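(* Let $d\ge 1$ and let $F:\mathbb{R}^{d+1}_+\to\mathbb{R}$ be a harmonic function. Assume that $\nabla F$ is weakly quasiregular. (1) If $\nabla F\in\mathcal{B}(\mathbb{R}^{d+1}_+)$, then $\mathrm{Dim}(\mathcal{D}(\nabla F)\cap Q)=d$ for any cube $Q\subset\mathbb{R}^d$. (2) If $\nabla F\in\mathcal{B}_0(\mathbb{R}^{d+1}_+)$, then $\mathrm{Dim}(\mathcal{D}_0(\nabla F)\cap Q)=d$ for any cube $Q\subset\mathbb{R}^d$.
   Context: $\mathbb{R}^{d+1}_+=\{(x,y):x\in\mathbb{R}^d,\ y>0\}$ is the upper half-space; $\mathrm{Dim}$ denotes Hausdorff dimension; $l(Q)$ is the sidelength of a cube $Q$ (with sides parallel to the axes). $HF(x,y)$ is the $(d+1)\times(d+1)$ Hessian matrix of $F$ at $(x,y)$, $\|HF(x,y)\|^2$ is the sum of the squares of its entries, and $(HF)e$ denotes the matrix $HF$ applied to the vector $e$. Bloch condition: $\nabla F\in\mathcal{B}(\mathbb{R}^{d+1}_+)$ if $\sup_{(x,y)\in\mathbb{R}^{d+1}_+}y\,\|HF(x,y)\|<\infty$. Little Bloch condition: $\nabla F\in\mathcal{B}_0(\mathbb{R}^{d+1}_+)$ if $\sup_{x\in\mathbb{R}^d}y\,\|HF(x,y)\|\to0$ as $y\to0$. Weak quasiregularity: $\nabla F$ is weakly quasiregular if there exist an integer $N\ge2$ and a constant $\gamma\ge1$ such that for every cube $Q\subset\mathbb{R}^d$ $$\int_{C_{1/N}(Q)}\max_{|e|=1}|(HF)e(x,y)|^2\,dx\,dy\le\gamma^2\min_{|e|=1}\int_{C_{1/N}(Q)}|(HF)e(x,y)|^2\,dx\,dy,$$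 where $C_{1/N}(Q)=Q\times[l(Q)/N,\,l(Q)]$ and the max and min are over unit vectors $e\in\mathbb{R}^{d+1}$. Boundary sets: $\mathcal{D}(\nabla F)=\{x\in\mathbb{R}^d:\limsup_{y\to0}|\nabla F(x,y)|<\infty\}$ and $\mathcal{D}_0(\nabla F)=\{x\in\mathbb{R}^d:\lim_{y\to0}\nabla F(x,y)\text{ exists}\}$. *)

theory Defs
  imports "HOL-Analysis.Analysis"
begin

definition partial :: "'a::euclidean_space \<Rightarrow> ('a \<Rightarrow> real) \<Rightarrow> 'a \<Rightarrow> real" where
  "partial b f z = frechet_derivative f (at z) b"

definition grad :: "('a::euclidean_space \<Rightarrow> real) \<Rightarrow> 'a \<Rightarrow> 'a" where
  "grad f z = (\<Sum>b\<in>Basis. partial b f z *\<^sub>R b)"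

definition hess :: "('a::euclidean_space \<Rightarrow> real) \<Rightarrow> 'a \<Rightarrow> 'a \<Rightarrow> 'a \<Rightarrow> real" where
  "hess f z b c = partial b (partial c f) z"

definition hess_norm :: "('a::euclidean_space \<Rightarrow> real) \<Rightarrow> 'a \<Rightarrow> real" where
  "hess_norm f z = sqrt (\<Sum>b\<in>Basis. \<Sum>c\<in>Basis. (hess f z b c)\<^sup>2)"

definition hess_apply :: "('a::euclidean_space \<Rightarrow> real) \<Rightarrow> 'a \<Rightarrow> 'a \<Rightarrow> 'a" where
  "hess_apply f z e = (\<Sum>b\<in>Basis. (\<Sum>c\<in>Basis. hess f z b c * (e \<bullet> c)) *\<^sub>R b)"

text \<open>Only used on open sets \<open>S\<close>, where the unrestricted derivatives in \<^const>\<open>partial\<close>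
  do not see the values of the function outside \<open>S\<close>.\<close>

definition C2_on :: "('a::euclidean_space \<Rightarrow> real) \<Rightarrow> 'a set \<Rightarrow> bool" where
  "C2_on f S \<longleftrightarrow>
     f differentiable_on S \<and>
     (\<forall>b\<in>Basis. partial b f differentiable_on S) \<and>
     (\<forall>b\<in>Basis. \<forall>c\<in>Basis. continuous_on S (\<lambda>z. hess f z b c))"

definition harmonic_on :: "('a::euclidean_space \<Rightarrow> real) \<Rightarrow> 'a set \<Rightarrow> bool" where
  "harmonic_on f S \<longleftrightarrow> C2_on f S \<and> (\<forall>z\<in>S. (\<Sum>b\<in>Basis. hess f z b b) = 0)"

definition upper_half_space :: "('a::euclidean_space \<times> real) set" where
  "upper_half_space = {(x, y). y > 0}"

definition cube :: "'a::euclidean_space \<Rightarrow> real \<Rightarrow> 'a set" where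
  "cube a l = cbox a (a + l *\<^sub>R One)"

text \<open>The three conditions on \<open>\<nabla>F\<close> are stated as predicates of \<open>F\<close>. Suprema are taken in
  \<^typ>\<open>ereal\<close>, where an unbounded set has supremum \<open>\<infinity>\<close>.\<close>

definition grad_Bloch :: "('a::euclidean_space \<times> real \<Rightarrow> real) \<Rightarrow> bool" where
  "grad_Bloch F \<longleftrightarrow>
     (SUP (x, y)\<in>upper_half_space. ereal (y * hess_norm F (x, y))) < \<infinity>"

definition grad_little_Bloch :: "('a::euclidean_space \<times> real \<Rightarrow> real) \<Rightarrow> bool" where
  "grad_little_Bloch F \<longleftrightarrow>
     ((\<lambda>y. SUP x. ereal (y * hess_norm F (x, y))) \<longlongrightarrow> 0) (at_right 0)"

text \<open>For \<open>F\<close> of class \<open>C\<^sup>2\<close> on the half-space, the real supremum and infimum over the unit sphere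
  below are attained, and the integrands are continuous on the compact box.\<close>

definition grad_weakly_quasiregular :: "('a::euclidean_space \<times> real \<Rightarrow> real) \<Rightarrow> bool" where
  "grad_weakly_quasiregular F \<longleftrightarrow>
     (\<exists>N::nat. \<exists>\<gamma>::real. N \<ge> 2 \<and> \<gamma> \<ge> 1 \<and>
       (\<forall>a l. l > 0 \<longrightarrow>
         integral (cube a l \<times> {l / real N..l})
           (\<lambda>z. SUP e\<in>sphere 0 1. (norm (hess_apply F z e))\<^sup>2)
         \<le> \<gamma>\<^sup>2 * (INF e\<in>sphere 0 1.
             integral (cube a l \<times> {l / real N..l}) (\<lambda>z. (norm (hess_apply F z e))\<^sup>2))))"

definition bounded_boundary_set :: "('a::euclidean_space \<times> real \<Rightarrow> real) \<Rightarrow> 'a set" where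
  "bounded_boundary_set F =
     {x. Limsup (at_right 0) (\<lambda>y. ereal (norm (grad F (x, y)))) < \<infinity>}"

definition convergent_boundary_set :: "('a::euclidean_space \<times> real \<Rightarrow> real) \<Rightarrow> 'a set" where
  "convergent_boundary_set F = {x. \<exists>L. ((\<lambda>y. grad F (x, y)) \<longlongrightarrow> L) (at_right 0)}"

text \<open>Covers are required to be bounded because \<^const>\<open>diameter\<close> is unspecified on
  unbounded sets.\<close>

definition hausdorff_premeasure :: "real \<Rightarrow> real \<Rightarrow> 'a::metric_space set \<Rightarrow> ennreal" where
  "hausdorff_premeasure s \<delta> A =
     (INF U\<in>{U :: nat \<Rightarrow> 'a set. A \<subseteq> (\<Union>i. U i) \<and> (\<forall>i. bounded (U i) \<and> diameter (U i) \<le> \<delta>)}.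
        \<Sum>i. ennreal (diameter (U i) powr s))"

definition hausdorff_measure :: "real \<Rightarrow> 'a::metric_space set \<Rightarrow> ennreal" where
  "hausdorff_measure s A = (SUP \<delta>\<in>{0<..}. hausdorff_premeasure s \<delta> A)"

text \<open>Restricting to \<open>s > 0\<close> does not change the infimum; it avoids \<open>s = 0\<close>, where
  \<open>0 powr 0 = 0\<close> would make the measure above differ from counting measure.\<close>

definition hausdorff_dim :: "'a::metric_space set \<Rightarrow> ennreal" where
  "hausdorff_dim A = (INF s\<in>{s. s > 0 \<and> hausdorff_measure s A = 0}. ennreal s)"

end

theory Submission
  imports Defs
begin

text \<open>The gradient is followed down the tree of \<open>N\<close>-adic subcubes of a cube, evaluated at the point above the
  corner of each cube at height equal to its sidelength. Let \<open>\<epsilon>\<close> bound \<open>y \<parallel>HF\<parallel>\<close> at the scales in question, and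
  stop as soon as the gradient has moved by \<open>M \<epsilon>\<close>. Green's formula with weight \<open>y\<close>, applied to \<open>u = e \<bullet> \<nabla>F\<close>
  and to \<open>(u - c)\<^sup>2\<close>, shows that the mean displacement is \<open>O(\<epsilon>)\<close> and that the second moment in direction \<open>e\<close>
  is the energy of \<open>(HF)e\<close> over the Whitney boxes before stopping, up to \<open>O(M \<epsilon>\<^sup>2)\<close>. By weak quasiregularity the
  energies in all directions are comparable, so if at least half of the volume is stopped, then a proportion of the
  stopped cubes, independent of \<open>M\<close>, has moved by a multiple of \<open>M \<epsilon>\<close> towards any prescribed target value. Keeping these
  cubes and iterating gives a Cantor set on which the gradient stays within \<open>O(M \<epsilon>)\<close> of the target; the sidelengths
  shrink at each step by a factor exponentially small in \<open>M\<close>, so its dimension tends to the full dimension as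
  \<open>M\<close> grows. If instead more than half of the volume of some cube is never stopped, the Bloch case is immediate, and in the
  little Bloch case one descends until \<open>\<epsilon>\<close> has halved and restarts there with a new target, the targets forming a
  Cauchy sequence.\<close>

subsection \<open>Integrals of partial derivatives over cubes\<close>

text \<open>The order of the choices: \<open>s\<close> below the full dimension fixes
  \<open>\<rho>\<close>, and \<open>\<rho>\<close> fixes \<open>M\<close>. The kept proportion is
  \<open>c\<^sub>1 / 16\<close> for every \<open>M\<close>, so a shrinking factor with
  \<open>\<rho> powr (DIM('a) - s) \<le> c\<^sub>1 / 16\<close> keeps the
  \<open>s\<close>-dimensional mass from decreasing over a generation. Then \<open>M\<close> is
  taken so large that a displacement by \<open>c\<^sub>1 / 16 * M * \<epsilon>\<close> cannot happen
  at scales above \<open>\<rho>\<close> times the initial one, the gradient growing only like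
  \<open>\<epsilon>\<close> times the logarithm of the scale. No measure on the Cantor set is built.
  A hypothetical cheap cover charges a cost to each cube of the tree; if the cost of a cube is below
  its mass, the same holds for one of its children. The resulting infinite chain shrinks to a point
  of the set that the cover has to miss.\<close>

lemma abs_integral_cbox_le:
  fixes f :: "'a::euclidean_space \<Rightarrow> real"
  assumes "0 \<le> B" "continuous_on (cbox a b) f" "\<And>x. x \<in> cbox a b \<Longrightarrow> \<bar>f x\<bar> \<le> B"
  shows "\<bar>integral (cbox a b) f\<bar> \<le> B * measure lborel (cbox a b)"
proof -
  have "(f has_integral integral (cbox a b) f) (cbox a b)"
    using assms(2) integrable_continuous by blast
  from has_integral_bound[OF assms(1) this] assms(3) show ?thesis by simp
qed

lemma content_cube:
  fixes a :: "'a::euclidean_space"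
  assumes "0 \<le> l" shows "measure lborel (cube a l) = l ^ DIM('a)"
  using assms by (simp add: cube_def content_cbox inner_simps)

lemma content_slab:
  fixes a :: "'a::euclidean_space"
  assumes i: "i \<in> Basis" and l: "0 \<le> l" and h: "0 \<le> h"
  shows "measure lborel (cbox a (a + l *\<^sub>R One - (l - h) *\<^sub>R i)) = h * l ^ (DIM('a) - 1)"
proof -
  have "measure lborel (cbox a (a + l *\<^sub>R One - (l - h) *\<^sub>R i)) = (\<Prod>j\<in>Basis. if j = i then h else l)"
    using i l h by (subst content_cbox) (auto simp: inner_simps inner_Basis intro!: prod.cong)
  also have "\<dots> = h * l ^ (DIM('a) - 1)"
    using i by (subst prod.remove[OF _ i]) (auto simp: card_Diff_singleton)
  finally show ?thesis .
qed

lemma continuous_on_cbox_modulus: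
  fixes f :: "'a::euclidean_space \<Rightarrow> real"
  assumes "compact S" "continuous_on S f" "0 < e"
  obtains d where "0 < d" "\<And>x y. x \<in> S \<Longrightarrow> y \<in> S \<Longrightarrow> dist x y < d \<Longrightarrow> \<bar>f x - f y\<bar> < e"
  using compact_uniformly_continuous[OF assms(2,1)] assms(3)
  unfolding uniformly_continuous_on_def dist_real_def by (metis abs_minus_commute)

text \<open>The difference of the integrals of \<open>g\<close> over two translates of the cube, at distance \<open>h\<close>, is carried by
  two slabs of thickness \<open>h\<close>. This replaces Fubini's theorem in a coordinate direction.\<close>

lemma abs_integral_partial_le_aux:
  fixes g g' :: "'a::euclidean_space \<Rightarrow> real"
  assumes i: "i \<in> Basis" and l: "0 < l"
    and g: "continuous_on (cube a l) g" and g': "continuous_on (cube a l) g'"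
    and der: "\<And>x. x \<in> cube a l \<Longrightarrow> ((\<lambda>s. g (x + s *\<^sub>R i)) has_real_derivative g' x) (at 0)"
    and b: "\<And>x. x \<in> cube a l \<Longrightarrow> \<bar>g x\<bar> \<le> \<beta>"
    and C: "\<And>x. x \<in> cube a l \<Longrightarrow> \<bar>g' x\<bar> \<le> C"
    and h: "0 < h" "h \<le> l"
    and om: "\<And>x y. x \<in> cube a l \<Longrightarrow> y \<in> cube a l \<Longrightarrow> dist x y \<le> h \<Longrightarrow> \<bar>g' x - g' y\<bar> \<le> \<omega>"
  shows "\<bar>integral (cube a l) g'\<bar> \<le> 2 * \<beta> * l ^ (DIM('a) - 1) + \<omega> * l ^ DIM('a) + C * (h * l ^ (DIM('a) - 1))"
proof -
  define n where "n = DIM('a)"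
  define b where "b = a + l *\<^sub>R (One::'a)"
  \<comment> \<open>\<open>Qh\<close> is the part of the cube that stays inside under translation by
    \<open>h\<close> along \<open>i\<close>; \<open>Bo\<close> and \<open>To\<close> are the slabs
    of thickness \<open>h\<close> at the two ends of the cube.\<close>
  define Qh where "Qh = cbox a (b - h *\<^sub>R i)"
  define Bo where "Bo = cbox a (a + l *\<^sub>R One - (l - h) *\<^sub>R i)"
  define To where "To = cbox (a + (l - h) *\<^sub>R i) b"
  have Q: "cube a l = cbox a b" by (simp add: cube_def b_def)
  have bi: "b \<bullet> j = a \<bullet> j + l" if "j \<in> Basis" for j using that by (simp add: b_def inner_simps)
  have ii: "i \<bullet> j = (if j = i then 1 else 0)" if "j \<in> Basis" for j
    using that i by (simp add: inner_Basis)
  have aQ: "a \<in> cube a l" using l by (auto simp: Q mem_box bi)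
  have \<beta>: "0 \<le> \<beta>" and C0: "0 \<le> C" and \<omega>: "0 \<le> \<omega>" using b[OF aQ] C[OF aQ] om[OF aQ aQ] h by auto
  have s1: "cbox a b \<inter> {x. x \<bullet> i \<le> a \<bullet> i + h} = Bo"
    using i l h by (auto simp: Bo_def mem_box bi ii inner_simps) (drule bspec, assumption, fastforce split: if_splits)+
  have s2: "cbox a b \<inter> {x. x \<bullet> i \<ge> a \<bullet> i + h} = cbox (a + h *\<^sub>R i) b"
    using i l h by (auto simp: mem_box bi ii inner_simps) (drule bspec, assumption, fastforce split: if_splits)+
  have s3: "cbox a b \<inter> {x. x \<bullet> i \<le> a \<bullet> i + (l - h)} = Qh"
    using i l h by (auto simp: Qh_def mem_box bi ii inner_simps) (drule bspec, assumption, fastforce split: if_splits)+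
  have s4: "cbox a b \<inter> {x. x \<bullet> i \<ge> a \<bullet> i + (l - h)} = To"
    using i l h by (auto simp: To_def mem_box bi ii inner_simps) (drule bspec, assumption, fastforce split: if_splits)+
  have sub: "Qh \<subseteq> cube a l" "Bo \<subseteq> cube a l" "To \<subseteq> cube a l" using s1 s3 s4 Q by blast+
  have sh: "x + s *\<^sub>R i \<in> cube a l" if "x \<in> Qh" "0 \<le> s" "s \<le> h" for x s
    using that h i unfolding Qh_def Q mem_box
    by (auto simp: inner_simps bi ii split: if_splits)
  have cB: "measure lborel Bo = h * l ^ (n - 1)" unfolding Bo_def n_def using content_slab[OF i] l h by simp
  have To_eq: "To = cbox (a + (l - h) *\<^sub>R i) ((a + (l - h) *\<^sub>R i) + l *\<^sub>R One - (l - h) *\<^sub>R i)"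
    by (simp add: To_def b_def)
  have cT: "measure lborel To = h * l ^ (n - 1)" using content_slab[OF i, of l h "a + (l - h) *\<^sub>R i"] l h by (simp only: To_eq n_def)
  have "measure lborel Qh \<le> measure lborel (cbox a b)"
    unfolding Qh_def using s3 by (intro content_subset) (metis Qh_def Int_lower1)
  hence cQ: "measure lborel Qh \<le> l ^ n" using content_cube[of l a] l by (simp add: Q n_def)
  have gi: "g integrable_on cbox a b" "g' integrable_on cbox a b"
    using g g' by (auto simp: Q intro: integrable_continuous)
  have cQh: "continuous_on Qh g" "continuous_on Qh g'" "continuous_on Bo g" "continuous_on To g"
      "continuous_on To g'"
    using g g' sub continuous_on_subset by blast+
  have iBo: "\<bar>integral Bo g\<bar> \<le> \<beta> * (h * l ^ (n - 1))"
    using abs_integral_cbox_le[of \<beta> _ _ g] \<beta> cQh(3) b sub(2) cB unfolding Bo_def by (metis subsetD)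
  have iTo: "\<bar>integral To g\<bar> \<le> \<beta> * (h * l ^ (n - 1))"
    using abs_integral_cbox_le[of \<beta> _ _ g] \<beta> cQh(4) b sub(3) cT unfolding To_def by (metis subsetD)
  have iTo': "\<bar>integral To g'\<bar> \<le> C * (h * l ^ (n - 1))"
    using abs_integral_cbox_le[of C _ _ g'] C0 cQh(5) C sub(3) cT unfolding To_def by (metis subsetD)
  have 1: "integral (cbox a b) g = integral Bo g + integral (cbox (a + h *\<^sub>R i) b) g"
    using integral_split[OF gi(1) i, of "a \<bullet> i + h"] by (simp add: s1 s2)
  have 2: "integral (cbox a b) g = integral Qh g + integral To g"
    using integral_split[OF gi(1) i, of "a \<bullet> i + (l - h)"] by (simp add: s3 s4)
  have 3: "integral (cbox a b) g' = integral Qh g' + integral To g'"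
    using integral_split[OF gi(2) i, of "a \<bullet> i + (l - h)"] by (simp add: s3 s4)
  have "(g has_integral integral (cbox (a + h *\<^sub>R i) b) g) (cbox (a + h *\<^sub>R i) b)"
    using g by (intro integrable_integral integrable_continuous) (metis Q Int_lower1 s2 continuous_on_subset)
  from has_integral_affinity'[OF this, of 1 "h *\<^sub>R i"]
  have sft: "((\<lambda>x. g (x + h *\<^sub>R i)) has_integral integral (cbox (a + h *\<^sub>R i) b) g) Qh"
    by (simp add: Qh_def)
  have iQ: "(g has_integral integral Qh g) Qh" "(g' has_integral integral Qh g') Qh"
    using cQh unfolding Qh_def by (auto intro: integrable_continuous)
  have I: "((\<lambda>x. g (x + h *\<^sub>R i) - g x - h * g' x) has_integral
      integral (cbox (a + h *\<^sub>R i) b) g - integral Qh g - h * integral Qh g') Qh"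
    by (intro has_integral_diff sft iQ has_integral_mult_right)
  \<comment> \<open>The mean value theorem evaluates \<open>g'\<close> at a point within
    \<open>h\<close> of \<open>x\<close>, so trading the difference quotient for \<open>g' x\<close>
    costs at most \<open>\<omega>\<close>.\<close>
  have B: "norm (g (x + h *\<^sub>R i) - g x - h * g' x) \<le> h * \<omega>" if x: "x \<in> Qh" for x
  proof -
    have d: "((\<lambda>s. g (x + s *\<^sub>R i)) has_real_derivative g' (x + s *\<^sub>R i)) (at s)" if "0 \<le> s" "s \<le> h" for s
      using DERIV_shift[of "\<lambda>s. g (x + s *\<^sub>R i)" "g' (x + s *\<^sub>R i)" 0 s] der[OF sh[OF x that]]
      by (simp add: algebra_simps)
    obtain z where z: "0 < z" "z < h" "g (x + h *\<^sub>R i) - g (x + 0 *\<^sub>R i) = (h - 0) * g' (x + z *\<^sub>R i)"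
      using MVT2[of 0 h "\<lambda>s. g (x + s *\<^sub>R i)" "\<lambda>s. g' (x + s *\<^sub>R i)"] d h(1) by auto
    have "\<bar>g' (x + z *\<^sub>R i) - g' x\<bar> \<le> \<omega>"
      using z sh[OF x] sub x i h by (intro om) (auto simp: dist_norm)
    hence "h * \<bar>g' (x + z *\<^sub>R i) - g' x\<bar> \<le> h * \<omega>" using h by simp
    moreover have "g (x + h *\<^sub>R i) - g x - h * g' x = h * (g' (x + z *\<^sub>R i) - g' x)"
      using z by (simp add: algebra_simps)
    ultimately show ?thesis using h by (simp add: abs_mult)
  qed
  have "\<bar>integral (cbox (a + h *\<^sub>R i) b) g - integral Qh g - h * integral Qh g'\<bar> \<le> h * \<omega> * measure lborel Qh"
    using has_integral_bound[OF _ I[unfolded Qh_def] B[unfolded Qh_def]] \<omega> h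
    unfolding Qh_def real_norm_def by simp
  also have "\<dots> \<le> h * \<omega> * l ^ n" using cQ \<omega> h by (simp add: mult_left_mono)
  \<comment> \<open>The translate of \<open>Qh\<close> misses \<open>Bo\<close> and
    \<open>Qh\<close> itself misses \<open>To\<close>, so the integrals of \<open>g\<close> over the
    two differ by the difference of the slab integrals.\<close>
  finally have "\<bar>h * integral Qh g'\<bar> \<le> h * \<omega> * l ^ n + \<bar>integral To g - integral Bo g\<bar>"
    using 1 2 by linarith
  hence "h * \<bar>integral Qh g'\<bar> \<le> h * (\<omega> * l ^ n + 2 * \<beta> * l ^ (n - 1))"
    using iBo iTo h by (simp add: abs_mult algebra_simps)
  hence "\<bar>integral Qh g'\<bar> \<le> \<omega> * l ^ n + 2 * \<beta> * l ^ (n - 1)" using h by simp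
  thus ?thesis using 3 iTo' unfolding Q n_def by linarith
qed

text \<open>Let \<open>h\<close> tend to 0 in the previous bound: the term with
  \<open>\<omega>\<close> disappears by uniform continuity of \<open>g'\<close>, the term with
  \<open>C\<close> because the slab gets thin. What remains is the flux through the two faces
  orthogonal to \<open>i\<close>.\<close>

lemma abs_integral_partial_le:
  fixes g g' :: "'a::euclidean_space \<Rightarrow> real"
  assumes i: "i \<in> Basis" and l: "0 < l"
    and g: "continuous_on (cube a l) g" and g': "continuous_on (cube a l) g'"
    and der: "\<And>x. x \<in> cube a l \<Longrightarrow> ((\<lambda>s. g (x + s *\<^sub>R i)) has_real_derivative g' x) (at 0)"
    and b: "\<And>x. x \<in> cube a l \<Longrightarrow> \<bar>g x\<bar> \<le> \<beta>"
  shows "\<bar>integral (cube a l) g'\<bar> \<le> 2 * \<beta> * l ^ (DIM('a) - 1)"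
proof (rule field_le_epsilon)
  fix e :: real assume e: "0 < e"
  have cmp: "compact (cube a l)" by (simp add: cube_def)
  have "compact (g' ` cube a l)" using cmp g' compact_continuous_image by blast
  then obtain C where C: "\<And>x. x \<in> cube a l \<Longrightarrow> \<bar>g' x\<bar> \<le> C" "0 < C"
    using compact_imp_bounded bounded_pos by (metis imageI real_norm_def)
  define \<omega> where "\<omega> = e / 2 / l ^ DIM('a)"
  have \<omega>: "0 < \<omega>" using e l by (simp add: \<omega>_def)
  obtain d where d: "0 < d" "\<And>x y. x \<in> cube a l \<Longrightarrow> y \<in> cube a l \<Longrightarrow> dist x y < d \<Longrightarrow> \<bar>g' x - g' y\<bar> < \<omega>"
    using continuous_on_cbox_modulus[OF cmp g' \<omega>] by metis
  define h where "h = Min {d / 2, l, e / 2 / (C * l ^ (DIM('a) - 1))}"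
  have h: "0 < h" "h \<le> l" "h \<le> d / 2" "h \<le> e / 2 / (C * l ^ (DIM('a) - 1))"
    using d l e C by (auto simp: h_def)
  have "\<bar>integral (cube a l) g'\<bar> \<le> 2 * \<beta> * l ^ (DIM('a) - 1) + \<omega> * l ^ DIM('a) + C * (h * l ^ (DIM('a) - 1))"
    by (rule abs_integral_partial_le_aux[OF i l g g' der b C(1) h(1,2)]) (use d h in \<open>force+\<close>)
  also have "\<omega> * l ^ DIM('a) = e / 2" using l by (simp add: \<omega>_def)
  also have "C * (h * l ^ (DIM('a) - 1)) \<le> e / 2"
  proof -
    have "h * (C * l ^ (DIM('a) - 1)) \<le> e / 2" using h(4) C l by (subst (asm) pos_le_divide_eq) auto
    thus ?thesis by (simp add: mult_ac)
  qed
  finally show "\<bar>integral (cube a l) g'\<bar> \<le> 2 * \<beta> * l ^ (DIM('a) - 1) + e" by simp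
qed

subsection \<open>Green's formula on a box\<close>

lemma sum_Basis_prod_real:
  fixes f :: "'a::euclidean_space \<times> real \<Rightarrow> 'b::comm_monoid_add"
  shows "sum f Basis = (\<Sum>i\<in>Basis. f (i, 0)) + f (0, 1)"
proof -
  have "inj_on (\<lambda>u. (u::'a, 0::real)) Basis" by (auto intro!: inj_onI)
  thus ?thesis
    unfolding Basis_prod_def by (subst sum.union_disjoint) (auto simp: sum.reindex)
qed

lemma has_integral_log_bound:
  fixes t l A B :: real
  assumes "0 < t" "t \<le> l"
  shows "((\<lambda>y. A + B * ln (l / y)) has_integral (A * l + B * l - (A * t + B * (t * ln (l / t) + t)))) {t..l}"
proof -
  have "((\<lambda>y. A + B * ln (l / y)) has_integral
      ((A * l + B * (l * ln (l / l) + l)) - (A * t + B * (t * ln (l / t) + t)))) {t..l}"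
  proof (rule fundamental_theorem_of_calculus[OF assms(2)])
    fix y assume y: "y \<in> {t..l}"
    have "((\<lambda>y. A * y + B * (y * ln (l / y) + y)) has_real_derivative (A + B * ln (l / y))) (at y)"
      using y assms by (auto intro!: derivative_eq_intros simp: field_simps)
    thus "((\<lambda>y. A * y + B * (y * ln (l / y) + y)) has_vector_derivative A + B * ln (l / y)) (at y within {t..l})"
      using has_real_derivative_iff_has_vector_derivative has_vector_derivative_at_within by blast
  qed
  thus ?thesis using assms by simp
qed

text \<open>The weight \<open>y\<close> is harmonic, and it makes the logarithmic growth of the tangential derivatives
  near the boundary integrable over the lateral faces.\<close>

lemma green_box:
  fixes \<phi> :: "'a::euclidean_space \<times> real \<Rightarrow> real" and t l A B :: real
  assumes tl: "0 < t" "t \<le> l" and AB: "0 \<le> A" "0 \<le> B"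
    and K: "K = cbox (a, t) (a + l *\<^sub>R One, l)"
    and c\<phi>: "continuous_on K \<phi>" and cG: "continuous_on K G"
    and cD: "\<And>b. b \<in> Basis \<Longrightarrow> continuous_on K (D b)"
    and der: "\<And>z. z \<in> K \<Longrightarrow> (\<phi> has_derivative (\<lambda>h. h \<bullet> G z)) (at z)"
    and der2: "\<And>z b. z \<in> K \<Longrightarrow> b \<in> Basis \<Longrightarrow> ((\<lambda>s. G (z + s *\<^sub>R b) \<bullet> b) has_real_derivative D b z) (at 0)"
    and bd: "\<And>x y i. (x, y) \<in> K \<Longrightarrow> i \<in> Basis \<Longrightarrow> \<bar>y * (G (x, y) \<bullet> (i, 0))\<bar> \<le> A + B * ln (l / y)"
  shows "\<bar>integral K (\<lambda>z. snd z * (\<Sum>b\<in>Basis. D b z))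
      - (integral (cube a l) (\<lambda>x. l * (G (x, l) \<bullet> (0, 1)) - \<phi> (x, l))
       - integral (cube a l) (\<lambda>x. t * (G (x, t) \<bullet> (0, 1)) - \<phi> (x, t)))\<bar>
    \<le> 2 * DIM('a) * l ^ DIM('a) * (A + B)"
proof -
  have l: "0 < l" using tl by simp
  have Q: "cube a l = cbox a (a + l *\<^sub>R One)" by (simp add: cube_def)
  have inK: "(x, y) \<in> K \<longleftrightarrow> x \<in> cube a l \<and> y \<in> {t..l}" for x y by (simp add: K Q)
  have cD': "continuous_on K (\<lambda>z. snd z * D b z)" if "b \<in> Basis" for b
    using cD[OF that] by (intro continuous_intros)
  have iD: "(\<lambda>z. snd z * D b z) integrable_on K" if "b \<in> Basis" for b
    using cD'[OF that] unfolding K by (rule integrable_continuous)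
  have sl: "continuous_on {t..l} (\<lambda>y. (x, y))" "continuous_on (cube a l) (\<lambda>x. (x, y))" for x y
    by (auto intro!: continuous_intros)
  have cs: "continuous_on {t..l} (\<lambda>y. f (x, y))" if "continuous_on K f" "x \<in> cube a l" for f :: "_ \<Rightarrow> 'b::topological_space" and x
    using that inK by (auto intro!: continuous_on_compose2[OF that(1) sl(1)])
  have cs2: "continuous_on (cube a l) (\<lambda>x. f (x, y))" if "continuous_on K f" "y \<in> {t..l}" for f :: "_ \<Rightarrow> 'b::topological_space" and y
    using that inK by (auto intro!: continuous_on_compose2[OF that(1) sl(2)])
  have i1: "(0, 1) \<in> (Basis :: ('a \<times> real) set)" by (simp add: Basis_prod_def)
  have i2: "(i, 0) \<in> (Basis :: ('a \<times> real) set)" if "i \<in> Basis" for i using that by (simp add: Basis_prod_def)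
  have "integral K (\<lambda>z. snd z * (\<Sum>b\<in>Basis. D b z)) = (\<Sum>b\<in>Basis. integral K (\<lambda>z. snd z * D b z))"
    unfolding sum_distrib_left by (rule integral_sum) (auto intro: iD)
  also have "\<dots> = (\<Sum>i\<in>Basis. integral K (\<lambda>z. snd z * D (i, 0) z)) + integral K (\<lambda>z. snd z * D (0, 1) z)"
    by (rule sum_Basis_prod_real)
  finally have split: "integral K (\<lambda>z. snd z * (\<Sum>b\<in>Basis. D b z)) = \<dots>" .
  \<comment> \<open>In the vertical direction the weighted integrand is an exact derivative:
    \<open>y\<close> times the second derivative of \<open>\<phi>\<close> is the derivative of
    \<open>y\<close> times the first one minus \<open>\<phi>\<close>.\<close>
  have vert: "integral K (\<lambda>z. snd z * D (0, 1) z) =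
      integral (cube a l) (\<lambda>x. l * (G (x, l) \<bullet> (0, 1)) - \<phi> (x, l))
       - integral (cube a l) (\<lambda>x. t * (G (x, t) \<bullet> (0, 1)) - \<phi> (x, t))"
  proof -
    have "integral K (\<lambda>z. snd z * D (0, 1) z) = integral (cube a l) (\<lambda>x. integral (cbox t l) (\<lambda>y. y * D (0, 1) (x, y)))"
      using integral_prod_continuous[OF cD'[OF i1, unfolded K]] by (simp add: K Q)
    also have "\<dots> = integral (cube a l) (\<lambda>x. (l * (G (x, l) \<bullet> (0, 1)) - \<phi> (x, l)) - (t * (G (x, t) \<bullet> (0, 1)) - \<phi> (x, t)))"
    proof (rule integral_cong)
      fix x assume x: "x \<in> cube a l"
      have "((\<lambda>y. y * D (0, 1) (x, y)) has_integral
         (l * (G (x, l) \<bullet> (0, 1)) - \<phi> (x, l)) - (t * (G (x, t) \<bullet> (0, 1)) - \<phi> (x, t))) {t..l}"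
      proof (rule fundamental_theorem_of_calculus[OF tl(2)])
        fix y assume y: "y \<in> {t..l}"
        have z: "(x, y) \<in> K" using x y inK by simp
        have 1: "((\<lambda>y. \<phi> (x, y)) has_real_derivative G (x, y) \<bullet> (0, 1)) (at y)"
        proof -
          have "((\<lambda>y. \<phi> (x, y)) has_derivative (\<lambda>h. (0, h) \<bullet> G (x, y))) (at y)"
            using der[OF z] by (intro has_derivative_compose[where f = "\<lambda>y. (x, y)" and f' = "\<lambda>h. (0, h)"
              and g = \<phi> and g' = "\<lambda>h. h \<bullet> G (x, y)"] derivative_eq_intros) auto
          thus ?thesis unfolding has_field_derivative_def
            by (rule has_derivative_eq_rhs) (auto simp: inner_prod_def mult.commute)
        qed
        have 2: "((\<lambda>y. G (x, y) \<bullet> (0, 1)) has_real_derivative D (0, 1) (x, y)) (at y)"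
          using der2[OF z i1] DERIV_shift[of "\<lambda>y. G (x, y) \<bullet> (0, 1)" "D (0, 1) (x, y)" 0 y] by (simp add: add.commute)
        have "((\<lambda>y. y * (G (x, y) \<bullet> (0, 1)) - \<phi> (x, y)) has_real_derivative y * D (0, 1) (x, y)) (at y)"
          by (rule derivative_eq_intros 1 2 refl)+ simp
        thus "((\<lambda>y. y * (G (x, y) \<bullet> (0, 1)) - \<phi> (x, y)) has_vector_derivative y * D (0, 1) (x, y)) (at y within {t..l})"
          using has_real_derivative_iff_has_vector_derivative has_vector_derivative_at_within by blast
      qed
      thus "integral (cbox t l) (\<lambda>y. y * D (0, 1) (x, y)) =
        (l * (G (x, l) \<bullet> (0, 1)) - \<phi> (x, l)) - (t * (G (x, t) \<bullet> (0, 1)) - \<phi> (x, t))"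
        by (simp add: integral_unique)
    qed
    also have "\<dots> = integral (cube a l) (\<lambda>x. l * (G (x, l) \<bullet> (0, 1)) - \<phi> (x, l))
       - integral (cube a l) (\<lambda>x. t * (G (x, t) \<bullet> (0, 1)) - \<phi> (x, t))"
      unfolding Q
      by (rule integral_diff; rule integrable_continuous; unfold Q[symmetric])
         (use tl in \<open>auto intro!: continuous_intros cs2 cG c\<phi>\<close>)
    finally show ?thesis .
  qed
  \<comment> \<open>For fixed \<open>y\<close> the slice integral is controlled by the weighted
    tangential derivative on two opposite faces, that is by \<open>A + B * ln (l / y)\<close>. The
    integral of this over \<open>y\<close> is at most \<open>(A + B) * l\<close>, uniformly in
    \<open>t\<close>.\<close>
  have side: "\<bar>integral K (\<lambda>z. snd z * D (i, 0) z)\<bar> \<le> 2 * l ^ DIM('a) * (A + B)" if i: "i \<in> Basis" for i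
  proof -
    let ?D = "\<lambda>x y. y * D (i, 0) (x, y)"
    have c2: "continuous_on (cbox (a, t) (a + l *\<^sub>R One, l)) (\<lambda>(x, y). ?D x y)"
      using cD'[OF i2[OF i]] by (simp add: K case_prod_unfold)
    have c3: "continuous_on (cbox (t, a) (l, a + l *\<^sub>R One)) (\<lambda>(y, x). ?D x y)"
    proof -
      have "continuous_on (prod.swap ` cbox (a, t) (a + l *\<^sub>R One, l)) ((\<lambda>(x, y). ?D x y) \<circ> prod.swap)"
        using c2 by (intro continuous_on_compose continuous_on_swap) (auto simp: image_image)
      thus ?thesis unfolding swap_cbox_Pair by (simp add: comp_def case_prod_unfold prod.swap_def)
    qed
    have "integral K (\<lambda>z. snd z * D (i, 0) z) = integral (cube a l) (\<lambda>x. integral (cbox t l) (?D x))"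
      using integral_prod_continuous[OF cD'[OF i2[OF i], unfolded K]] by (simp add: K Q)
    also have "\<dots> = integral (cbox t l) (\<lambda>y. integral (cube a l) (\<lambda>x. ?D x y))"
      unfolding Q by (rule integral_swap_continuous[OF c2])
    finally have eq: "integral K (\<lambda>z. snd z * D (i, 0) z) = \<dots>" .
    have "norm (integral {t..l} (\<lambda>y. integral (cube a l) (\<lambda>x. ?D x y)))
      \<le> integral {t..l} (\<lambda>y. 2 * l ^ (DIM('a) - 1) * (A + B * ln (l / y)))"
    proof (rule integral_norm_bound_integral)
      show "(\<lambda>y. integral (cube a l) (\<lambda>x. ?D x y)) integrable_on {t..l}"
        using integral_integrable_2dim[OF c3] by (simp add: Q)
      show "(\<lambda>y. 2 * l ^ (DIM('a) - 1) * (A + B * ln (l / y))) integrable_on {t..l}"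
        using has_integral_mult_right[OF has_integral_log_bound[OF tl]] by (metis has_integral_integrable)
      fix y assume y: "y \<in> {t..l}"
      have "\<bar>integral (cube a l) (\<lambda>x. ?D x y)\<bar> \<le> 2 * (A + B * ln (l / y)) * l ^ (DIM('a) - 1)"
      proof (rule abs_integral_partial_le[OF i l])
        show "continuous_on (cube a l) (\<lambda>x. y * (G (x, y) \<bullet> (i, 0)))"
          by (intro continuous_intros cs2[OF cG y])
        show "continuous_on (cube a l) (\<lambda>x. ?D x y)"
          by (intro continuous_intros cs2[OF cD[OF i2[OF i]] y])
        fix x assume x: "x \<in> cube a l"
        have z: "(x, y) \<in> K" using x y inK by simp
        show "((\<lambda>s. y * (G (x + s *\<^sub>R i, y) \<bullet> (i, 0))) has_real_derivative y * D (i, 0) (x, y)) (at 0)"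
          using der2[OF z i2[OF i]] by (auto intro!: derivative_eq_intros)
        show "\<bar>y * (G (x, y) \<bullet> (i, 0))\<bar> \<le> A + B * ln (l / y)" by (rule bd[OF z i])
      qed
      thus "norm (integral (cube a l) (\<lambda>x. ?D x y)) \<le> 2 * l ^ (DIM('a) - 1) * (A + B * ln (l / y))"
        unfolding real_norm_def by (simp only: mult_ac)
    qed
    also have "\<dots> = 2 * l ^ (DIM('a) - 1) * (A * l + B * l - (A * t + B * (t * ln (l / t) + t)))"
      by (intro integral_unique has_integral_mult_right has_integral_log_bound tl)
    also have "\<dots> \<le> 2 * l ^ (DIM('a) - 1) * ((A + B) * l)"
    proof -
      have "0 \<le> A * t + B * (t * ln (l / t) + t)" using tl AB by simp
      thus ?thesis using l by (intro mult_left_mono) (auto simp: algebra_simps)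
    qed
    also have "\<dots> = 2 * l ^ DIM('a) * (A + B)"
      using power_minus_mult[of "DIM('a)" l] by (simp add: mult_ac)
    finally show ?thesis unfolding eq by simp
  qed
  have "\<bar>\<Sum>i\<in>Basis. integral K (\<lambda>z. snd z * D (i, 0) z)\<bar> \<le> (\<Sum>i\<in>(Basis::'a set). 2 * l ^ DIM('a) * (A + B))"
    by (rule order_trans[OF sum_abs sum_mono]) (rule side)
  thus ?thesis unfolding split vert by (simp add: mult_ac)
qed

subsection \<open>Gradient and Hessian of a function of class \<open>C\<^sup>2\<close>\<close>

lemma upper_half_space_iff: "z \<in> upper_half_space \<longleftrightarrow> 0 < snd z"
  by (cases z) (simp add: upper_half_space_def)

lemma open_upper_half_space: "open (upper_half_space :: ('a::euclidean_space \<times> real) set)"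
proof -
  have "open {z :: 'a \<times> real. 0 < snd z}" by (intro open_Collect_less continuous_intros)
  thus ?thesis by (simp add: upper_half_space_def case_prod_unfold)
qed

lemma grad_inner_Basis: "b \<in> Basis \<Longrightarrow> grad f z \<bullet> b = partial b f z"
  by (simp add: grad_def inner_sum_left inner_Basis if_distrib cong: if_cong)

lemma has_derivative_grad:
  assumes "f differentiable (at z)"
  shows "(f has_derivative (\<lambda>h. h \<bullet> grad f z)) (at z)"
proof -
  let ?D = "frechet_derivative f (at z)"
  have D: "(f has_derivative ?D) (at z)" using assms by (simp add: frechet_derivative_works)
  have lin: "linear ?D" using D has_derivative_linear by blast
  have "?D h = h \<bullet> grad f z" for h
  proof -
    have "?D h = ?D (\<Sum>b\<in>Basis. (h \<bullet> b) *\<^sub>R b)" by (simp add: euclidean_representation)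
    also have "\<dots> = (\<Sum>b\<in>Basis. (h \<bullet> b) * ?D b)" using lin by (simp add: linear_sum linear_cmul)
    also have "\<dots> = h \<bullet> grad f z" by (simp add: grad_def partial_def inner_sum_right mult.commute)
    finally show ?thesis .
  qed
  thus ?thesis using D by (metis (no_types, lifting) has_derivative_eq_rhs ext)
qed

lemma hess_grad: "b \<in> Basis \<Longrightarrow> grad (partial c f) z \<bullet> b = hess f z b c"
  by (simp add: hess_def grad_inner_Basis)

context
  fixes f :: "'a::euclidean_space \<Rightarrow> real" and S
  assumes C2: "C2_on f S" and S: "open S"
begin

lemma C2_on_differentiable: "z \<in> S \<Longrightarrow> f differentiable (at z)"
  using C2 S by (simp add: C2_on_def differentiable_on_eq_differentiable_at)

lemma C2_on_partial_differentiable: "z \<in> S \<Longrightarrow> b \<in> Basis \<Longrightarrow> partial b f differentiable (at z)"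
  using C2 S by (simp add: C2_on_def differentiable_on_eq_differentiable_at)

text \<open>Identifies \<open>hess_apply f z e\<close> as the gradient of the scalar function
  \<open>e \<bullet> grad f\<close>, so that Hessian energies in direction \<open>e\<close> become
  Dirichlet energies.\<close>

lemma C2_on_has_derivative_inner_grad:
  assumes "z \<in> S"
  shows "((\<lambda>z. e \<bullet> grad f z) has_derivative (\<lambda>h. h \<bullet> hess_apply f z e)) (at z)"
proof -
  have eq: "(\<lambda>z. e \<bullet> grad f z) = (\<lambda>z. \<Sum>c\<in>Basis. (e \<bullet> c) * partial c f z)"
    by (simp add: grad_def inner_sum_right mult.commute)
  have "((\<lambda>z. \<Sum>c\<in>Basis. (e \<bullet> c) * partial c f z) has_derivative
      (\<lambda>h. \<Sum>c\<in>Basis. (e \<bullet> c) * (h \<bullet> grad (partial c f) z))) (at z)"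
    by (intro has_derivative_sum has_derivative_mult_right has_derivative_grad C2_on_partial_differentiable assms)
  moreover have "(\<Sum>c\<in>Basis. (e \<bullet> c) * (h \<bullet> grad (partial c f) z)) = h \<bullet> hess_apply f z e" for h
  proof -
    have "(\<Sum>c\<in>Basis. (e \<bullet> c) * (h \<bullet> grad (partial c f) z)) =
      (\<Sum>c\<in>Basis. \<Sum>b\<in>Basis. (e \<bullet> c) * ((h \<bullet> b) * hess f z b c))"
      by (subst euclidean_inner) (simp add: hess_grad sum_distrib_left)
    also have "\<dots> = (\<Sum>b\<in>Basis. \<Sum>c\<in>Basis. (e \<bullet> c) * ((h \<bullet> b) * hess f z b c))" by (rule sum.swap)
    also have "\<dots> = h \<bullet> hess_apply f z e"
      by (simp add: hess_apply_def inner_sum_right sum_distrib_left sum_distrib_right mult_ac)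
    finally show ?thesis .
  qed
  ultimately show ?thesis unfolding eq by simp
qed

lemma C2_on_continuous_grad: "continuous_on S (grad f)"
  unfolding grad_def
  by (intro continuous_intros continuous_at_imp_continuous_on ballI differentiable_imp_continuous_within
      C2_on_partial_differentiable)

text \<open>Continuity jointly in the point and the direction, for the supremum over unit vectors in
  weak quasiregularity.\<close>

lemma C2_on_continuous_hess_apply: "continuous_on (S \<times> UNIV) (\<lambda>(z, e). hess_apply f z e)"
proof -
  have "continuous_on (S \<times> UNIV) (\<lambda>p. hess f (fst p) b c)" if "b \<in> Basis" "c \<in> Basis" for b c
    using C2 that unfolding C2_on_def
    by (intro continuous_on_compose2[where f = fst and s = "S \<times> UNIV" and g = "\<lambda>z. hess f z b c"] continuous_intros) auto
  thus ?thesis unfolding hess_apply_def case_prod_unfold by (intro continuous_intros)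
qed

lemma C2_on_continuous_hess_apply': "continuous_on S (\<lambda>z. hess_apply f z e)"
proof -
  have "continuous_on S (\<lambda>z. (z, e))" by (intro continuous_intros)
  from continuous_on_compose2[OF C2_on_continuous_hess_apply this] show ?thesis by auto
qed

end

lemma norm_hess_apply_le: "norm (hess_apply f z e) \<le> hess_norm f z * norm e"
proof -
  have "(norm (hess_apply f z e))\<^sup>2 = (\<Sum>b\<in>Basis. (\<Sum>c\<in>Basis. hess f z b c * (e \<bullet> c))\<^sup>2)"
    unfolding power2_norm_eq_inner
    by (subst euclidean_inner) (simp add: hess_apply_def inner_sum_left inner_Basis power2_eq_square if_distrib cong: if_cong)
  also have "\<dots> \<le> (\<Sum>b\<in>Basis. (\<Sum>c\<in>Basis. (hess f z b c)\<^sup>2) * (\<Sum>c\<in>Basis. (e \<bullet> c)\<^sup>2))"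
    by (intro sum_mono Cauchy_Schwarz_ineq_sum)
  also have "(\<Sum>c\<in>Basis. (e \<bullet> c)\<^sup>2) = (norm e)\<^sup>2"
    unfolding power2_norm_eq_inner by (subst (2) euclidean_inner) (simp add: power2_eq_square)
  also have "(\<Sum>b\<in>Basis. (\<Sum>c\<in>Basis. (hess f z b c)\<^sup>2) * (norm e)\<^sup>2) = (hess_norm f z * norm e)\<^sup>2"
    unfolding hess_norm_def power_mult_distrib
    by (subst real_sqrt_pow2) (auto intro!: sum_nonneg simp: sum_distrib_right)
  finally show ?thesis
    by (rule power2_le_imp_le) (auto simp: hess_norm_def intro!: mult_nonneg_nonneg sum_nonneg)
qed

lemma hess_norm_nonneg: "0 \<le> hess_norm f z"
  by (auto simp: hess_norm_def intro!: sum_nonneg)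

lemma partial_difference_quotient:
  fixes f :: "'a::euclidean_space \<Rightarrow> real"
  assumes "f differentiable (at z)" "f differentiable (at (z + w))"
  shows "(\<lambda>z. (f (z + w) - f z) / k) differentiable (at z)"
    and "partial b (\<lambda>z. (f (z + w) - f z) / k) z = (partial b f (z + w) - partial b f z) / k"
proof -
  have 1: "(f has_derivative frechet_derivative f (at z)) (at z)"
    "(f has_derivative frechet_derivative f (at (z + w))) (at (z + w))"
    using assms by (simp_all add: frechet_derivative_works)
  have "((\<lambda>z. f (z + w)) has_derivative frechet_derivative f (at (z + w))) (at z)"
    by (rule has_derivative_compose[where f = "\<lambda>z. z + w" and f' = "\<lambda>h. h" and g = f])
       (auto intro!: derivative_eq_intros 1)
  hence D: "((\<lambda>z. (f (z + w) - f z) / k) has_derivative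
      (\<lambda>h. (frechet_derivative f (at (z + w)) h - frechet_derivative f (at z) h) / k)) (at z)"
    using 1(1) by (intro bounded_linear.has_derivative[OF bounded_linear_divide] has_derivative_diff)
  thus "(\<lambda>z. (f (z + w) - f z) / k) differentiable (at z)" by (auto simp: differentiable_def)
  show "partial b (\<lambda>z. (f (z + w) - f z) / k) z = (partial b f (z + w) - partial b f z) / k"
    using frechet_derivative_at[OF D] unfolding partial_def by metis
qed

lemma harmonic_on_difference_quotient:
  fixes F :: "'a::euclidean_space \<Rightarrow> real"
  assumes F: "harmonic_on F T" and T: "open T" and S: "open S" "S \<subseteq> T" "\<And>z. z \<in> S \<Longrightarrow> z + w \<in> T"
  shows "harmonic_on (\<lambda>z. (F (z + w) - F z) / k) S"
proof -
  let ?v = "\<lambda>z. (F (z + w) - F z) / k"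
  have C2: "C2_on F T" using F by (simp add: harmonic_on_def)
  note df = C2_on_differentiable[OF C2 T] C2_on_partial_differentiable[OF C2 T]
  have p: "partial b ?v z = (partial b F (z + w) - partial b F z) / k" if "z \<in> S" for z b
    using that S df(1) by (intro partial_difference_quotient) auto
  have pd: "(\<lambda>z. (partial b F (z + w) - partial b F z) / k) differentiable (at z)" if "z \<in> S" "b \<in> Basis" for z b
    using that S df(2) by (intro partial_difference_quotient) auto
  \<comment> \<open>The formula \<open>p\<close> for the partial derivatives holds only on
    \<open>S\<close>; differentiability is transferred because \<open>S\<close> is open.\<close>
  have pd': "partial b ?v differentiable (at z)" if "z \<in> S" "b \<in> Basis" for z b
    using pd[OF that] p S(1) that(1) unfolding differentiable_def
    by (metis (no_types, lifting) has_derivative_transform_within_open)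
  have h: "hess ?v z b c = (hess F (z + w) b c - hess F z b c) / k" if "z \<in> S" "b \<in> Basis" "c \<in> Basis" for z b c
  proof -
    have "frechet_derivative (partial c ?v) (at z) = frechet_derivative (\<lambda>z. (partial c F (z + w) - partial c F z) / k) (at z)"
      by (rule frechet_derivative_transform_within_open[OF pd'[OF that(1,3)] S(1) that(1)]) (rule p)
    hence "hess ?v z b c = partial b (\<lambda>z. (partial c F (z + w) - partial c F z) / k) z"
      by (simp add: hess_def partial_def)
    also have "\<dots> = (partial b (partial c F) (z + w) - partial b (partial c F) z) / k"
      using that S df(2) by (intro partial_difference_quotient) auto
    finally show ?thesis by (simp add: hess_def)
  qed
  show ?thesis unfolding harmonic_on_def C2_on_def
  proof (intro conjI ballI)
    show "?v differentiable_on S"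
      using S df(1) unfolding differentiable_on_eq_differentiable_at[OF S(1)]
      by (auto intro!: partial_difference_quotient)
    show "partial b ?v differentiable_on S" if "b \<in> Basis" for b
      unfolding differentiable_on_eq_differentiable_at[OF S(1)] using pd' that by blast
    show "continuous_on S (\<lambda>z. hess ?v z b c)" if "b \<in> Basis" "c \<in> Basis" for b c
    proof -
      have c: "continuous_on T (\<lambda>z. hess F z b c)" using C2 that by (simp add: C2_on_def)
      have "continuous_on S (\<lambda>z. (hess F (z + w) b c - hess F z b c) / k)"
        by (cases "k = 0") (use S in \<open>auto intro!: continuous_intros continuous_on_compose2[OF c]\<close>)
      thus ?thesis using h that by (metis (no_types, lifting) continuous_on_cong)
    qed
    show "(\<Sum>b\<in>Basis. hess ?v z b b) = 0" if "z \<in> S" for z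
      using h that F S unfolding harmonic_on_def
      by (simp add: sum_divide_distrib[symmetric] sum_subtractf subset_iff)
  qed
qed

subsection \<open>Green's formula for directional derivatives of a harmonic function\<close>

text \<open>Difference quotients of \<open>F\<close> are harmonic of class \<open>C\<^sup>2\<close>, whereas third derivatives of \<open>F\<close> are
  not known to exist.\<close>

lemma exists_harmonic_approximation_directional_derivative:
  fixes F :: "'a::euclidean_space \<Rightarrow> real"
  assumes F: "harmonic_on F T" and T: "open T" and K: "compact K" "K \<subseteq> T" and e: "norm e = 1" and \<eta>: "0 < \<eta>"
  obtains v S where "open S" "K \<subseteq> S" "harmonic_on v S"
    "\<And>z. z \<in> K \<Longrightarrow> \<bar>v z - e \<bullet> grad F z\<bar> \<le> \<eta>"
    "\<And>z. z \<in> K \<Longrightarrow> norm (grad v z - hess_apply F z e) \<le> \<eta>"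
proof -
  define u where "u z = e \<bullet> grad F z" for z
  define H where "H z = hess_apply F z e" for z
  have C2: "C2_on F T" using F by (simp add: harmonic_on_def)
  have cu: "continuous_on T u" unfolding u_def
    by (intro continuous_intros C2_on_continuous_grad[OF C2 T])
  have cH: "continuous_on T H" unfolding H_def by (rule C2_on_continuous_hess_apply'[OF C2 T])
  have du: "(u has_derivative (\<lambda>h. h \<bullet> H z)) (at z)" if "z \<in> T" for z
    unfolding u_def H_def by (rule C2_on_has_derivative_inner_grad[OF C2 T that])
  have dF: "(F has_derivative (\<lambda>h. h \<bullet> grad F z)) (at z)" if "z \<in> T" for z
    using has_derivative_grad C2_on_differentiable[OF C2 T that] by blast
  have line: "((\<lambda>s. f (w + s *\<^sub>R b)) has_real_derivative b \<bullet> g (w + s *\<^sub>R b)) (at s)"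
    if "(f has_derivative (\<lambda>h. h \<bullet> g (w + s *\<^sub>R b))) (at (w + s *\<^sub>R b))" for f :: "'a \<Rightarrow> real" and g w b s
  proof -
    have "((\<lambda>s. f (w + s *\<^sub>R b)) has_derivative (\<lambda>h. (h *\<^sub>R b) \<bullet> g (w + s *\<^sub>R b))) (at s)"
      by (rule has_derivative_compose[where f = "\<lambda>s. w + s *\<^sub>R b" and f' = "\<lambda>h. h *\<^sub>R b" and g = f])
         (auto intro!: derivative_eq_intros that)
    thus ?thesis unfolding has_field_derivative_def
      by (rule has_derivative_eq_rhs) (auto simp: mult.commute)
  qed
  obtain d where d: "0 < d" "(\<Union>x\<in>K. cball x d) \<subseteq> T"
    using compact_subset_open_imp_cball_epsilon_subset[OF K(1) T K(2)] by metis
  define K' where "K' = (\<Union>x\<in>K. \<Union>y\<in>cball 0 d. {x + y})"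
  have K': "compact K'" unfolding K'_def by (rule compact_sums'[OF K(1) compact_cball])
  have near: "z + w \<in> K'" if "z \<in> K" "norm w \<le> d" for z w
    using that unfolding K'_def by (simp, intro bexI[of _ z] bexI[of _ w]) auto
  have K'T: "K' \<subseteq> T" using d(2) unfolding K'_def by (fastforce simp: dist_norm)
  define D where "D = real DIM('a)"
  have D: "0 < D" by (simp add: D_def)
  have "uniformly_continuous_on K' u" "uniformly_continuous_on K' H"
    using compact_uniformly_continuous K' continuous_on_subset[OF cu K'T] continuous_on_subset[OF cH K'T] by blast+
  then obtain d1 d2 where d1: "0 < d1" "\<And>x y. x \<in> K' \<Longrightarrow> y \<in> K' \<Longrightarrow> dist y x < d1 \<Longrightarrow> dist (u y) (u x) < \<eta>"
    and d2: "0 < d2" "\<And>x y. x \<in> K' \<Longrightarrow> y \<in> K' \<Longrightarrow> dist y x < d2 \<Longrightarrow> dist (H y) (H x) < \<eta> / D"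
    unfolding uniformly_continuous_on_def using \<eta> D by (metis divide_pos_pos)
  \<comment> \<open>One third, because two displacements of length at most \<open>h\<close>, along
    \<open>e\<close> and along a basis vector, are combined below and must stay under all three
    moduli.\<close>
  define h where "h = Min {d, d1, d2} / 3"
  have h: "0 < h" "2 * h \<le> d" "2 * h < d1" "2 * h < d2" using d d1 d2 by (auto simp: h_def)
  define S where "S = T \<inter> {z. z + h *\<^sub>R e \<in> T}"
  define v where "v z = (F (z + h *\<^sub>R e) - F z) / h" for z
  have S: "open S"
  proof -
    have "open ((\<lambda>z. z + h *\<^sub>R e) -` T)" by (intro open_vimage T continuous_intros)
    thus ?thesis unfolding S_def using T by (auto simp: vimage_def)
  qed
  have zK: "z + s *\<^sub>R e \<in> K'" if "z \<in> K" "0 \<le> s" "s \<le> h" for z s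
    using that e h by (intro near) auto
  have zT: "z + s *\<^sub>R e \<in> T" if "z \<in> K" "0 \<le> s" "s \<le> h" for z s
    using zK[OF that] K'T by blast
  have KS: "K \<subseteq> S" using zT[of _ h] K h by (auto simp: S_def)
  have hv: "harmonic_on v S" unfolding v_def
    by (rule harmonic_on_difference_quotient[OF F T S]) (auto simp: S_def)
  have vu: "\<bar>v z - e \<bullet> grad F z\<bar> \<le> \<eta>" if z: "z \<in> K" for z
  proof -
    have "((\<lambda>s. F (z + s *\<^sub>R e)) has_real_derivative u (z + s *\<^sub>R e)) (at s)" if "0 \<le> s" "s \<le> h" for s
      using line[where f = F and g = "grad F", OF dF[OF zT[OF z that]]] by (simp add: u_def)
    then obtain \<xi> where \<xi>: "0 < \<xi>" "\<xi> < h" "F (z + h *\<^sub>R e) - F (z + 0 *\<^sub>R e) = (h - 0) * u (z + \<xi> *\<^sub>R e)"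
      using MVT2[of 0 h "\<lambda>s. F (z + s *\<^sub>R e)" "\<lambda>s. u (z + s *\<^sub>R e)"] h(1) by auto
    hence "v z = u (z + \<xi> *\<^sub>R e)" using h by (simp add: v_def)
    moreover have "dist (u (z + \<xi> *\<^sub>R e)) (u z) < \<eta>"
      using zK[of z \<xi>] zK[of z 0] \<xi> h z e by (intro d1(2)) (auto simp: dist_norm)
    ultimately show ?thesis by (simp add: dist_real_def u_def)
  qed
  have gv: "\<bar>grad v z \<bullet> c - H z \<bullet> c\<bar> \<le> \<eta> / D" if z: "z \<in> K" and c: "c \<in> Basis" for z c
  proof -
    have zcK: "z + \<tau> *\<^sub>R c + s *\<^sub>R e \<in> K'" if "0 \<le> s" "s \<le> h" "0 \<le> \<tau>" "\<tau> \<le> h" for s \<tau>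
    proof -
      have "norm (\<tau> *\<^sub>R c + s *\<^sub>R e) \<le> \<tau> + s"
        using norm_triangle_ineq[of "\<tau> *\<^sub>R c" "s *\<^sub>R e"] e c that by simp
      thus ?thesis using near[OF z, of "\<tau> *\<^sub>R c + s *\<^sub>R e"] that h by (simp add: add.assoc)
    qed
    \<comment> \<open>The quotient of \<open>v\<close> is a double difference of \<open>F\<close>.
      The mean value theorem along \<open>e\<close> turns it into a difference of \<open>u\<close>,
      and along \<open>c\<close> into a component of \<open>H\<close> at a nearby point.\<close>
    have q: "\<bar>(v (z + \<tau> *\<^sub>R c) - v z) / \<tau> - H z \<bullet> c\<bar> \<le> \<eta> / D" if \<tau>: "0 < \<tau>" "\<tau> \<le> h" for \<tau>
    proof -
      define \<psi> where "\<psi> s = F (z + \<tau> *\<^sub>R c + s *\<^sub>R e) - F (z + s *\<^sub>R e)" for s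
      have "(\<psi> has_real_derivative u (z + \<tau> *\<^sub>R c + s *\<^sub>R e) - u (z + s *\<^sub>R e)) (at s)" if "0 \<le> s" "s \<le> h" for s
        unfolding \<psi>_def u_def using zcK[OF that, of \<tau>] zT[OF z that] K'T \<tau>
        by (intro DERIV_diff line[where f = F and g = "grad F"] dF) auto
      then obtain \<xi> where \<xi>: "0 < \<xi>" "\<xi> < h"
        "\<psi> h - \<psi> 0 = (h - 0) * (u (z + \<tau> *\<^sub>R c + \<xi> *\<^sub>R e) - u (z + \<xi> *\<^sub>R e))"
        using MVT2[of 0 h \<psi> "\<lambda>s. u (z + \<tau> *\<^sub>R c + s *\<^sub>R e) - u (z + s *\<^sub>R e)"] h(1) by auto
      have "((\<lambda>s. u (z + \<xi> *\<^sub>R e + s *\<^sub>R c)) has_real_derivative c \<bullet> H (z + \<xi> *\<^sub>R e + s *\<^sub>R c)) (at s)"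
        if "0 \<le> s" "s \<le> \<tau>" for s
        using zcK[of \<xi> s] \<xi> that \<tau> K'T by (intro line[where f = u and g = H] du) (auto simp: algebra_simps)
      then obtain \<sigma> where \<sigma>: "0 < \<sigma>" "\<sigma> < \<tau>"
        "u (z + \<xi> *\<^sub>R e + \<tau> *\<^sub>R c) - u (z + \<xi> *\<^sub>R e + 0 *\<^sub>R c) = (\<tau> - 0) * (c \<bullet> H (z + \<xi> *\<^sub>R e + \<sigma> *\<^sub>R c))"
        using MVT2[of 0 \<tau> "\<lambda>s. u (z + \<xi> *\<^sub>R e + s *\<^sub>R c)" "\<lambda>s. c \<bullet> H (z + \<xi> *\<^sub>R e + s *\<^sub>R c)"] \<tau>(1) by auto
      have "v (z + \<tau> *\<^sub>R c) - v z = (\<psi> h - \<psi> 0) / h"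
        by (simp add: v_def \<psi>_def diff_divide_distrib add_divide_distrib)
      also have "\<dots> = \<tau> * (c \<bullet> H (z + \<xi> *\<^sub>R e + \<sigma> *\<^sub>R c))"
        using \<xi>(3) \<sigma>(3) h by (simp add: algebra_simps)
      finally have "(v (z + \<tau> *\<^sub>R c) - v z) / \<tau> = H (z + \<xi> *\<^sub>R e + \<sigma> *\<^sub>R c) \<bullet> c"
        using \<tau> by (simp add: inner_commute)
      moreover have "\<bar>H (z + \<xi> *\<^sub>R e + \<sigma> *\<^sub>R c) \<bullet> c - H z \<bullet> c\<bar> \<le> dist (H (z + \<xi> *\<^sub>R e + \<sigma> *\<^sub>R c)) (H z)"
        using Basis_le_norm[OF c, of "H (z + \<xi> *\<^sub>R e + \<sigma> *\<^sub>R c) - H z"] by (simp add: inner_diff_left dist_norm)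
      moreover have "dist (H (z + \<xi> *\<^sub>R e + \<sigma> *\<^sub>R c)) (H z) < \<eta> / D"
      proof (rule d2(2))
        show "z \<in> K'" using zK[OF z, of 0] h by simp
        show "z + \<xi> *\<^sub>R e + \<sigma> *\<^sub>R c \<in> K'" using zcK[of \<xi> \<sigma>] \<xi> \<sigma> \<tau> by (simp add: algebra_simps)
        have "norm (\<xi> *\<^sub>R e + \<sigma> *\<^sub>R c) \<le> \<xi> + \<sigma>"
          using norm_triangle_ineq[of "\<xi> *\<^sub>R e" "\<sigma> *\<^sub>R c"] e c \<xi> \<sigma> by simp
        thus "dist (z + \<xi> *\<^sub>R e + \<sigma> *\<^sub>R c) z < d2" using \<xi> \<sigma> \<tau> h by (simp add: dist_norm add.assoc)
      qed
      ultimately show ?thesis by simp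
    qed
    have "C2_on v S" using hv by (simp add: harmonic_on_def)
    hence "(v has_derivative (\<lambda>h. h \<bullet> grad v z)) (at z)"
      using has_derivative_grad C2_on_differentiable[OF _ S] KS z by blast
    hence "((\<lambda>s. v (z + s *\<^sub>R c)) has_real_derivative c \<bullet> grad v z) (at 0)"
      using line[where f = v and g = "grad v" and w = z and s = 0 and b = c] by simp
    hence "((\<lambda>\<tau>. (v (z + \<tau> *\<^sub>R c) - v z) / \<tau>) \<longlongrightarrow> c \<bullet> grad v z) (at 0)"
      by (simp add: DERIV_def)
    hence "((\<lambda>\<tau>. \<bar>(v (z + \<tau> *\<^sub>R c) - v z) / \<tau> - H z \<bullet> c\<bar>) \<longlongrightarrow> \<bar>c \<bullet> grad v z - H z \<bullet> c\<bar>) (at_right 0)"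
      by (intro tendsto_intros) (metis filterlim_at_split)
    moreover have "\<forall>\<^sub>F \<tau> in at_right 0. \<bar>(v (z + \<tau> *\<^sub>R c) - v z) / \<tau> - H z \<bullet> c\<bar> \<le> \<eta> / D"
      using eventually_at_right_less[of 0] eventually_at_right_real[OF h(1)]
      by eventually_elim (auto intro!: q)
    ultimately have "\<bar>c \<bullet> grad v z - H z \<bullet> c\<bar> \<le> \<eta> / D"
      by (rule tendsto_upperbound) simp
    thus ?thesis by (simp add: inner_commute)
  qed
  have "norm (grad v z - hess_apply F z e) \<le> \<eta>" if z: "z \<in> K" for z
  proof -
    have "norm (grad v z - H z) \<le> (\<Sum>c\<in>Basis. \<bar>(grad v z - H z) \<bullet> c\<bar>)" by (rule norm_le_l1)
    also have "\<dots> \<le> (\<Sum>c\<in>(Basis::'a set). \<eta> / D)" using gv[OF z] by (intro sum_mono) (simp add: inner_diff_left)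
    also have "\<dots> = \<eta>" using D by (simp add: D_def)
    finally show ?thesis by (simp add: H_def)
  qed
  thus ?thesis using that[OF S KS hv] vu by blast
qed

text \<open>Passes Green's formula to the limit: all its terms are integrals of a continuous
  \<open>\<Psi>\<close> of position, value and gradient. The limit function is bounded, so
  eventually all values lie in one closed ball, where \<open>\<Psi>\<close> is uniformly
  continuous.\<close>

lemma LIMSEQ_integral_cbox_compose:
  fixes f :: "nat \<Rightarrow> 'a::euclidean_space \<Rightarrow> 'b::euclidean_space" and \<Psi> :: "'b \<Rightarrow> real"
  assumes u: "uniform_limit (cbox a b) f g sequentially" and c: "\<And>k. continuous_on (cbox a b) (f k)"
    and \<Psi>: "continuous_on UNIV \<Psi>"
  shows "(\<lambda>k. integral (cbox a b) (\<lambda>x. \<Psi> (f k x))) \<longlonglongrightarrow> integral (cbox a b) (\<lambda>x. \<Psi> (g x))"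
proof -
  have "continuous_on (cbox a b) g"
    by (rule uniform_limit_theorem[OF _ u]) (use c in auto)
  hence "bounded (g ` cbox a b)" using compact_continuous_image compact_cbox compact_imp_bounded by blast
  then obtain R where R: "\<And>x. x \<in> cbox a b \<Longrightarrow> norm (g x) \<le> R" unfolding bounded_iff by blast
  let ?U = "cball 0 (R + 1) :: 'b set"
  have uc: "uniformly_continuous_on ?U \<Psi>"
    using \<Psi> by (intro compact_uniformly_continuous) (auto intro: continuous_on_subset)
  have ev: "\<forall>\<^sub>F k in sequentially. \<forall>x\<in>cbox a b. f k x \<in> ?U"
    using uniform_limitD[OF u zero_less_one]
  proof eventually_elim
    fix k assume k: "\<forall>x\<in>cbox a b. dist (f k x) (g x) < 1"
    show "\<forall>x\<in>cbox a b. f k x \<in> cball 0 (R + 1)"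
    proof
      fix x assume x: "x \<in> cbox a b"
      have "norm (f k x) \<le> norm (g x) + dist (f k x) (g x)" by (metis dist_norm norm_triangle_sub)
      thus "f k x \<in> cball 0 (R + 1)" using R[OF x] k x by force
    qed
  qed
  have "uniform_limit (cbox a b) (\<lambda>k x. \<Psi> (f k x)) (\<lambda>x. \<Psi> (g x)) sequentially"
    by (rule uniform_limit_compose_uniformly_continuous_on[OF u uc ev]) simp
  then obtain I J where IJ: "\<And>k. ((\<lambda>x. \<Psi> (f k x)) has_integral I k) (cbox a b)"
    "((\<lambda>x. \<Psi> (g x)) has_integral J) (cbox a b)" "I \<longlonglongrightarrow> J"
    by (rule uniform_limit_integral_cbox)
       (use c \<Psi> in \<open>auto intro!: continuous_on_compose2[OF \<Psi>]\<close>)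
  have "integral (cbox a b) (\<lambda>x. \<Psi> (f k x)) = I k" for k using IJ(1) by (rule integral_unique)
  moreover have "integral (cbox a b) (\<lambda>x. \<Psi> (g x)) = J" using IJ(2) by (rule integral_unique)
  ultimately show ?thesis using IJ(3) by simp
qed

text \<open>The boundary term \<open>y \<partial>\<^sub>y\<phi> - \<phi>\<close> of Green's formula for \<open>\<phi> = p (v - c) + q (v - c)\<^sup>2\<close>; only \<open>(p, q) = (1, 0)\<close>
  and \<open>(0, 1)\<close> are used, for the first and the second moment.\<close>

definition flux :: "real \<Rightarrow> real \<Rightarrow> real \<Rightarrow> real \<Rightarrow> real \<Rightarrow> 'a::euclidean_space \<times> real \<Rightarrow> real" where
  "flux p q c y V G = y * ((p + 2 * q * (V - c)) * (G \<bullet> (0, 1))) - (p * (V - c) + q * (V - c)\<^sup>2)"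

lemma uniform_limit_Pair:
  fixes f :: "'i \<Rightarrow> 'a \<Rightarrow> 'b::metric_space" and g :: "'i \<Rightarrow> 'a \<Rightarrow> 'c::metric_space"
  assumes "uniform_limit X f f0 F" "uniform_limit X g g0 F"
  shows "uniform_limit X (\<lambda>k x. (f k x, g k x)) (\<lambda>x. (f0 x, g0 x)) F"
proof (rule uniform_limitI)
  fix r :: real assume r: "0 < r"
  hence "\<forall>\<^sub>F k in F. \<forall>x\<in>X. dist (f k x) (f0 x) < r / 2" "\<forall>\<^sub>F k in F. \<forall>x\<in>X. dist (g k x) (g0 x) < r / 2"
    using uniform_limitD[OF assms(1), of "r / 2"] uniform_limitD[OF assms(2), of "r / 2"] by simp_all
  thus "\<forall>\<^sub>F k in F. \<forall>x\<in>X. dist (f k x, g k x) (f0 x, g0 x) < r"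
  proof eventually_elim
    case (elim k)
    show ?case
    proof
      fix x assume x: "x \<in> X"
      have "dist (f k x, g k x) (f0 x, g0 x) \<le> dist (f k x) (f0 x) + dist (g k x) (g0 x)"
        unfolding dist_prod_def by (simp add: sqrt_sum_squares_le_sum)
      thus "dist (f k x, g k x) (f0 x, g0 x) < r" using elim x by (smt (verit, best) field_sum_of_halves)
    qed
  qed
qed

text \<open>\<open>green_box\<close> for \<open>\<phi> = p * (v - c) + q * (v - c)\<^sup>2\<close>,
  with \<open>D b\<close> its second derivative along \<open>b\<close>. Since \<open>v\<close> is
  harmonic, these sum to \<open>2 * q\<close> times the squared norm of the gradient.\<close>

lemma green_harmonic:
  fixes v :: "'a::euclidean_space \<times> real \<Rightarrow> real" and t l A B p q c :: real
  assumes v: "harmonic_on v S" and S: "open S" and tl: "0 < t" "t \<le> l" and AB: "0 \<le> A" "0 \<le> B"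
    and K: "K = cbox (a, t) (a + l *\<^sub>R One, l)" "K \<subseteq> S"
    and bd: "\<And>x y i. (x, y) \<in> K \<Longrightarrow> i \<in> Basis \<Longrightarrow>
      \<bar>y * ((p + 2 * q * (v (x, y) - c)) * (grad v (x, y) \<bullet> (i, 0)))\<bar> \<le> A + B * ln (l / y)"
  shows "\<bar>integral K (\<lambda>z. snd z * (2 * q * (norm (grad v z))\<^sup>2))
      - (integral (cube a l) (\<lambda>x. flux p q c l (v (x, l)) (grad v (x, l)))
       - integral (cube a l) (\<lambda>x. flux p q c t (v (x, t)) (grad v (x, t))))\<bar>
    \<le> 2 * DIM('a) * l ^ DIM('a) * (A + B)"
proof -
  have C2: "C2_on v S" using v by (simp add: harmonic_on_def)
  define \<phi> where "\<phi> z = p * (v z - c) + q * (v z - c)\<^sup>2" for z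
  define G where "G z = (p + 2 * q * (v z - c)) *\<^sub>R grad v z" for z
  define D where "D b z = 2 * q * (grad v z \<bullet> b)\<^sup>2 + (p + 2 * q * (v z - c)) * hess v z b b" for b z
  have dv: "(v has_derivative (\<lambda>h. h \<bullet> grad v z)) (at z)" if "z \<in> S" for z
    using has_derivative_grad C2_on_differentiable[OF C2 S that] by blast
  have cv: "continuous_on S v"
    using dv by (meson continuous_at_imp_continuous_on has_derivative_continuous)
  have cg: "continuous_on S (grad v)" by (rule C2_on_continuous_grad[OF C2 S])
  have ch: "continuous_on S (\<lambda>z. hess v z b b)" if "b \<in> Basis" for b
    using C2 that by (simp add: C2_on_def)
  have sumD: "(\<Sum>b\<in>Basis. D b z) = 2 * q * (norm (grad v z))\<^sup>2" if "z \<in> S" for z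
  proof -
    have "(\<Sum>b\<in>Basis. D b z) = 2 * q * (\<Sum>b\<in>Basis. (grad v z \<bullet> b)\<^sup>2) + (p + 2 * q * (v z - c)) * (\<Sum>b\<in>Basis. hess v z b b)"
      by (simp add: D_def sum.distrib sum_distrib_left)
    moreover have "(\<Sum>b\<in>Basis. hess v z b b) = 0" using v that by (simp add: harmonic_on_def)
    moreover have "(\<Sum>b\<in>Basis. (grad v z \<bullet> b)\<^sup>2) = (norm (grad v z))\<^sup>2"
      unfolding power2_norm_eq_inner by (subst (2) euclidean_inner) (simp add: power2_eq_square)
    ultimately show ?thesis by simp
  qed
  have "\<bar>integral K (\<lambda>z. snd z * (\<Sum>b\<in>Basis. D b z))
      - (integral (cube a l) (\<lambda>x. l * (G (x, l) \<bullet> (0, 1)) - \<phi> (x, l))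
       - integral (cube a l) (\<lambda>x. t * (G (x, t) \<bullet> (0, 1)) - \<phi> (x, t)))\<bar>
    \<le> 2 * DIM('a) * l ^ DIM('a) * (A + B)"
  proof (rule green_box[OF tl AB K(1)])
    note c = continuous_on_subset[OF cv K(2)] continuous_on_subset[OF cg K(2)]
    show "continuous_on K \<phi>" "continuous_on K G"
      unfolding \<phi>_def G_def by (intro continuous_intros c)+
    show "continuous_on K (D b)" if "b \<in> Basis" for b
      unfolding D_def using that by (intro continuous_intros c continuous_on_subset[OF ch K(2)])
    fix z assume z: "z \<in> K"
    hence zS: "z \<in> S" using K by blast
    have "(\<phi> has_derivative (\<lambda>h. p * (h \<bullet> grad v z) + q * (2 * (v z - c) * (h \<bullet> grad v z)))) (at z)"
      unfolding \<phi>_def by (rule derivative_eq_intros dv[OF zS] refl)+ (simp add: algebra_simps)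
    thus "(\<phi> has_derivative (\<lambda>h. h \<bullet> G z)) (at z)"
      by (rule has_derivative_eq_rhs) (auto simp: G_def algebra_simps)
    fix b :: "'a \<times> real" assume b: "b \<in> Basis"
    have line: "((\<lambda>s. f (z + s *\<^sub>R b)) has_real_derivative b \<bullet> g) (at 0)"
      if "(f has_derivative (\<lambda>h. h \<bullet> g)) (at z)" for f :: "'a \<times> real \<Rightarrow> real" and g
    proof -
      have "((\<lambda>s. f (z + s *\<^sub>R b)) has_derivative (\<lambda>h. (h *\<^sub>R b) \<bullet> g)) (at 0)"
        by (rule has_derivative_compose[where f = "\<lambda>s. z + s *\<^sub>R b" and f' = "\<lambda>h. h *\<^sub>R b" and g = f])
           (auto intro!: derivative_eq_intros that)
      thus ?thesis unfolding has_field_derivative_def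
        by (rule has_derivative_eq_rhs) (auto simp: mult.commute)
    qed
    have 1: "((\<lambda>s. v (z + s *\<^sub>R b)) has_real_derivative b \<bullet> grad v z) (at 0)" by (rule line[OF dv[OF zS]])
    have "(partial b v has_derivative (\<lambda>h. h \<bullet> grad (partial b v) z)) (at z)"
      using has_derivative_grad C2_on_partial_differentiable[OF C2 S zS b] by blast
    from line[OF this] have 2: "((\<lambda>s. partial b v (z + s *\<^sub>R b)) has_real_derivative hess v z b b) (at 0)"
      using hess_grad[OF b, of b v z] by (simp add: inner_commute)
    have "((\<lambda>s. (p + 2 * q * (v (z + s *\<^sub>R b) - c)) * partial b v (z + s *\<^sub>R b)) has_real_derivative D b z) (at 0)"
      by (rule derivative_eq_intros 1 2 refl)+
         (simp add: D_def power2_eq_square algebra_simps grad_inner_Basis[OF b] inner_commute[of b])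
    thus "((\<lambda>s. G (z + s *\<^sub>R b) \<bullet> b) has_real_derivative D b z) (at 0)"
      by (simp add: G_def grad_inner_Basis[OF b])
  next
    fix x y and i :: 'a assume "(x, y) \<in> K" "i \<in> Basis"
    thus "\<bar>y * (G (x, y) \<bullet> (i, 0))\<bar> \<le> A + B * ln (l / y)" using bd by (simp add: G_def)
  qed
  moreover have "integral K (\<lambda>z. snd z * (\<Sum>b\<in>Basis. D b z)) = integral K (\<lambda>z. snd z * (2 * q * (norm (grad v z))\<^sup>2))"
    using K sumD by (intro integral_cong) auto
  ultimately show ?thesis by (simp add: G_def \<phi>_def flux_def)
qed

text \<open>The limit of \<open>green_harmonic\<close> along difference quotients converging to
  \<open>e \<bullet> grad F\<close>. The lateral flux is a product: \<open>bd1\<close> bounds the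
  derivative of the polynomial in \<open>u\<close>, and \<open>bd2\<close> bounds \<open>y\<close>
  times the gradient of \<open>u\<close>.\<close>

lemma green_directional_derivative:
  fixes F :: "'a::euclidean_space \<times> real \<Rightarrow> real" and t l A B p q c \<epsilon> :: real
  assumes F: "harmonic_on F T" and T: "open T" and e: "norm e = 1" and tl: "0 < t" "t \<le> l"
    and AB: "0 \<le> A" "0 \<le> B" "0 \<le> \<epsilon>" and K: "K = cbox (a, t) (a + l *\<^sub>R One, l)" "K \<subseteq> T"
    and bd1: "\<And>x y. (x, y) \<in> K \<Longrightarrow> \<bar>p + 2 * q * (e \<bullet> grad F (x, y) - c)\<bar> \<le> A + B * ln (l / y)"
    and bd2: "\<And>x y. (x, y) \<in> K \<Longrightarrow> \<bar>y\<bar> * norm (hess_apply F (x, y) e) \<le> \<epsilon>"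
  shows "\<bar>integral K (\<lambda>z. snd z * (2 * q * (norm (hess_apply F z e))\<^sup>2))
      - (integral (cube a l) (\<lambda>x. flux p q c l (e \<bullet> grad F (x, l)) (hess_apply F (x, l) e))
       - integral (cube a l) (\<lambda>x. flux p q c t (e \<bullet> grad F (x, t)) (hess_apply F (x, t) e)))\<bar>
    \<le> 2 * DIM('a) * l ^ DIM('a) * (\<epsilon> * (A + B))"
proof -
  define u where "u z = e \<bullet> grad F z" for z
  define H where "H z = hess_apply F z e" for z
  define \<eta> where "\<eta> k = inverse (real (Suc k))" for k
  have \<eta>: "0 < \<eta> k" for k by (simp add: \<eta>_def)
  have \<eta>0: "\<eta> \<longlonglongrightarrow> 0" unfolding \<eta>_def by (rule LIMSEQ_inverse_real_of_nat)
  have cK: "compact K" by (simp add: K)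
  have "\<exists>v S. open S \<and> K \<subseteq> S \<and> harmonic_on v S \<and> (\<forall>z\<in>K. \<bar>v z - u z\<bar> \<le> \<eta> k) \<and>
      (\<forall>z\<in>K. norm (grad v z - H z) \<le> \<eta> k)" for k
    using exists_harmonic_approximation_directional_derivative[OF F T cK K(2) e \<eta>[of k]] unfolding u_def H_def by metis
  then obtain v S where vS: "\<And>k. open (S k)" "\<And>k. K \<subseteq> S k" "\<And>k. harmonic_on (v k) (S k)"
    "\<And>k z. z \<in> K \<Longrightarrow> \<bar>v k z - u z\<bar> \<le> \<eta> k" "\<And>k z. z \<in> K \<Longrightarrow> norm (grad (v k) z - H z) \<le> \<eta> k"
    by metis
  have cv: "continuous_on K (v k)" for k
  proof -
    have C2: "C2_on (v k) (S k)" using vS(3) by (simp add: harmonic_on_def)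
    have "continuous_on (S k) (v k)"
      using C2_on_differentiable[OF C2 vS(1)]
      by (auto intro!: continuous_at_imp_continuous_on differentiable_imp_continuous_within)
    thus ?thesis using vS(2) continuous_on_subset by blast
  qed
  have cg: "continuous_on K (grad (v k))" for k
  proof -
    have C2: "C2_on (v k) (S k)" using vS(3) by (simp add: harmonic_on_def)
    show ?thesis using C2_on_continuous_grad[OF C2 vS(1)] vS(2) continuous_on_subset by blast
  qed
  have uv: "uniform_limit K v u sequentially" and ug: "uniform_limit K (\<lambda>k. grad (v k)) H sequentially"
  proof -
    have ev: "\<forall>\<^sub>F k in sequentially. \<eta> k < r" if "0 < r" for r using order_tendstoD(2)[OF \<eta>0 that] .
    show "uniform_limit K v u sequentially"
      by (rule uniform_limitI, rule eventually_mono[OF ev])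
         (use vS(4) in \<open>auto simp: dist_real_def intro: le_less_trans\<close>)
    show "uniform_limit K (\<lambda>k. grad (v k)) H sequentially"
    proof (rule uniform_limitI, rule eventually_mono[OF ev], assumption, rule ballI)
      fix r k z assume "\<eta> k < r" "z \<in> K"
      thus "dist (grad (v k) z) (H z) < r" using vS(5)[of z k] by (simp add: dist_norm)
    qed
  qed
  have sl: "(x, y) \<in> K" if "x \<in> cube a l" "y \<in> {t..l}" for x y using that by (simp add: K cube_def)
  have Q: "cube a l = cbox a (a + l *\<^sub>R One)" by (simp add: cube_def)
  have L1: "(\<lambda>k. integral K (\<lambda>z. snd z * (2 * q * (norm (grad (v k) z))\<^sup>2))) \<longlonglongrightarrow>
      integral K (\<lambda>z. snd z * (2 * q * (norm (H z))\<^sup>2))"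
  proof -
    have "uniform_limit K (\<lambda>k z. (z, grad (v k) z)) (\<lambda>z. (z, H z)) sequentially"
      by (intro uniform_limit_Pair uniform_limit_const ug)
    moreover have "continuous_on K (\<lambda>z. (z, grad (v k) z))" for k by (intro continuous_intros cg)
    moreover have "continuous_on UNIV (\<lambda>(z::'a \<times> real, g::'a \<times> real). snd z * (2 * q * (norm g)\<^sup>2))"
      unfolding case_prod_unfold by (intro continuous_intros)
    ultimately show ?thesis
      using LIMSEQ_integral_cbox_compose[where a = "(a, t)" and b = "(a + l *\<^sub>R One, l)" and
        f = "\<lambda>k z. (z, grad (v k) z)" and g = "\<lambda>z. (z, H z)" and \<Psi> = "\<lambda>(z, g). snd z * (2 * q * (norm g)\<^sup>2)"] by (simp add: K)
  qed
  have L2: "(\<lambda>k. integral (cube a l) (\<lambda>x. flux p q c y (v k (x, y)) (grad (v k) (x, y)))) \<longlonglongrightarrow>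
      integral (cube a l) (\<lambda>x. flux p q c y (u (x, y)) (H (x, y)))" if y: "y \<in> {t..l}" for y
  proof -
    have pi: "(\<lambda>x. (x, y)) \<in> cube a l \<rightarrow> K" using sl[OF _ y] by auto
    have "uniform_limit (cube a l) (\<lambda>k x. (v k (x, y), grad (v k) (x, y))) (\<lambda>x. (u (x, y), H (x, y))) sequentially"
      by (intro uniform_limit_Pair uniform_limit_compose'[OF uv pi] uniform_limit_compose'[OF ug pi])
    moreover have "continuous_on (cube a l) (\<lambda>x. (v k (x, y), grad (v k) (x, y)))" for k
      using sl[OF _ y] by (intro continuous_intros continuous_on_compose2[OF cv] continuous_on_compose2[OF cg]) auto
    moreover have "continuous_on UNIV (\<lambda>(V, G::'a \<times> real). flux p q c y V G)"
      unfolding case_prod_unfold flux_def by (intro continuous_intros)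
    ultimately show ?thesis
      using LIMSEQ_integral_cbox_compose[where a = a and b = "a + l *\<^sub>R One" and f = "\<lambda>k x. (v k (x, y), grad (v k) (x, y))"
        and g = "\<lambda>x. (u (x, y), H (x, y))" and \<Psi> = "\<lambda>(V, G). flux p q c y V G"] by (simp add: Q)
  qed
  \<comment> \<open>The lateral bounds for the \<open>k\<close>-th quotient, with its error
    \<open>\<eta> k\<close> in value and gradient included; they tend to
    \<open>\<epsilon> * A\<close> and \<open>\<epsilon> * B\<close>.\<close>
  define A' where "A' k = (\<epsilon> + l * \<eta> k) * (A + 2 * \<bar>q\<bar> * \<eta> k)" for k
  define B' where "B' k = (\<epsilon> + l * \<eta> k) * B" for k
  have G: "\<bar>integral K (\<lambda>z. snd z * (2 * q * (norm (grad (v k) z))\<^sup>2))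
      - (integral (cube a l) (\<lambda>x. flux p q c l (v k (x, l)) (grad (v k) (x, l)))
       - integral (cube a l) (\<lambda>x. flux p q c t (v k (x, t)) (grad (v k) (x, t))))\<bar>
    \<le> 2 * DIM('a) * l ^ DIM('a) * (A' k + B' k)" for k
  proof (rule green_harmonic[OF vS(3) vS(1) tl _ _ K(1) vS(2)])
    show "0 \<le> A' k" "0 \<le> B' k" using \<eta>[of k] AB tl by (auto simp: A'_def B'_def)
    fix x y and i :: 'a assume xy: "(x, y) \<in> K" and i: "i \<in> Basis"
    have y: "0 < y" "y \<le> l" "t \<le> y" using xy tl by (auto simp: K)
    have i0: "(i, 0) \<in> (Basis::('a \<times> real) set)" using i by (simp add: Basis_prod_def)
    have "\<bar>p + 2 * q * (v k (x, y) - c)\<bar> \<le> \<bar>p + 2 * q * (u (x, y) - c)\<bar> + \<bar>2 * q * (v k (x, y) - u (x, y))\<bar>"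
      by (simp add: algebra_simps)
    also have "\<bar>2 * q * (v k (x, y) - u (x, y))\<bar> \<le> 2 * \<bar>q\<bar> * \<eta> k"
      using vS(4)[OF xy, of k] by (simp add: abs_mult mult_left_mono)
    finally have 1: "\<bar>p + 2 * q * (v k (x, y) - c)\<bar> \<le> A + B * ln (l / y) + 2 * \<bar>q\<bar> * \<eta> k"
      using bd1[OF xy] by (simp add: u_def)
    have "\<bar>grad (v k) (x, y) \<bullet> (i, 0)\<bar> \<le> norm (grad (v k) (x, y))" by (rule Basis_le_norm[OF i0])
    also have "\<dots> \<le> norm (H (x, y)) + norm (grad (v k) (x, y) - H (x, y))" by (metis norm_triangle_sub)
    also have "\<dots> \<le> norm (H (x, y)) + \<eta> k" using vS(5)[OF xy] by simp
    finally have "y * \<bar>grad (v k) (x, y) \<bullet> (i, 0)\<bar> \<le> y * norm (H (x, y)) + y * \<eta> k"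
      using y by (simp add: distrib_left[symmetric])
    also have "\<dots> \<le> \<epsilon> + l * \<eta> k" using bd2[OF xy] y \<eta>[of k] by (intro add_mono mult_right_mono) (auto simp: H_def)
    finally have 2: "y * \<bar>grad (v k) (x, y) \<bullet> (i, 0)\<bar> \<le> \<epsilon> + l * \<eta> k" .
    have "\<bar>y * ((p + 2 * q * (v k (x, y) - c)) * (grad (v k) (x, y) \<bullet> (i, 0)))\<bar>
      = (y * \<bar>grad (v k) (x, y) \<bullet> (i, 0)\<bar>) * \<bar>p + 2 * q * (v k (x, y) - c)\<bar>"
      using y by (simp add: abs_mult)
    also have "\<dots> \<le> (\<epsilon> + l * \<eta> k) * (A + B * ln (l / y) + 2 * \<bar>q\<bar> * \<eta> k)"
      using 1 2 y \<eta>[of k] AB by (intro mult_mono) auto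
    also have "\<dots> = A' k + B' k * ln (l / y)" by (simp add: A'_def B'_def algebra_simps)
    finally show "\<bar>y * ((p + 2 * q * (v k (x, y) - c)) * (grad (v k) (x, y) \<bullet> (i, 0)))\<bar> \<le> A' k + B' k * ln (l / y)" .
  qed
  have "(\<lambda>k. 2 * DIM('a) * l ^ DIM('a) * (A' k + B' k)) \<longlonglongrightarrow>
      2 * DIM('a) * l ^ DIM('a) * ((\<epsilon> + l * 0) * (A + 2 * \<bar>q\<bar> * 0) + (\<epsilon> + l * 0) * B)"
    unfolding A'_def B'_def by (intro tendsto_intros \<eta>0)
  hence R: "(\<lambda>k. 2 * DIM('a) * l ^ DIM('a) * (A' k + B' k)) \<longlonglongrightarrow> 2 * DIM('a) * l ^ DIM('a) * (\<epsilon> * (A + B))"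
    by (simp add: distrib_left)
  have L: "(\<lambda>k. \<bar>integral K (\<lambda>z. snd z * (2 * q * (norm (grad (v k) z))\<^sup>2))
      - (integral (cube a l) (\<lambda>x. flux p q c l (v k (x, l)) (grad (v k) (x, l)))
       - integral (cube a l) (\<lambda>x. flux p q c t (v k (x, t)) (grad (v k) (x, t))))\<bar>) \<longlonglongrightarrow>
    \<bar>integral K (\<lambda>z. snd z * (2 * q * (norm (H z))\<^sup>2))
      - (integral (cube a l) (\<lambda>x. flux p q c l (u (x, l)) (H (x, l)))
       - integral (cube a l) (\<lambda>x. flux p q c t (u (x, t)) (H (x, t))))\<bar>"
    using tl by (intro tendsto_intros L1 L2) auto
  show ?thesis using LIMSEQ_le[OF L R exI[of _ 0]] G unfolding u_def H_def by simp
qed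

subsection \<open>Oscillation and moments under the Bloch condition\<close>

text \<open>A localized bound that serves both hypotheses: under the Bloch condition one
  \<open>\<epsilon>\<close> works for every \<open>l\<close>, under the little Bloch condition every
  positive \<open>\<epsilon>\<close> works once \<open>l\<close> is small.\<close>

definition bloch_below :: "('a::euclidean_space \<times> real \<Rightarrow> real) \<Rightarrow> real \<Rightarrow> real \<Rightarrow> bool" where
  "bloch_below F \<epsilon> l \<longleftrightarrow> (\<forall>x y. 0 < y \<longrightarrow> y \<le> l \<longrightarrow> y * hess_norm F (x, y) \<le> \<epsilon>)"

lemma bloch_below_mono: "bloch_below F \<epsilon> l \<Longrightarrow> l' \<le> l \<Longrightarrow> \<epsilon> \<le> \<epsilon>' \<Longrightarrow> bloch_below F \<epsilon>' l'"
  unfolding bloch_below_def by (meson order_trans)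

lemma bloch_below_nonneg: "bloch_below F \<epsilon> l \<Longrightarrow> 0 < l \<Longrightarrow> 0 \<le> \<epsilon>"
  unfolding bloch_below_def by (meson hess_norm_nonneg less_imp_le mult_nonneg_nonneg order_refl order_trans)

lemma bloch_below_hess_apply:
  assumes "bloch_below F \<epsilon> l" "0 < y" "y \<le> l" "norm e = 1"
  shows "y * norm (hess_apply F (x, y) e) \<le> \<epsilon>"
proof -
  have "y * norm (hess_apply F (x, y) e) \<le> y * hess_norm F (x, y)"
    using norm_hess_apply_le[of F "(x, y)" e] assms by (intro mult_left_mono) auto
  also have "\<dots> \<le> \<epsilon>" using assms by (simp add: bloch_below_def)
  finally show ?thesis .
qed

lemma norm_diff_corner_le:
  fixes b :: "'a::euclidean_space" and l :: real
  assumes "x \<in> cube b l"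
  shows "norm (x - b) \<le> DIM('a) * l"
proof -
  have "norm (x - b) \<le> (\<Sum>i\<in>Basis. \<bar>(x - b) \<bullet> i\<bar>)" by (rule norm_le_l1)
  also have "\<dots> \<le> (\<Sum>i\<in>(Basis::'a set). l)"
    using assms by (intro sum_mono) (auto simp: cube_def mem_box inner_simps)
  finally show ?thesis by simp
qed

text \<open>Test the difference against the unit vector \<open>e\<close> in its own direction.
  Moving horizontally at height \<open>l\<close> costs a distance of at most
  \<open>DIM('a) * l\<close> times the Hessian bound \<open>\<epsilon> / l\<close>; moving down from
  \<open>l\<close> to \<open>y\<close> integrates \<open>\<epsilon> / s\<close> to a
  logarithm.\<close>

lemma grad_oscillation_le:
  fixes F :: "'a::euclidean_space \<times> real \<Rightarrow> real"
  assumes F: "harmonic_on F upper_half_space" and bl: "bloch_below F \<epsilon> l"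
    and l: "0 < l" and x: "x \<in> cube b l" and y: "0 < y" "y \<le> l"
  shows "norm (grad F (x, y) - grad F (b, l)) \<le> \<epsilon> * (DIM('a) + ln (l / y))"
proof (cases "grad F (x, y) = grad F (b, l)")
  case True
  have "0 \<le> \<epsilon>" using bloch_below_nonneg[OF bl l] .
  moreover have "0 \<le> ln (l / y)" using l y by simp
  ultimately show ?thesis using True by simp
next
  case False
  define w where "w = grad F (x, y) - grad F (b, l)"
  have w: "w \<noteq> 0" using False by (simp add: w_def)
  define e where "e = w /\<^sub>R norm w"
  have e: "norm e = 1" using w by (simp add: e_def)
  define u where "u z = e \<bullet> grad F z" for z
  have C2: "C2_on F upper_half_space" using F by (simp add: harmonic_on_def)
  have du: "(u has_derivative (\<lambda>h. h \<bullet> hess_apply F z e)) (at z)" if "0 < snd z" for z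
    unfolding u_def using that
    by (intro C2_on_has_derivative_inner_grad[OF C2 open_upper_half_space]) (simp add: upper_half_space_iff)
  have \<epsilon>: "0 \<le> \<epsilon>" using bloch_below_nonneg[OF bl l] .
  have H: "norm (hess_apply F (x, y) e) \<le> \<epsilon> / y" if "0 < y" "y \<le> l" for x y
    using bloch_below_hess_apply[OF bl that e] that by (simp add: field_simps)
  have 1: "u (x, l) - u (b, l) \<le> \<epsilon> * DIM('a)"
  proof -
    have d: "((\<lambda>s. u (b + s *\<^sub>R (x - b), l)) has_real_derivative (x - b, 0) \<bullet> hess_apply F (b + s *\<^sub>R (x - b), l) e) (at s)" for s
    proof -
      have "((\<lambda>s. u (b + s *\<^sub>R (x - b), l)) has_derivative (\<lambda>h. (h *\<^sub>R (x - b), 0) \<bullet> hess_apply F (b + s *\<^sub>R (x - b), l) e)) (at s)"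
        by (rule has_derivative_compose[where f = "\<lambda>s. (b + s *\<^sub>R (x - b), l)" and f' = "\<lambda>h. (h *\<^sub>R (x - b), 0)" and g = u])
           (auto intro!: derivative_eq_intros du l)
      thus ?thesis unfolding has_field_derivative_def
        by (rule has_derivative_eq_rhs) (auto simp: inner_prod_def mult.commute)
    qed
    obtain s where "u (b + 1 *\<^sub>R (x - b), l) - u (b + 0 *\<^sub>R (x - b), l) = (1 - 0) * ((x - b, 0) \<bullet> hess_apply F (b + s *\<^sub>R (x - b), l) e)"
      using MVT2[of 0 1 "\<lambda>s. u (b + s *\<^sub>R (x - b), l)" "\<lambda>s. (x - b, 0) \<bullet> hess_apply F (b + s *\<^sub>R (x - b), l) e", OF _ d]
      by auto
    hence "u (x, l) - u (b, l) = (x - b, 0) \<bullet> hess_apply F (b + s *\<^sub>R (x - b), l) e" by simp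
    also have "\<dots> \<le> norm (x - b, 0::real) * norm (hess_apply F (b + s *\<^sub>R (x - b), l) e)" by (rule norm_cauchy_schwarz)
    also have "\<dots> \<le> (DIM('a) * l) * (\<epsilon> / l)"
      using norm_diff_corner_le[OF x] H[of l] l by (intro mult_mono) auto
    finally show ?thesis using l by (simp add: mult.commute)
  qed
  have 2: "u (x, y) - u (x, l) \<le> \<epsilon> * ln (l / y)"
  proof -
    have "u (x, y) + \<epsilon> * ln y \<le> u (x, l) + \<epsilon> * ln l"
    proof (rule DERIV_nonneg_imp_nondecreasing[OF y(2)])
      fix s assume s: "y \<le> s" "s \<le> l"
      have "((\<lambda>s. u (x, s)) has_derivative (\<lambda>h. (0, h) \<bullet> hess_apply F (x, s) e)) (at s)"
        by (rule has_derivative_compose[where f = "\<lambda>s. (x, s)" and f' = "\<lambda>h. (0, h)" and g = u])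
           (use s y in \<open>auto intro!: derivative_eq_intros du\<close>)
      hence d: "((\<lambda>s. u (x, s)) has_real_derivative (0, 1) \<bullet> hess_apply F (x, s) e) (at s)"
        unfolding has_field_derivative_def by (rule has_derivative_eq_rhs) (auto simp: inner_prod_def mult.commute)
      have "((\<lambda>s. u (x, s) + \<epsilon> * ln s) has_real_derivative (0, 1) \<bullet> hess_apply F (x, s) e + \<epsilon> / s) (at s)"
        using s y by (auto intro!: derivative_eq_intros d)
      moreover have "- ((0, 1) \<bullet> hess_apply F (x, s) e) \<le> \<epsilon> / s"
      proof -
        have "- ((0, 1) \<bullet> hess_apply F (x, s) e) \<le> norm (0::'a, 1::real) * norm (hess_apply F (x, s) e)"
          using Cauchy_Schwarz_ineq2[of "(0::'a, 1::real)" "hess_apply F (x, s) e"] by linarith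
        also have "\<dots> = norm (hess_apply F (x, s) e)" by (simp add: norm_Pair)
        finally show ?thesis using H[of s x] s y by linarith
      qed
      ultimately show "\<exists>d. ((\<lambda>s. u (x, s) + \<epsilon> * ln s) has_real_derivative d) (at s) \<and> 0 \<le> d"
        by (intro exI conjI) auto
    qed
    thus ?thesis using l y by (simp add: ln_div algebra_simps)
  qed
  have "norm w = e \<bullet> w" using w by (simp add: e_def power2_norm_eq_inner[symmetric] power2_eq_square)
  also have "\<dots> = u (x, y) - u (b, l)" by (simp add: u_def w_def inner_diff_right)
  also have "\<dots> \<le> \<epsilon> * (DIM('a) + ln (l / y))" using 1 2 by (simp add: distrib_left)
  finally show ?thesis by (simp add: w_def)
qed

text \<open>The boundary term at height \<open>t\<close> is additive over subcubes. Hence the difference of this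
  functional on a cube and on a stopping partition of it is the energy of the region in between, although
  lateral faces of neighbouring Whitney boxes are never matched up.\<close>

definition green_functional :: "('a::euclidean_space \<times> real \<Rightarrow> real) \<Rightarrow> 'a \<times> real \<Rightarrow> real \<Rightarrow> real \<Rightarrow> 'a \<times> real \<Rightarrow> real" where
  "green_functional F e c t w =
     integral (cbox (fst w, t) (fst w + snd w *\<^sub>R One, snd w)) (\<lambda>z. snd z * (2 * (norm (hess_apply F z e))\<^sup>2))
     + integral (cube (fst w) (snd w)) (\<lambda>x. flux 0 1 c t (e \<bullet> grad F (x, t)) (hess_apply F (x, t) e))"

context
  fixes F :: "'a::euclidean_space \<times> real \<Rightarrow> real" and \<epsilon> l t :: real and b :: 'a and e :: "'a \<times> real"
  assumes F: "harmonic_on F upper_half_space" and bl: "bloch_below F \<epsilon> l"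
    and tl: "0 < t" "t \<le> l" and e: "norm e = 1"
begin

lemma slice_estimates:
  shows "0 \<le> \<epsilon>" "cbox (b, t) (b + l *\<^sub>R One, l) \<subseteq> upper_half_space"
    and "s \<in> {t..l} \<Longrightarrow> continuous_on (cube b l) (\<lambda>x. e \<bullet> grad F (x, s))"
    and "s \<in> {t..l} \<Longrightarrow> continuous_on (cube b l) (\<lambda>x. hess_apply F (x, s) e)"
    and "s \<in> {t..l} \<Longrightarrow> x \<in> cube b l \<Longrightarrow> \<bar>s * (hess_apply F (x, s) e \<bullet> (0, 1))\<bar> \<le> \<epsilon>"
    and "s \<in> {t..l} \<Longrightarrow> x \<in> cube b l \<Longrightarrow> \<bar>e \<bullet> grad F (x, s) - e \<bullet> grad F (b, l)\<bar> \<le> \<epsilon> * (DIM('a) + ln (l / s))"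
proof -
  have C2: "C2_on F upper_half_space" using F by (simp add: harmonic_on_def)
  have l: "0 < l" using tl by simp
  show "0 \<le> \<epsilon>" using bloch_below_nonneg[OF bl l] .
  show "cbox (b, t) (b + l *\<^sub>R One, l) \<subseteq> upper_half_space"
    using tl by (auto simp: upper_half_space_iff)
  show "continuous_on (cube b l) (\<lambda>x. e \<bullet> grad F (x, s))" if "s \<in> {t..l}"
    using that tl by (intro continuous_intros continuous_on_compose2[OF C2_on_continuous_grad[OF C2 open_upper_half_space]])
       (auto simp: upper_half_space_iff)
  show "continuous_on (cube b l) (\<lambda>x. hess_apply F (x, s) e)" if "s \<in> {t..l}"
    using that tl by (intro continuous_intros continuous_on_compose2[OF C2_on_continuous_hess_apply'[OF C2 open_upper_half_space]])
       (auto simp: upper_half_space_iff)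
  show "\<bar>s * (hess_apply F (x, s) e \<bullet> (0, 1))\<bar> \<le> \<epsilon>" if s: "s \<in> {t..l}" and "x \<in> cube b l"
  proof -
    have "\<bar>hess_apply F (x, s) e \<bullet> (0, 1)\<bar> \<le> norm (hess_apply F (x, s) e)"
      by (rule Basis_le_norm) (simp add: Basis_prod_def)
    hence "s * \<bar>hess_apply F (x, s) e \<bullet> (0, 1)\<bar> \<le> s * norm (hess_apply F (x, s) e)"
      using s tl by (intro mult_left_mono) auto
    also have "\<dots> \<le> \<epsilon>" using bloch_below_hess_apply[OF bl _ _ e] s tl by auto
    finally show ?thesis using s tl by (simp add: abs_mult)
  qed
  show "\<bar>e \<bullet> grad F (x, s) - e \<bullet> grad F (b, l)\<bar> \<le> \<epsilon> * (DIM('a) + ln (l / s))" if s: "s \<in> {t..l}" and x: "x \<in> cube b l"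
  proof -
    have "\<bar>e \<bullet> (grad F (x, s) - grad F (b, l))\<bar> \<le> norm e * norm (grad F (x, s) - grad F (b, l))"
      by (rule Cauchy_Schwarz_ineq2)
    also have "\<dots> \<le> \<epsilon> * (DIM('a) + ln (l / s))"
      using grad_oscillation_le[OF F bl l x, of s] s tl e by simp
    finally show ?thesis by (simp add: inner_diff_right)
  qed
qed

text \<open>With \<open>(p, q) = (1, 0)\<close> the volume term of Green's formula vanishes: the
  mean of \<open>e \<bullet> grad F\<close> at height \<open>t\<close> is its value at the top
  corner, up to a multiple of \<open>\<epsilon>\<close> independent of \<open>t\<close>. The lateral
  faces contribute \<open>2 * DIM('a)\<close>, the top \<open>1 + DIM('a)\<close> and the bottom
  1.\<close>

lemma first_moment:
  "\<bar>integral (cube b l) (\<lambda>x. e \<bullet> grad F (x, t)) - l ^ DIM('a) * (e \<bullet> grad F (b, l))\<bar>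
    \<le> (2 + 3 * DIM('a)) * \<epsilon> * l ^ DIM('a)"
proof -
  define c where "c = e \<bullet> grad F (b, l)"
  define u where "u z = e \<bullet> grad F z" for z
  define Gy where "Gy s x = s * (hess_apply F (x, s) e \<bullet> (0, 1))" for s x
  define n where "n = real DIM('a)"
  define V where "V = l ^ DIM('a)"
  have l: "0 < l" using tl by simp
  have V: "0 < V" using l by (simp add: V_def)
  have n: "0 \<le> n" by (simp add: n_def)
  note S = slice_estimates
  have mt: "t \<in> {t..l}" "l \<in> {t..l}" using tl by auto
  have Q: "cube b l = cbox b (b + l *\<^sub>R One)" by (simp add: cube_def)
  have mV: "measure lborel (cbox b (b + l *\<^sub>R One)) = V" using content_cube[of l b] l by (simp add: Q V_def)
  have fl: "flux 1 0 c s (u z) G = s * (G \<bullet> (0, 1)) - (u z - c)" for s z G by (simp add: flux_def)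
  have "\<bar>integral (cbox (b, t) (b + l *\<^sub>R One, l)) (\<lambda>z. snd z * (2 * 0 * (norm (hess_apply F z e))\<^sup>2))
      - (integral (cube b l) (\<lambda>x. flux 1 0 c l (e \<bullet> grad F (x, l)) (hess_apply F (x, l) e))
       - integral (cube b l) (\<lambda>x. flux 1 0 c t (e \<bullet> grad F (x, t)) (hess_apply F (x, t) e)))\<bar>
    \<le> 2 * DIM('a) * l ^ DIM('a) * (\<epsilon> * (1 + 0))"
  proof (rule green_directional_derivative[OF F open_upper_half_space e tl _ _ S(1) refl S(2)])
    fix x y assume xy: "(x, y) \<in> cbox (b, t) (b + l *\<^sub>R One, l)"
    show "\<bar>y\<bar> * norm (hess_apply F (x, y) e) \<le> \<epsilon>"
      using xy tl bloch_below_hess_apply[OF bl _ _ e, of y x] by simp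
  qed auto
  hence 1: "\<bar>integral (cube b l) (\<lambda>x. Gy l x - (u (x, l) - c)) - integral (cube b l) (\<lambda>x. Gy t x - (u (x, t) - c))\<bar> \<le> 2 * n * V * \<epsilon>"
    by (simp add: fl[unfolded u_def] u_def Gy_def n_def V_def)
  have cu: "continuous_on (cube b l) (\<lambda>x. u (x, s))" if "s \<in> {t..l}" for s
    using S(3)[OF that] by (simp add: u_def)
  have cG: "continuous_on (cube b l) (Gy s)" if "s \<in> {t..l}" for s
    unfolding Gy_def by (intro continuous_intros S(4)[OF that])
  have top: "\<bar>integral (cube b l) (\<lambda>x. Gy l x - (u (x, l) - c))\<bar> \<le> (\<epsilon> + n * \<epsilon>) * V"
    unfolding Q mV[symmetric]
  proof (rule abs_integral_cbox_le, unfold Q[symmetric])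
    show "0 \<le> \<epsilon> + n * \<epsilon>" using S(1) n by simp
    show "continuous_on (cube b l) (\<lambda>x. Gy l x - (u (x, l) - c))" by (intro continuous_intros cu cG mt)
    fix x assume x: "x \<in> cube b l"
    show "\<bar>Gy l x - (u (x, l) - c)\<bar> \<le> \<epsilon> + n * \<epsilon>"
      using S(5)[OF mt(2) x] S(6)[OF mt(2) x] l unfolding Gy_def u_def c_def n_def
      by (simp add: mult.commute)
  qed
  have bot: "\<bar>integral (cube b l) (Gy t)\<bar> \<le> \<epsilon> * V"
    unfolding Q mV[symmetric]
    by (rule abs_integral_cbox_le, unfold Q[symmetric]) (use S(1,5) cG mt in \<open>auto simp: Gy_def\<close>)
  have "integral (cube b l) (\<lambda>x. Gy t x - (u (x, t) - c)) = integral (cube b l) (Gy t) - (integral (cube b l) (\<lambda>x. u (x, t)) - c * V)"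
  proof -
    have i: "Gy t integrable_on cube b l" "(\<lambda>x. u (x, t)) integrable_on cube b l" "(\<lambda>x. c) integrable_on cube b l"
      using cG[OF mt(1)] cu[OF mt(1)] unfolding Q by (auto intro: integrable_continuous)
    have "integral (cube b l) (\<lambda>x. c) = c * V" unfolding Q using mV by simp
    thus ?thesis using i by (simp add: integral_diff integrable_diff)
  qed
  hence "\<bar>integral (cube b l) (\<lambda>x. u (x, t)) - c * V\<bar> \<le> 2 * n * V * \<epsilon> + (\<epsilon> + n * \<epsilon>) * V + \<epsilon> * V"
    using 1 top bot by linarith
  thus ?thesis by (simp add: u_def c_def n_def V_def algebra_simps)
qed

text \<open>With \<open>(p, q) = (0, 1)\<close> the flux through the top face is minus the squared
  distance of the corner value from \<open>c\<close>, up to small terms. The error is only linear in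
  \<open>r\<close>, which is why displacements of size \<open>M * \<epsilon>\<close> dominate it for
  large \<open>M\<close>.\<close>

lemma second_moment:
  assumes r: "\<bar>e \<bullet> grad F (b, l) - c\<bar> \<le> r"
  shows "\<bar>green_functional F e c t (b, l) + l ^ DIM('a) * (e \<bullet> grad F (b, l) - c)\<^sup>2\<bar>
    \<le> 6 * (real DIM('a) + 1)\<^sup>2 * \<epsilon> * (r + \<epsilon>) * l ^ DIM('a)"
proof -
  define c0 where "c0 = e \<bullet> grad F (b, l)"
  define u where "u z = e \<bullet> grad F z" for z
  define Gy where "Gy s x = s * (hess_apply F (x, s) e \<bullet> (0, 1))" for s x
  define n where "n = real DIM('a)"
  define V where "V = l ^ DIM('a)"
  have l: "0 < l" using tl by simp
  have V: "0 < V" using l by (simp add: V_def)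
  have n: "0 \<le> n" by (simp add: n_def)
  have r0: "0 \<le> r" "\<bar>c0 - c\<bar> \<le> r" using r by (auto simp: c0_def)
  note S = slice_estimates
  have mt: "t \<in> {t..l}" "l \<in> {t..l}" using tl by auto
  have Q: "cube b l = cbox b (b + l *\<^sub>R One)" by (simp add: cube_def)
  have mV: "measure lborel (cbox b (b + l *\<^sub>R One)) = V" using content_cube[of l b] l by (simp add: Q V_def)
  let ?A = "2 * (r + \<epsilon> * n)" and ?B = "2 * \<epsilon>"
  have "\<bar>integral (cbox (b, t) (b + l *\<^sub>R One, l)) (\<lambda>z. snd z * (2 * 1 * (norm (hess_apply F z e))\<^sup>2))
      - (integral (cube b l) (\<lambda>x. flux 0 1 c l (e \<bullet> grad F (x, l)) (hess_apply F (x, l) e))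
       - integral (cube b l) (\<lambda>x. flux 0 1 c t (e \<bullet> grad F (x, t)) (hess_apply F (x, t) e)))\<bar>
    \<le> 2 * DIM('a) * l ^ DIM('a) * (\<epsilon> * (?A + ?B))"
  proof (rule green_directional_derivative[OF F open_upper_half_space e tl _ _ S(1) refl S(2)])
    fix x y assume xy: "(x, y) \<in> cbox (b, t) (b + l *\<^sub>R One, l)"
    hence y: "y \<in> {t..l}" "x \<in> cube b l" by (auto simp: cube_def)
    show "\<bar>y\<bar> * norm (hess_apply F (x, y) e) \<le> \<epsilon>"
      using xy tl bloch_below_hess_apply[OF bl _ _ e, of y x] by simp
    show "\<bar>0 + 2 * 1 * (e \<bullet> grad F (x, y) - c)\<bar> \<le> ?A + ?B * ln (l / y)"
      using S(6)[OF y] r unfolding n_def by (simp add: algebra_simps)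
  qed (use r0 S(1) n in auto)
  hence 1: "\<bar>green_functional F e c t (b, l) - integral (cube b l) (\<lambda>x. flux 0 1 c l (e \<bullet> grad F (x, l)) (hess_apply F (x, l) e))\<bar>
      \<le> 2 * n * V * (\<epsilon> * (?A + ?B))"
    unfolding green_functional_def by (simp add: n_def V_def algebra_simps)
  have "\<bar>integral (cube b l) (\<lambda>x. flux 0 1 c l (e \<bullet> grad F (x, l)) (hess_apply F (x, l) e) + (c0 - c)\<^sup>2)\<bar>
      \<le> (2 * \<epsilon> * (r + n * \<epsilon>) + n * \<epsilon> * (2 * r + n * \<epsilon>)) * V"
    unfolding Q mV[symmetric]
  proof (rule abs_integral_cbox_le, unfold Q[symmetric])
    show "0 \<le> 2 * \<epsilon> * (r + n * \<epsilon>) + n * \<epsilon> * (2 * r + n * \<epsilon>)" using S(1) n r0 by simp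
    show "continuous_on (cube b l) (\<lambda>x. flux 0 1 c l (e \<bullet> grad F (x, l)) (hess_apply F (x, l) e) + (c0 - c)\<^sup>2)"
      unfolding flux_def by (intro continuous_intros S mt)
    fix x assume x: "x \<in> cube b l"
    define U where "U = u (x, l)"
    have U: "\<bar>U - c0\<bar> \<le> n * \<epsilon>" using S(6)[OF mt(2) x] l by (simp add: U_def u_def c0_def n_def mult.commute)
    have Uc: "\<bar>U - c\<bar> \<le> r + n * \<epsilon>" using U r0 by linarith
    have g: "\<bar>Gy l x\<bar> \<le> \<epsilon>" using S(5)[OF mt(2) x] by (simp add: Gy_def)
    \<comment> \<open>The difference of the squares of \<open>U - c\<close> and
      \<open>c0 - c\<close> is factored, so that its first factor \<open>U - c0\<close> is
      \<open>O(\<epsilon>)\<close> by the oscillation bound.\<close>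
    have "flux 0 1 c l (e \<bullet> grad F (x, l)) (hess_apply F (x, l) e) + (c0 - c)\<^sup>2
      = 2 * (Gy l x * (U - c)) - (U - c0) * ((U - c) + (c0 - c))"
      by (simp add: flux_def Gy_def U_def u_def power2_eq_square algebra_simps)
    moreover have "\<bar>Gy l x * (U - c)\<bar> \<le> \<epsilon> * (r + n * \<epsilon>)"
      unfolding abs_mult using g Uc S(1) by (intro mult_mono) auto
    moreover have "\<bar>(U - c0) * ((U - c) + (c0 - c))\<bar> \<le> n * \<epsilon> * (2 * r + n * \<epsilon>)"
      unfolding abs_mult using U Uc r0 n S(1) by (intro mult_mono) auto
    ultimately show "\<bar>flux 0 1 c l (e \<bullet> grad F (x, l)) (hess_apply F (x, l) e) + (c0 - c)\<^sup>2\<bar>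
       \<le> 2 * \<epsilon> * (r + n * \<epsilon>) + n * \<epsilon> * (2 * r + n * \<epsilon>)" by linarith
  qed
  moreover have "integral (cube b l) (\<lambda>x. flux 0 1 c l (e \<bullet> grad F (x, l)) (hess_apply F (x, l) e) + (c0 - c)\<^sup>2)
     = integral (cube b l) (\<lambda>x. flux 0 1 c l (e \<bullet> grad F (x, l)) (hess_apply F (x, l) e)) + V * (c0 - c)\<^sup>2"
  proof -
    have "continuous_on (cube b l) (\<lambda>x. flux 0 1 c l (e \<bullet> grad F (x, l)) (hess_apply F (x, l) e))"
      unfolding flux_def by (intro continuous_intros S mt)
    hence i: "(\<lambda>x. flux 0 1 c l (e \<bullet> grad F (x, l)) (hess_apply F (x, l) e)) integrable_on cube b l"
      unfolding Q by (rule integrable_continuous)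
    have "integral (cube b l) (\<lambda>x. (c0 - c)\<^sup>2) = V * (c0 - c)\<^sup>2" unfolding Q using mV by simp
    thus ?thesis using i by (subst integral_add) (auto simp: Q)
  qed
  ultimately have "\<bar>green_functional F e c t (b, l) + V * (c0 - c)\<^sup>2\<bar>
     \<le> 2 * n * V * (\<epsilon> * (?A + ?B)) + (2 * \<epsilon> * (r + n * \<epsilon>) + n * \<epsilon> * (2 * r + n * \<epsilon>)) * V"
    using 1 by linarith
  also have "\<dots> = (\<epsilon> * r * (2 + 6 * n) + \<epsilon> * \<epsilon> * (5 * n\<^sup>2 + 6 * n)) * V"
    by (simp add: algebra_simps power2_eq_square)
  also have "\<dots> \<le> (\<epsilon> * r * (6 * (n + 1)\<^sup>2) + \<epsilon> * \<epsilon> * (6 * (n + 1)\<^sup>2)) * V"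
  proof -
    have "2 + 6 * n \<le> 6 * (n + 1)\<^sup>2" "5 * n\<^sup>2 + 6 * n \<le> 6 * (n + 1)\<^sup>2"
      using n by (auto simp: power2_eq_square algebra_simps)
    thus ?thesis using S(1) r0 V by (intro mult_right_mono add_mono mult_left_mono) auto
  qed
  finally show ?thesis by (simp add: c0_def V_def n_def algebra_simps)
qed

end

subsection \<open>The tree of \<open>N\<close>-adic subcubes\<close>

lemma
  fixes S :: "'a::euclidean_space \<Rightarrow> real set"
  assumes S: "\<And>i. i \<in> Basis \<Longrightarrow> finite (S i)"
  shows finite_coordinate_product: "finite {d. \<forall>i\<in>Basis. d \<bullet> i \<in> S i}"
    and card_coordinate_product_le: "card {d. \<forall>i\<in>Basis. d \<bullet> i \<in> S i} \<le> (\<Prod>i\<in>Basis. card (S i))"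
proof -
  let ?f = "\<lambda>f. \<Sum>i\<in>Basis. f i *\<^sub>R i :: 'a"
  have sub: "{d. \<forall>i\<in>Basis. d \<bullet> i \<in> S i} \<subseteq> ?f ` PiE Basis S"
  proof
    fix d assume d: "d \<in> {d. \<forall>i\<in>Basis. d \<bullet> i \<in> S i}"
    have "d = ?f (restrict (\<lambda>i. d \<bullet> i) Basis)" by (simp add: euclidean_representation)
    moreover have "restrict (\<lambda>i. d \<bullet> i) Basis \<in> PiE Basis S" using d by auto
    ultimately show "d \<in> ?f ` PiE Basis S" by blast
  qed
  have fin: "finite (PiE Basis S)" using S by (intro finite_PiE) auto
  show "finite {d. \<forall>i\<in>Basis. d \<bullet> i \<in> S i}" using sub fin finite_surj by blast
  have "card {d. \<forall>i\<in>Basis. d \<bullet> i \<in> S i} \<le> card (?f ` PiE Basis S)" using sub fin by (intro card_mono) auto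
  also have "\<dots> \<le> card (PiE Basis S)" using fin by (rule card_image_le)
  also have "\<dots> = (\<Prod>i\<in>Basis. card (S i))" by (rule card_PiE) simp
  finally show "card {d. \<forall>i\<in>Basis. d \<bullet> i \<in> S i} \<le> (\<Prod>i\<in>Basis. card (S i))" .
qed

definition digits :: "nat \<Rightarrow> 'a::euclidean_space set" where
  "digits N = {d. \<forall>i\<in>Basis. d \<bullet> i \<in> real ` {..<N}}"

text \<open>A cube is encoded as a pair of corner and sidelength, hence as the point of the half-space above
  its corner at height equal to the sidelength.\<close>

definition children :: "nat \<Rightarrow> 'a::euclidean_space \<times> real \<Rightarrow> ('a \<times> real) set" where
  "children N w = (\<lambda>d. (fst w + (snd w / N) *\<^sub>R d, snd w / N)) ` digits N"

definition cube_of :: "'a::euclidean_space \<times> real \<Rightarrow> 'a set" where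
  "cube_of w = cube (fst w) (snd w)"

definition cube_vol :: "'a::euclidean_space \<times> real \<Rightarrow> real" where
  "cube_vol w = snd w ^ DIM('a)"

lemma cube_of_cbox: "cube_of w = cbox (fst w) (fst w + snd w *\<^sub>R One)"
  by (simp add: cube_of_def cube_def)

lemma mem_cube_of: "x \<in> cube_of w \<longleftrightarrow> (\<forall>i\<in>Basis. fst w \<bullet> i \<le> x \<bullet> i \<and> x \<bullet> i \<le> fst w \<bullet> i + snd w)"
  by (auto simp: cube_of_cbox mem_box inner_simps)

lemma mem_interior_cube_of: "x \<in> interior (cube_of w) \<longleftrightarrow> (\<forall>i\<in>Basis. fst w \<bullet> i < x \<bullet> i \<and> x \<bullet> i < fst w \<bullet> i + snd w)"
  by (auto simp: cube_of_cbox mem_box inner_simps)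

lemma finite_digits: "finite (digits N)"
  unfolding digits_def by (rule finite_coordinate_product) simp

lemma finite_children: "finite (children N w)"
  unfolding children_def using finite_digits by blast

lemma snd_children: "w' \<in> children N w \<Longrightarrow> snd w' = snd w / N"
  by (auto simp: children_def)

lemma interior_cube_of_nonempty: "0 < snd w \<Longrightarrow> interior (cube_of w) \<noteq> {}"
proof -
  assume "0 < snd w"
  hence "fst w + (snd w / 2) *\<^sub>R One \<in> interior (cube_of w)"
    unfolding mem_interior_cube_of by (auto simp: inner_simps)
  thus ?thesis by blast
qed

lemma children_subset:
  assumes "w' \<in> children N w" "0 < snd w" "0 < N"
  shows "cube_of w' \<subseteq> cube_of w"
proof
  fix x assume x: "x \<in> cube_of w'"
  obtain d where d: "d \<in> digits N" "w' = (fst w + (snd w / N) *\<^sub>R d, snd w / N)"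
    using assms by (auto simp: children_def)
  show "x \<in> cube_of w" unfolding mem_cube_of
  proof
    fix i :: 'a assume i: "i \<in> Basis"
    obtain k where k: "k < N" "d \<bullet> i = real k" using d i by (auto simp: digits_def)
    have "fst w \<bullet> i + (snd w / N) * k \<le> x \<bullet> i" "x \<bullet> i \<le> fst w \<bullet> i + (snd w / N) * k + snd w / N"
      using x i unfolding mem_cube_of by (auto simp: d k inner_simps)
    moreover have "(snd w / N) * k + snd w / N \<le> snd w"
    proof -
      have "(snd w / N) * (real k + 1) \<le> (snd w / N) * N" using k assms by (intro mult_left_mono) auto
      thus ?thesis using assms by (simp add: distrib_left)
    qed
    moreover have "0 \<le> (snd w / N) * k" using assms by simp
    ultimately show "fst w \<bullet> i \<le> x \<bullet> i \<and> x \<bullet> i \<le> fst w \<bullet> i + snd w" by linarith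
  qed
qed

lemma children_interior_disjoint:
  assumes w: "w1 \<in> children N w" "w2 \<in> children N w" "0 < snd w" "0 < N"
    and x: "x \<in> interior (cube_of w1)" "x \<in> interior (cube_of w2)"
  shows "w1 = w2"
proof -
  obtain d1 d2 where d: "d1 \<in> digits N" "w1 = (fst w + (snd w / N) *\<^sub>R d1, snd w / N)"
      "d2 \<in> digits N" "w2 = (fst w + (snd w / N) *\<^sub>R d2, snd w / N)"
    using w by (auto simp: children_def)
  have "d1 \<bullet> i = d2 \<bullet> i" if i: "i \<in> Basis" for i
  proof -
    obtain k1 k2 where k: "d1 \<bullet> i = real k1" "d2 \<bullet> i = real k2" using d(1,3) i by (fastforce simp: digits_def)
    have h: "0 < snd w / N" using w by simp
    have "(snd w / N) * k1 < (snd w / N) * (k2 + 1)" "(snd w / N) * k2 < (snd w / N) * (k1 + 1)"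
    proof -
      have "fst w1 \<bullet> i < x \<bullet> i" "x \<bullet> i < fst w1 \<bullet> i + snd w1" "fst w2 \<bullet> i < x \<bullet> i" "x \<bullet> i < fst w2 \<bullet> i + snd w2"
        using x i unfolding mem_interior_cube_of by auto
      thus "(snd w / N) * k1 < (snd w / N) * (k2 + 1)" "(snd w / N) * k2 < (snd w / N) * (k1 + 1)"
        by (simp_all add: d(2,4) k inner_simps distrib_left)
    qed
    hence "real k1 < real k2 + 1" "real k2 < real k1 + 1"
      using h by (auto simp only: mult_less_cancel_left_pos of_nat_add of_nat_1)
    hence "k1 = k2" by linarith
    thus ?thesis using k by simp
  qed
  hence "d1 = d2" by (rule euclidean_eqI)
  thus ?thesis using d by simp
qed

lemma children_division:
  fixes w :: "'a::euclidean_space \<times> real"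
  assumes w: "0 < snd w" "0 < N"
  shows "(cube_of ` children N w) division_of cube_of w" "inj_on cube_of (children N w)"
proof -
  have pos: "0 < snd w'" if "w' \<in> children N w" for w' using snd_children[OF that] w by simp
  show inj: "inj_on cube_of (children N w)"
    using children_interior_disjoint[OF _ _ w] interior_cube_of_nonempty[OF pos] by (intro inj_onI) fastforce
  show "(cube_of ` children N w) division_of cube_of w"
  proof (rule division_ofI)
    show "finite (cube_of ` children N w)" using finite_children by blast
    fix K assume "K \<in> cube_of ` children N w"
    then obtain w' where w': "w' \<in> children N w" "K = cube_of w'" by blast
    show "K \<subseteq> cube_of w" using w' children_subset w by blast
    show "K \<noteq> {}" using interior_cube_of_nonempty[OF pos[OF w'(1)]] w'(2) interior_subset by blast
    show "\<exists>a b. K = cbox a b" using w' cube_of_cbox by blast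
    fix K' assume "K' \<in> cube_of ` children N w" "K \<noteq> K'"
    thus "interior K \<inter> interior K' = {}" using children_interior_disjoint[OF w'(1) _ w] w'(2) by blast
  next
    show "\<Union>(cube_of ` children N w) = cube_of w"
    proof
      show "\<Union>(cube_of ` children N w) \<subseteq> cube_of w" using children_subset w by blast
      show "cube_of w \<subseteq> \<Union>(cube_of ` children N w)"
      proof
        fix x assume x: "x \<in> cube_of w"
        define h where "h = snd w / N"
        have h: "0 < h" "N * h = snd w" using w by (auto simp: h_def)
        \<comment> \<open>The minimum with \<open>N - 1\<close> assigns points of the far faces,
          where the quotient equals \<open>N\<close>, to the last child.\<close>
        define k where "k i = min (nat \<lfloor>(x \<bullet> i - fst w \<bullet> i) / h\<rfloor>) (N - 1)" for i
        define d where "d = (\<Sum>i\<in>Basis. real (k i) *\<^sub>R i :: 'a)"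
        have di: "d \<bullet> i = real (k i)" if "i \<in> Basis" for i
          using that by (simp add: d_def inner_sum_left inner_Basis if_distrib cong: if_cong)
        have "k i < N" for i using w by (auto simp: k_def min_def)
        hence "d \<in> digits N" using di by (auto simp: digits_def)
        hence "(fst w + h *\<^sub>R d, h) \<in> children N w" unfolding children_def h_def by blast
        moreover have "x \<in> cube_of (fst w + h *\<^sub>R d, h)" unfolding mem_cube_of
        proof
          fix i :: 'a assume i: "i \<in> Basis"
          define q where "q = (x \<bullet> i - fst w \<bullet> i) / h"
          have q: "0 \<le> q" "q \<le> N" "x \<bullet> i = fst w \<bullet> i + h * q"
            using x i h unfolding mem_cube_of q_def by (auto simp: field_simps)
          have "real (k i) \<le> q \<and> q \<le> real (k i) + 1"
          proof (cases "nat \<lfloor>q\<rfloor> \<le> N - 1")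
            case True
            hence "k i = nat \<lfloor>q\<rfloor>" by (simp add: k_def q_def)
            thus ?thesis using q by linarith
          next
            case False
            have "k i = N - 1" using False by (simp add: k_def q_def)
            moreover have "real N \<le> q"
            proof -
              have "int N \<le> \<lfloor>q\<rfloor>" using False w by linarith
              thus ?thesis by linarith
            qed
            ultimately have "k i = N - 1" "real N \<le> q" by auto
            thus ?thesis using q w by auto
          qed
          hence "h * real (k i) \<le> h * q" "h * q \<le> h * (real (k i) + 1)" using h by auto
          thus "fst (fst w + h *\<^sub>R d, h) \<bullet> i \<le> x \<bullet> i \<and> x \<bullet> i \<le> fst (fst w + h *\<^sub>R d, h) \<bullet> i + snd (fst w + h *\<^sub>R d, h)"
            using q di[OF i] by (simp add: inner_simps algebra_simps)
        qed
        ultimately show "x \<in> \<Union>(cube_of ` children N w)" by blast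
      qed
    qed
  qed
qed

lemma integral_children:
  fixes f :: "'a::euclidean_space \<Rightarrow> real"
  assumes "0 < snd w" "0 < N" "f integrable_on cube_of w"
  shows "integral (cube_of w) f = (\<Sum>w'\<in>children N w. integral (cube_of w') f)"
  using integral_combine_division_topdown[OF assms(3) children_division(1)[OF assms(1,2)]]
    sum.reindex[OF children_division(2)[OF assms(1,2)], of "\<lambda>K. integral K f"] by (simp add: comp_def)

lemma cube_vol_children:
  assumes "0 < snd w" "0 < N"
  shows "cube_vol w = (\<Sum>w'\<in>children N w. cube_vol w')"
proof -
  have 1: "integral (cube_of w') (\<lambda>_. 1::real) = cube_vol w'" if "0 < snd w'" for w' :: "'a \<times> real"
    using that content_cube[of "snd w'" "fst w'"] by (simp add: cube_of_def cube_vol_def cube_def)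
  have "integral (cube_of w) (\<lambda>_. 1::real) = (\<Sum>w'\<in>children N w. integral (cube_of w') (\<lambda>_. 1))"
    by (rule integral_children[OF assms]) (simp add: cube_of_cbox integrable_continuous)
  also have "\<dots> = (\<Sum>w'\<in>children N w. cube_vol w')"
    using assms by (intro sum.cong refl 1) (simp add: snd_children)
  finally show ?thesis using 1 assms by simp
qed

lemma integral_box_children:
  fixes f :: "'a::euclidean_space \<times> real \<Rightarrow> real"
  assumes w: "0 < snd w" "0 < N" and f: "continuous_on (cbox (fst w, s) (fst w + snd w *\<^sub>R One, r)) f"
  shows "integral (cbox (fst w, s) (fst w + snd w *\<^sub>R One, r)) f =
    (\<Sum>w'\<in>children N w. integral (cbox (fst w', s) (fst w' + snd w' *\<^sub>R One, r)) f)"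
proof -
  have "integral (cbox (fst w, s) (fst w + snd w *\<^sub>R One, r)) f = integral (cube_of w) (\<lambda>x. integral (cbox s r) (\<lambda>y. f (x, y)))"
    unfolding cube_of_cbox by (rule integral_prod_continuous[OF f])
  also have "\<dots> = (\<Sum>w'\<in>children N w. integral (cube_of w') (\<lambda>x. integral (cbox s r) (\<lambda>y. f (x, y))))"
    by (rule integral_children[OF w]) (use integral_integrable_2dim[OF f] in \<open>simp add: cube_of_cbox\<close>)
  also have "\<dots> = (\<Sum>w'\<in>children N w. integral (cbox (fst w', s) (fst w' + snd w' *\<^sub>R One, r)) f)"
  proof (rule sum.cong[OF refl])
    fix w' assume "w' \<in> children N w"
    hence "cube_of w' \<subseteq> cube_of w" using w by (rule children_subset)
    hence "cbox (fst w', s) (fst w' + snd w' *\<^sub>R One, r) \<subseteq> cbox (fst w, s) (fst w + snd w *\<^sub>R One, r)"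
      unfolding cbox_Pair_eq cube_of_cbox by blast
    from integral_prod_continuous[OF continuous_on_subset[OF f this]]
    show "integral (cube_of w') (\<lambda>x. integral (cbox s r) (\<lambda>y. f (x, y))) = integral (cbox (fst w', s) (fst w' + snd w' *\<^sub>R One, r)) f"
      by (simp add: cube_of_cbox)
  qed
  finally show ?thesis .
qed

subsection \<open>Stopping-time sums on trees\<close>

text \<open>The sum over the leaves of the tree below \<open>w\<close>, cut at the stopping time or
  after \<open>r\<close> levels, whichever comes first. As \<open>r\<close> is the remaining depth,
  a leaf satisfies \<open>r = 0\<close> or is stopped.\<close>

fun stopped_sum :: "('w \<Rightarrow> 'w set) \<Rightarrow> ('w \<Rightarrow> bool) \<Rightarrow> nat \<Rightarrow> 'w \<Rightarrow> ('w \<Rightarrow> real) \<Rightarrow> real" where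
  "stopped_sum ch stop 0 w f = f w"
| "stopped_sum ch stop (Suc r) w f = (if stop w then f w else \<Sum>w'\<in>ch w. stopped_sum ch stop r w' f)"

lemma stopped_sum_stop: "stop w \<Longrightarrow> stopped_sum ch stop r w f = f w"
  by (cases r) auto

lemma stopped_sum_add: "stopped_sum ch stop r w (\<lambda>w. f w + g w) = stopped_sum ch stop r w f + stopped_sum ch stop r w g"
  by (induction r arbitrary: w) (auto simp: sum.distrib)

lemma stopped_sum_cmult: "stopped_sum ch stop r w (\<lambda>w. c * f w) = c * stopped_sum ch stop r w f"
  by (induction r arbitrary: w) (auto simp: sum_distrib_left)

lemma stopped_sum_diff: "stopped_sum ch stop r w (\<lambda>w. f w - g w) = stopped_sum ch stop r w f - stopped_sum ch stop r w g"
  by (induction r arbitrary: w) (auto simp: sum_subtractf)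

lemma stopped_sum_sum: "finite B \<Longrightarrow> stopped_sum ch stop r w (\<lambda>w. \<Sum>b\<in>B. f b w) = (\<Sum>b\<in>B. stopped_sum ch stop r w (f b))"
proof (induction r arbitrary: w)
  case (Suc r)
  thus ?case by (simp add: sum.swap[of _ B])
qed simp

text \<open>The invariant \<open>I\<close> carries down what is known about nodes reached without
  stopping, so that \<open>f\<close> and \<open>g\<close> are compared only at leaves that
  occur.\<close>

lemma stopped_sum_mono_inv:
  assumes "I r w" and "\<And>r w w'. I (Suc r) w \<Longrightarrow> \<not> stop w \<Longrightarrow> w' \<in> ch w \<Longrightarrow> I r w'"
    and "\<And>r w. I r w \<Longrightarrow> r = 0 \<or> stop w \<Longrightarrow> f w \<le> g w"
  shows "stopped_sum ch stop r w f \<le> stopped_sum ch stop r w g"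
  using assms(1)
proof (induction r arbitrary: w)
  case 0
  thus ?case using assms(3)[of 0] by simp
next
  case (Suc r)
  show ?case using Suc assms(2)[OF Suc.prems] assms(3)[OF Suc.prems] by (auto intro!: sum_mono)
qed

lemma stopped_sum_nonneg: "(\<And>w. 0 \<le> f w) \<Longrightarrow> 0 \<le> stopped_sum ch stop r w f"
  by (induction r arbitrary: w) (auto intro!: sum_nonneg)

text \<open>Optional stopping: a quantity that is additive over children has the same total on every
  stopping partition.\<close>

lemma stopped_sum_additive:
  assumes "I r w" and "\<And>r w w'. I (Suc r) w \<Longrightarrow> \<not> stop w \<Longrightarrow> w' \<in> ch w \<Longrightarrow> I r w'"
    and "\<And>r w. I (Suc r) w \<Longrightarrow> f w = (\<Sum>w'\<in>ch w. f w')"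
  shows "stopped_sum ch stop r w f = f w"
  using assms(1)
proof (induction r arbitrary: w)
  case (Suc r)
  show ?case using Suc assms(2)[OF Suc.prems] assms(3)[OF Suc.prems] by auto
qed simp

subsection \<open>Energy of Whitney boxes\<close>

text \<open>The integral of \<open>y\<close> times the Laplacian of the square of
  \<open>e \<bullet> grad F\<close> over the Whitney box of \<open>w\<close>, as Green's formula
  produces it; hence the factor 2.\<close>

definition energy :: "('a::euclidean_space \<times> real \<Rightarrow> real) \<Rightarrow> nat \<Rightarrow> 'a \<times> real \<Rightarrow> 'a \<times> real \<Rightarrow> real" where
  "energy F N e w = integral (cbox (fst w, snd w / N) (fst w + snd w *\<^sub>R One, snd w)) (\<lambda>z. snd z * (2 * (norm (hess_apply F z e))\<^sup>2))"

text \<open>Cutting the column over \<open>w\<close> at height \<open>snd w / N\<close> leaves the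
  Whitney box on top and the columns over the children below, while the boundary term at height
  \<open>t\<close> is additive.\<close>

lemma green_functional_children:
  fixes F :: "'a::euclidean_space \<times> real \<Rightarrow> real"
  assumes F: "harmonic_on F upper_half_space" and N: "0 < N" and t: "0 < t" "t \<le> snd w / N"
  shows "green_functional F e c t w = energy F N e w + (\<Sum>w'\<in>children N w. green_functional F e c t w')"
proof -
  have w: "0 < snd w" using order.strict_trans2[OF t] by (simp add: zero_less_divide_iff)
  have C2: "C2_on F upper_half_space" using F by (simp add: harmonic_on_def)
  let ?f = "\<lambda>z. snd z * (2 * (norm (hess_apply F z e))\<^sup>2)"
  let ?K = "\<lambda>s r. cbox (fst w, s) (fst w + snd w *\<^sub>R One, r)"
  have cf: "continuous_on (?K s r) ?f" if "0 < s" for s r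
    by (intro continuous_intros continuous_on_subset[OF C2_on_continuous_hess_apply'[OF C2 open_upper_half_space]])
       (use that in \<open>auto simp: upper_half_space_iff\<close>)
  have le: "snd w / N \<le> snd w" using w N by (simp add: field_simps)
  have b: "(0, 1) \<in> (Basis :: ('a \<times> real) set)" by (simp add: Basis_prod_def)
  have s1: "?K t (snd w) \<inter> {z. z \<bullet> (0, 1) \<le> snd w / N} = ?K t (snd w / N)"
    using le by (auto simp: inner_prod_def)
  have s2: "?K t (snd w) \<inter> {z. z \<bullet> (0, 1) \<ge> snd w / N} = ?K (snd w / N) (snd w)"
    using t by (auto simp: inner_prod_def)
  have "integral (?K t (snd w)) ?f = integral (?K t (snd w / N)) ?f + energy F N e w"
    unfolding energy_def s1[symmetric] s2[symmetric]
    by (rule integral_split[OF integrable_continuous[OF cf[OF t(1)]] b])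
  also have "integral (?K t (snd w / N)) ?f = (\<Sum>w'\<in>children N w. integral (cbox (fst w', t) (fst w' + snd w' *\<^sub>R One, snd w')) ?f)"
    unfolding integral_box_children[OF w N cf[OF t(1)]] by (rule sum.cong) (auto simp: snd_children)
  finally have 1: "integral (?K t (snd w)) ?f = (\<Sum>w'\<in>children N w. integral (cbox (fst w', t) (fst w' + snd w' *\<^sub>R One, snd w')) ?f) + energy F N e w" .
  have "continuous_on (cube_of w) (\<lambda>x. flux 0 1 c t (e \<bullet> grad F (x, t)) (hess_apply F (x, t) e))"
    unfolding flux_def using t
    by (intro continuous_intros continuous_on_compose2[OF C2_on_continuous_grad[OF C2 open_upper_half_space]]
        continuous_on_compose2[OF C2_on_continuous_hess_apply'[OF C2 open_upper_half_space]])
       (auto simp: upper_half_space_iff)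
  hence "(\<lambda>x. flux 0 1 c t (e \<bullet> grad F (x, t)) (hess_apply F (x, t) e)) integrable_on cube_of w"
    unfolding cube_of_cbox by (rule integrable_continuous)
  from integral_children[OF w N this] 1 show ?thesis
    by (simp add: green_functional_def cube_of_def sum.distrib)
qed

text \<open>Telescoping \<open>green_functional_children\<close> down to the stopping partition
  leaves the energies of the boxes above it, which do not depend on \<open>c\<close> and are
  compared box by box. The bound on \<open>t\<close> keeps the common bottom below all
  leaves.\<close>

lemma green_functional_stopped_sum_le:
  fixes F :: "'a::euclidean_space \<times> real \<Rightarrow> real"
  assumes F: "harmonic_on F upper_half_space" and N: "0 < N"
    and cmp: "\<And>w. 0 < snd w \<Longrightarrow> energy F N e' w \<le> \<kappa> * energy F N e w"
    and t: "0 < t" "t \<le> snd w / N ^ r"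
  shows "green_functional F e' c' t w - stopped_sum (children N) stop r w (green_functional F e' c' t) \<le>
     \<kappa> * (green_functional F e c t w - stopped_sum (children N) stop r w (green_functional F e c t))"
  using t(2)
proof (induction r arbitrary: w)
  case (Suc r)
  show ?case
  proof (cases "stop w")
    case False
    have t': "t \<le> snd w / N / N ^ r" using Suc.prems by (simp add: mult.commute)
    have "0 < snd w / N / N ^ r" using order.strict_trans2[OF t(1) t'] .
    hence "0 < snd w / N / N ^ r * N ^ r" using N by (intro mult_pos_pos) auto
    hence sw: "0 < snd w / N" using N by simp
    hence w: "0 < snd w" by (simp add: zero_less_divide_iff)
    have "snd w / N / N ^ r \<le> snd w / N" using w N by (simp add: divide_le_eq mult_le_cancel_left1)
    hence t2: "t \<le> snd w / N" using t' by linarith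
    have D: "green_functional F e c t w - stopped_sum (children N) stop (Suc r) w (green_functional F e c t) =
      energy F N e w + (\<Sum>w'\<in>children N w. green_functional F e c t w' - stopped_sum (children N) stop r w' (green_functional F e c t))" for e c
      using False green_functional_children[OF F N t(1) t2, of e c] by (simp add: sum_subtractf)
    have "(\<Sum>w'\<in>children N w. green_functional F e' c' t w' - stopped_sum (children N) stop r w' (green_functional F e' c' t))
      \<le> (\<Sum>w'\<in>children N w. \<kappa> * (green_functional F e c t w' - stopped_sum (children N) stop r w' (green_functional F e c t)))"
      by (intro sum_mono Suc.IH) (use t' in \<open>simp add: snd_children\<close>)
    thus ?thesis unfolding D using cmp[OF w] by (simp add: sum_distrib_left[symmetric] distrib_left)
  qed simp
qed simp

text \<open>Uniform continuity on the product makes the functions \<open>\<lambda>z. f z e\<close>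
  equicontinuous, with a modulus independent of \<open>e\<close>, which the supremum
  inherits.\<close>

lemma continuous_on_SUP_compact:
  fixes f :: "'a::metric_space \<Rightarrow> 'b::metric_space \<Rightarrow> real"
  assumes K: "compact K" and S: "compact S" "S \<noteq> {}" and f: "continuous_on (K \<times> S) (\<lambda>(z, e). f z e)"
  shows "continuous_on K (\<lambda>z. SUP e\<in>S. f z e)"
    and "z \<in> K \<Longrightarrow> e \<in> S \<Longrightarrow> f z e \<le> (SUP e\<in>S. f z e)"
proof -
  have cmp: "compact (K \<times> S)" using K S by (simp add: compact_Times)
  have "compact ((\<lambda>(z, e). f z e) ` (K \<times> S))" using cmp f compact_continuous_image by blast
  then obtain B where B: "\<And>p. p \<in> K \<times> S \<Longrightarrow> norm (case p of (z, e) \<Rightarrow> f z e) \<le> B"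
    using compact_imp_bounded bounded_iff by (metis (no_types, lifting) imageI)
  have bdd: "bdd_above (f z ` S)" if "z \<in> K" for z
    using B[of "(z, e)" for e] that by (intro bdd_aboveI2[of _ _ B]) force
  show up: "f z e \<le> (SUP e\<in>S. f z e)" if "z \<in> K" "e \<in> S" for z e
    using cSUP_upper[OF that(2) bdd[OF that(1)]] .
  have uc: "uniformly_continuous_on (K \<times> S) (\<lambda>(z, e). f z e)"
    using compact_uniformly_continuous[OF f cmp] .
  show "continuous_on K (\<lambda>z. SUP e\<in>S. f z e)"
    unfolding continuous_on_iff
  proof (intro ballI allI impI)
    fix z and \<eta> :: real assume z: "z \<in> K" and \<eta>: "0 < \<eta>"
    obtain d where d: "0 < d" "\<And>p q. p \<in> K \<times> S \<Longrightarrow> q \<in> K \<times> S \<Longrightarrow> dist q p < d \<Longrightarrow>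
        dist (case q of (z, e) \<Rightarrow> f z e) (case p of (z, e) \<Rightarrow> f z e) < \<eta> / 2"
      using uc \<eta> unfolding uniformly_continuous_on_def by (metis half_gt_zero)
    have le: "(SUP e\<in>S. f y e) \<le> (SUP e\<in>S. f x e) + \<eta> / 2" if "x \<in> K" "y \<in> K" "dist x y < d" for x y
    proof (rule cSUP_least[OF S(2)])
      fix e assume e: "e \<in> S"
      have "dist (f y e) (f x e) < \<eta> / 2"
        using d(2)[of "(x, e)" "(y, e)"] that e by (auto simp: dist_prod_def dist_commute)
      thus "f y e \<le> (SUP e\<in>S. f x e) + \<eta> / 2" using up[OF that(1) e] unfolding dist_real_def by linarith
    qed
    show "\<exists>d>0. \<forall>x'\<in>K. dist x' z < d \<longrightarrow> dist (SUP e\<in>S. f x' e) (SUP e\<in>S. f z e) < \<eta>"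
      using le[OF z] le[OF _ z] d(1) \<eta> by (intro exI[of _ d]) (fastforce simp: dist_real_def dist_commute abs_less_iff)
  qed
qed

text \<open>On a Whitney box the weight \<open>y\<close> lies between \<open>l / N\<close> and
  \<open>l\<close>, so inserting it into the unweighted inequality costs a factor \<open>N\<close>;
  hence \<open>\<kappa> = N * \<gamma>\<^sup>2\<close>.\<close>

lemma weakly_quasiregular_energy:
  fixes F :: "'a::euclidean_space \<times> real \<Rightarrow> real"
  assumes F: "harmonic_on F upper_half_space" and wq: "grad_weakly_quasiregular F"
  obtains N \<kappa> where "2 \<le> N" "1 \<le> \<kappa>"
    "\<And>w e e'. 0 < snd w \<Longrightarrow> norm e = 1 \<Longrightarrow> norm e' = 1 \<Longrightarrow> energy F N e' w \<le> \<kappa> * energy F N e w"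
proof -
  obtain N \<gamma> where N: "2 \<le> N" and \<gamma>: "1 \<le> \<gamma>" and wqr: "\<And>a l. l > 0 \<Longrightarrow>
        integral (cube a l \<times> {l / real N..l})
           (\<lambda>z. SUP e\<in>sphere 0 1. (norm (hess_apply F z e))\<^sup>2)
         \<le> \<gamma>\<^sup>2 * (INF e\<in>sphere 0 1.
             integral (cube a l \<times> {l / real N..l}) (\<lambda>z. (norm (hess_apply F z e))\<^sup>2))"
    using wq unfolding grad_weakly_quasiregular_def by blast
  have C2: "C2_on F upper_half_space" using F by (simp add: harmonic_on_def)
  have "energy F N e' w \<le> (N * \<gamma>\<^sup>2) * energy F N e w" if w: "0 < snd w" and e: "norm e = 1" "norm e' = 1" for w e e'
  proof -
    define l where "l = snd w"
    define W where "W = cbox (fst w, l / N) (fst w + l *\<^sub>R One, l)"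
    have l: "0 < l" "0 < l / N" using w N by (auto simp: l_def)
    have WT: "W \<subseteq> upper_half_space" using l unfolding W_def by (auto simp: upper_half_space_iff)
    have W_eq: "cube (fst w) l \<times> {l / N..l} = W" by (simp add: W_def cbox_Pair_eq cube_def)
    have y: "l / N \<le> snd z" "snd z \<le> l" if "z \<in> W" for z
      using that unfolding W_def by (cases z; simp)+
    have cH: "continuous_on W (\<lambda>z. hess_apply F z e)" for e
      using continuous_on_subset[OF C2_on_continuous_hess_apply'[OF C2 open_upper_half_space] WT] .
    have int: "(\<lambda>z. (norm (hess_apply F z e))\<^sup>2) integrable_on W" "(\<lambda>z. snd z * (2 * (norm (hess_apply F z e))\<^sup>2)) integrable_on W" for e
      unfolding W_def by (rule integrable_continuous; unfold W_def[symmetric]; intro continuous_intros cH)+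
    have "continuous_on (W \<times> sphere 0 1) (\<lambda>(z, e). (norm (hess_apply F z e))\<^sup>2)"
      unfolding case_prod_unfold
      using continuous_on_subset[OF C2_on_continuous_hess_apply[OF C2 open_upper_half_space], of "W \<times> sphere 0 1"] WT
      by (intro continuous_intros) (auto simp: case_prod_unfold)
    note sup = continuous_on_SUP_compact[OF _ compact_sphere _ this]
    have cW: "compact W" by (simp add: W_def)
    have ne: "sphere 0 1 \<noteq> ({} :: ('a \<times> real) set)" using e by (metis dist_0_norm empty_iff mem_sphere)
    \<comment> \<open>For a non-integrable function \<open>integral\<close> would be 0 and the
      hypothesis would say nothing, so the supremum has to be shown integrable.\<close>
    have isup: "(\<lambda>z. SUP e\<in>sphere 0 1. (norm (hess_apply F z e))\<^sup>2) integrable_on W"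
      using sup(1)[OF cW ne] unfolding W_def by (rule integrable_continuous)
    have h1: "energy F N e' w \<le> 2 * l * integral W (\<lambda>z. (norm (hess_apply F z e'))\<^sup>2)"
    proof -
      have "integral W (\<lambda>z. snd z * (2 * (norm (hess_apply F z e'))\<^sup>2)) \<le> integral W (\<lambda>z. (2 * l) * (norm (hess_apply F z e'))\<^sup>2)"
      proof (rule integral_le[OF int(2) integrable_on_mult_right[OF int(1)]])
        fix z assume z: "z \<in> W"
        show "snd z * (2 * (norm (hess_apply F z e'))\<^sup>2) \<le> (2 * l) * (norm (hess_apply F z e'))\<^sup>2"
          using mult_right_mono[OF y(2)[OF z], of "2 * (norm (hess_apply F z e'))\<^sup>2"] by (simp add: mult.assoc mult.left_commute)
      qed
      thus ?thesis by (simp add: energy_def W_def l_def)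
    qed
    have h2: "integral W (\<lambda>z. (norm (hess_apply F z e'))\<^sup>2) \<le> integral W (\<lambda>z. SUP e\<in>sphere 0 1. (norm (hess_apply F z e))\<^sup>2)"
      using sup(2)[OF cW ne] e by (intro integral_le int isup) simp
    also have "\<dots> \<le> \<gamma>\<^sup>2 * (INF e\<in>sphere 0 1. integral W (\<lambda>z. (norm (hess_apply F z e))\<^sup>2))"
      using wqr[OF l(1), of "fst w"] by (simp add: W_eq)
    finally have h2: "integral W (\<lambda>z. (norm (hess_apply F z e'))\<^sup>2) \<le> \<gamma>\<^sup>2 * (INF e\<in>sphere 0 1. integral W (\<lambda>z. (norm (hess_apply F z e))\<^sup>2))" .
    have h3: "(INF e\<in>sphere 0 1. integral W (\<lambda>z. (norm (hess_apply F z e))\<^sup>2)) \<le> integral W (\<lambda>z. (norm (hess_apply F z e))\<^sup>2)"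
      using e by (intro cINF_lower bdd_belowI2[of _ 0] integral_nonneg int) auto
    have h4: "integral W (\<lambda>z. (norm (hess_apply F z e))\<^sup>2) \<le> N / (2 * l) * energy F N e w"
    proof -
      have "integral W (\<lambda>z. (2 * (l / N)) * (norm (hess_apply F z e))\<^sup>2) \<le> integral W (\<lambda>z. snd z * (2 * (norm (hess_apply F z e))\<^sup>2))"
      proof (rule integral_le[OF integrable_on_mult_right[OF int(1)] int(2)])
        fix z assume z: "z \<in> W"
        show "(2 * (l / N)) * (norm (hess_apply F z e))\<^sup>2 \<le> snd z * (2 * (norm (hess_apply F z e))\<^sup>2)"
          using mult_right_mono[OF y(1)[OF z], of "2 * (norm (hess_apply F z e))\<^sup>2"] by (simp add: mult.assoc mult.left_commute)
      qed
      hence "(2 * (l / N)) * integral W (\<lambda>z. (norm (hess_apply F z e))\<^sup>2) \<le> energy F N e w"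
        by (simp add: energy_def W_def l_def)
      thus ?thesis using l N by (simp add: field_simps)
    qed
    have "integral W (\<lambda>z. (norm (hess_apply F z e'))\<^sup>2) \<le> \<gamma>\<^sup>2 * (N / (2 * l) * energy F N e w)"
      using h2 mult_left_mono[OF order_trans[OF h3 h4], of "\<gamma>\<^sup>2"] by simp
    hence "2 * l * integral W (\<lambda>z. (norm (hess_apply F z e'))\<^sup>2) \<le> 2 * l * (\<gamma>\<^sup>2 * (N / (2 * l) * energy F N e w))"
      using l by (intro mult_left_mono) auto
    also have "\<dots> = N * \<gamma>\<^sup>2 * energy F N e w" using l by simp
    finally show ?thesis using h1 by simp
  qed
  moreover have "1 \<le> N * \<gamma>\<^sup>2"
    using mult_mono[of 1 "real N" 1 "\<gamma>\<^sup>2"] N \<gamma> by (simp add: one_le_power)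
  ultimately show ?thesis using that[OF N] by blast
qed

subsection \<open>Stopping times for the gradient\<close>

locale harmonic_energy_comparison =
  fixes F :: "'a::euclidean_space \<times> real \<Rightarrow> real" and N :: nat and \<kappa> :: real
  assumes harmonic: "harmonic_on F upper_half_space" and N2: "2 \<le> N" and \<kappa>1: "1 \<le> \<kappa>"
    and energy_le: "\<And>w e e'. 0 < snd w \<Longrightarrow> norm e = 1 \<Longrightarrow> norm e' = 1 \<Longrightarrow> energy F N e' w \<le> \<kappa> * energy F N e w"
begin

abbreviation "ch \<equiv> children N :: 'a \<times> real \<Rightarrow> ('a \<times> real) set"

text \<open>From a cube to its child the gradient moves by at most \<open>\<epsilon> * osc\<close>:
  \<open>DIM('a)\<close> for the horizontal move and \<open>ln N\<close> for the vertical
  one.\<close>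

definition "osc = DIM('a) + ln N"

lemma osc_pos: "0 < osc"
  using N2 DIM_positive[where 'a = 'a] by (simp add: osc_def add_pos_nonneg)

lemma N0: "0 < N" using N2 by simp

lemma child_corner: "w' \<in> ch w \<Longrightarrow> 0 < snd w \<Longrightarrow> fst w' \<in> cube_of w"
proof -
  assume w: "w' \<in> ch w" "0 < snd w"
  have "0 < snd w'" using snd_children[OF w(1)] w(2) N0 by simp
  hence "fst w' \<in> cube_of w'" by (simp add: mem_cube_of)
  thus ?thesis using children_subset[OF w N0] by blast
qed

lemma grad_osc:
  assumes "bloch_below F \<epsilon> (snd w)" "0 < snd w" "x \<in> cube_of w" "0 < y" "y \<le> snd w"
  shows "norm (grad F (x, y) - grad F w) \<le> \<epsilon> * (DIM('a) + ln (snd w / y))"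
  using grad_oscillation_le[OF harmonic assms(1,2), of x "fst w" y] assms(3-) by (simp add: cube_of_def)

lemma grad_osc_child:
  assumes "bloch_below F \<epsilon> (snd w)" "0 < snd w" "w' \<in> ch w"
  shows "norm (grad F w' - grad F w) \<le> \<epsilon> * osc"
proof -
  have s: "snd w' = snd w / N" by (rule snd_children[OF assms(3)])
  have "snd w' \<le> snd w" using s N0 assms(2) by (simp add: divide_le_eq mult_le_cancel_left1)
  moreover have "0 < snd w'" "snd w / snd w' = N" using s N0 assms(2) by auto
  ultimately show ?thesis
    using grad_osc[OF assms(1,2) child_corner[OF assms(3,2)], of "snd w'"] by (simp add: osc_def)
qed

definition stop :: "'a \<times> real \<Rightarrow> real \<Rightarrow> 'a \<times> real \<Rightarrow> bool" where
  "stop w0 m w \<longleftrightarrow> m \<le> norm (grad F w - grad F w0)"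

abbreviation "stopped_mass w m R \<equiv> stopped_sum ch (stop w m) R w (\<lambda>w'. if stop w m w' then cube_vol w' else 0)"
abbreviation "unstopped_mass w m R \<equiv> stopped_sum ch (stop w m) R w (\<lambda>w'. if stop w m w' then 0 else cube_vol w')"

text \<open>If half the volume has moved by \<open>M * \<epsilon>\<close>, sharing the second moment
  among \<open>DIM('a) + 1\<close> comparable directions leaves \<open>2 * c\<^sub>1\<close> times
  the square of \<open>M * \<epsilon>\<close> in each. \<open>c\<^sub>2\<close> is the constant of
  \<open>second_moment\<close>, and \<open>c\<^sub>3\<close> is twice that of
  \<open>first_moment\<close>, which is applied at the root and at the leaves.\<close>

definition "c\<^sub>1 = 1 / (4 * (DIM('a) + 1) * \<kappa>)"
definition "c\<^sub>2 = 6 * (real DIM('a) + 1)\<^sup>2"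
definition "c\<^sub>3 = 2 * (2 + 3 * real DIM('a))"

lemma c_pos: "0 < c\<^sub>1" "0 < c\<^sub>2" "0 < c\<^sub>3"
  using \<kappa>1 by (auto simp: c\<^sub>1_def c\<^sub>2_def c\<^sub>3_def intro!: mult_pos_pos add_nonneg_pos zero_less_power)

text \<open>The first bound absorbs the overshoot \<open>osc\<close> at the stopping time, the
  second makes the error of the second moment small against \<open>c\<^sub>1\<close> times the
  square of \<open>M * \<epsilon>\<close>, and the third does the same for the first moment.\<close>

definition large :: "real \<Rightarrow> bool" where
  "large M \<longleftrightarrow> osc + 2 \<le> M \<and> 4 * c\<^sub>2 \<le> c\<^sub>1 * M \<and> 8 * c\<^sub>3 \<le> c\<^sub>1 * M"

text \<open>Invariant of the nodes below \<open>w0\<close> with \<open>r\<close> of \<open>R\<close>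
  levels left. The sidelength determines \<open>r\<close>, and no node is smaller than
  \<open>snd w0 / N ^ R\<close>, the common height at which Green's formula is cut off.\<close>

definition stage :: "'a \<times> real \<Rightarrow> nat \<Rightarrow> real \<Rightarrow> nat \<Rightarrow> 'a \<times> real \<Rightarrow> bool" where
  "stage w0 R m r w \<longleftrightarrow> r \<le> R \<and> snd w = snd w0 / N ^ R * N ^ r \<and> cube_of w \<subseteq> cube_of w0 \<and> norm (grad F w - grad F w0) \<le> m"

lemma stage_snd:
  assumes "stage w0 R m r w" "0 < snd w0"
  shows "0 < snd w" "snd w \<le> snd w0" "snd w0 / N ^ R \<le> snd w / N ^ r" "snd w0 / N ^ R \<le> snd w"
proof -
  have s: "snd w = snd w0 / N ^ R * N ^ r" "r \<le> R" using assms by (auto simp: stage_def)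
  show "0 < snd w" using s N0 assms by simp
  have "real N ^ r \<le> real N ^ R" using s N0 by (intro power_increasing) auto
  thus "snd w \<le> snd w0" using s N0 assms by (simp add: divide_le_eq mult_le_cancel_left1)
  show "snd w0 / N ^ R \<le> snd w / N ^ r" using s N0 by simp
  have "1 \<le> real N ^ r" using N0 by simp
  thus "snd w0 / N ^ R \<le> snd w" using s N0 assms mult_left_mono[of 1 "real N ^ r" "snd w0 / N ^ R"] by simp
qed

lemma stage_start: "0 \<le> m \<Longrightarrow> stage w0 R m R w0"
  using N0 by (simp add: stage_def)

text \<open>A node that has not stopped has moved by less than \<open>m\<close>, and one generation
  adds at most \<open>\<epsilon> * osc\<close>.\<close>

lemma stage_step:
  assumes "bloch_below F \<epsilon> (snd w0)" "0 < snd w0" and "m + \<epsilon> * osc \<le> m'"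
    and i: "stage w0 R m' (Suc r) w" and s: "\<not> stop w0 m w" and w': "w' \<in> ch w"
  shows "stage w0 R m' r w'"
proof -
  note b = stage_snd[OF i assms(2)]
  have "norm (grad F w' - grad F w) \<le> \<epsilon> * osc"
    by (rule grad_osc_child[OF bloch_below_mono[OF assms(1) b(2)] b(1) w']) simp
  hence "norm (grad F w' - grad F w0) \<le> m'"
    using s assms(3) norm_triangle_ineq[of "grad F w' - grad F w" "grad F w - grad F w0"]
    by (simp add: stop_def)
  moreover have "cube_of w' \<subseteq> cube_of w0"
    using children_subset[OF w' b(1) N0] i by (auto simp: stage_def)
  ultimately show ?thesis using i snd_children[OF w'] N0 by (simp add: stage_def)
qed

lemma stopped_sum_cube_vol:
  assumes "0 < snd w"
  shows "stopped_sum ch st r w cube_vol = cube_vol w"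
proof (rule stopped_sum_additive[where I = "\<lambda>_ w. 0 < snd w"])
  show "cube_vol w = (\<Sum>w'\<in>ch w. cube_vol w')" if "0 < snd w" for r w by (rule cube_vol_children[OF that N0])
  show "0 < snd w'" if "0 < snd w" "w' \<in> ch w" for r w w' using that N0 by (simp add: snd_children)
qed fact

context
  fixes w0 :: "'a \<times> real" and \<epsilon> M :: real and R :: nat
  assumes w0: "0 < snd w0" and bl: "bloch_below F \<epsilon> (snd w0)" and \<epsilon>: "0 < \<epsilon>" and M: "large M"
begin

abbreviation "PS \<equiv> stopped_sum ch (stop w0 (M * \<epsilon>)) R w0"
abbreviation "X e w \<equiv> e \<bullet> (grad F w - grad F w0)"

lemma M_bounds: "osc + 2 \<le> M" "0 < M" "4 * c\<^sub>2 \<le> c\<^sub>1 * M" "8 * c\<^sub>3 \<le> c\<^sub>1 * M"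
  using M osc_pos by (auto simp: large_def)

lemma PS_mono:
  assumes "\<And>r w. stage w0 R ((M + osc) * \<epsilon>) r w \<Longrightarrow> f w \<le> g w"
  shows "PS f \<le> PS g"
proof (rule stopped_sum_mono_inv[where I = "stage w0 R ((M + osc) * \<epsilon>)"])
  show "stage w0 R ((M + osc) * \<epsilon>) R w0" using M_bounds \<epsilon> osc_pos by (intro stage_start) simp
  show "stage w0 R ((M + osc) * \<epsilon>) r w'" if "stage w0 R ((M + osc) * \<epsilon>) (Suc r) w" "\<not> stop w0 (M * \<epsilon>) w" "w' \<in> ch w" for r w w'
    by (rule stage_step[OF bl w0 _ that]) (simp add: algebra_simps)
qed (rule assms)

lemma cube_vol_pos: "stage w0 R ((M + osc) * \<epsilon>) r w \<Longrightarrow> 0 < cube_vol w"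
  using stage_snd(1)[OF _ w0] by (simp add: cube_vol_def)

lemma X_le: "norm e = 1 \<Longrightarrow> stage w0 R ((M + osc) * \<epsilon>) r w \<Longrightarrow> \<bar>X e w\<bar> \<le> ((M + osc) * \<epsilon>)"
  using Cauchy_Schwarz_ineq2[of e "grad F w - grad F w0"] by (simp add: stage_def)

text \<open>\<open>second_moment\<close> is applied to each leaf and to the root. Since
  \<open>c\<close> is the value at the root, the square vanishes there, and the energy of the boxes
  before stopping equals the second moment of the displacement at the leaves, up to the
  error.\<close>

lemma energy_identity:
  assumes e: "norm e = 1"
  defines "t \<equiv> snd w0 / N ^ R" and "c \<equiv> e \<bullet> grad F w0"
  shows "\<bar>green_functional F e c t w0 - PS (green_functional F e c t) - PS (\<lambda>w. cube_vol w * (X e w)\<^sup>2)\<bar> \<le> 2 * c\<^sub>2 * M * \<epsilon>\<^sup>2 * cube_vol w0"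
proof -
  have t: "0 < t" "t \<le> snd w0" using w0 N0 stage_snd(4)[OF stage_start w0, of 0 R] by (auto simp: t_def)
  have m0: "0 \<le> ((M + osc) * \<epsilon>)" using M_bounds \<epsilon> osc_pos by simp
  define \<delta> where "\<delta> = c\<^sub>2 * \<epsilon> * (((M + osc) * \<epsilon>) + \<epsilon>)"
  have "\<bar>green_functional F e c t (fst w0, snd w0) + snd w0 ^ DIM('a) * (e \<bullet> grad F (fst w0, snd w0) - c)\<^sup>2\<bar>
    \<le> c\<^sub>2 * \<epsilon> * (0 + \<epsilon>) * snd w0 ^ DIM('a)"
    unfolding c\<^sub>2_def by (rule second_moment[OF harmonic bl t e]) (simp add: c_def)
  hence 1: "\<bar>green_functional F e c t w0\<bar> \<le> c\<^sub>2 * \<epsilon> * \<epsilon> * cube_vol w0" by (simp add: c_def cube_vol_def)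
  have 2: "\<bar>green_functional F e c t w + cube_vol w * (X e w)\<^sup>2\<bar> \<le> \<delta> * cube_vol w" if i: "stage w0 R ((M + osc) * \<epsilon>) r w" for r w
  proof -
    note b = stage_snd[OF i w0]
    have "\<bar>green_functional F e c t (fst w, snd w) + snd w ^ DIM('a) * (e \<bullet> grad F (fst w, snd w) - c)\<^sup>2\<bar>
      \<le> c\<^sub>2 * \<epsilon> * (((M + osc) * \<epsilon>) + \<epsilon>) * snd w ^ DIM('a)"
      unfolding c\<^sub>2_def
      by (rule second_moment[OF harmonic bloch_below_mono[OF bl b(2)] t(1) _ e])
         (use b(4) X_le[OF e i] in \<open>auto simp: t_def c_def inner_diff_right\<close>)
    thus ?thesis by (simp add: cube_vol_def c_def inner_diff_right \<delta>_def)
  qed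
  have "PS (\<lambda>w. green_functional F e c t w + cube_vol w * (X e w)\<^sup>2) \<le> PS (\<lambda>w. \<delta> * cube_vol w)"
    using 2 by (intro PS_mono) force
  hence u: "PS (green_functional F e c t) + PS (\<lambda>w. cube_vol w * (X e w)\<^sup>2) \<le> \<delta> * cube_vol w0"
    by (simp add: stopped_sum_add stopped_sum_cmult stopped_sum_cube_vol[OF w0])
  have "PS (\<lambda>w. - \<delta> * cube_vol w) \<le> PS (\<lambda>w. green_functional F e c t w + cube_vol w * (X e w)\<^sup>2)"
    using 2 by (intro PS_mono) force
  hence l: "- \<delta> * cube_vol w0 \<le> PS (green_functional F e c t) + PS (\<lambda>w. cube_vol w * (X e w)\<^sup>2)"
    by (simp add: stopped_sum_add stopped_sum_cmult[of _ _ _ _ "- \<delta>", simplified] stopped_sum_cube_vol[OF w0])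
  \<comment> \<open>The leaves contribute \<open>M + osc + 1\<close> and the root 1;
    \<open>osc + 2 \<le> M\<close> bounds the sum by \<open>2 * M\<close>.\<close>
  have "\<delta> * cube_vol w0 + c\<^sub>2 * \<epsilon> * \<epsilon> * cube_vol w0 = c\<^sub>2 * (M + osc + 2) * \<epsilon>\<^sup>2 * cube_vol w0"
    by (simp add: \<delta>_def algebra_simps power2_eq_square)
  also have "\<dots> \<le> c\<^sub>2 * (2 * M) * \<epsilon>\<^sup>2 * cube_vol w0"
    using M_bounds c_pos w0 by (intro mult_right_mono mult_left_mono) (auto simp: cube_vol_def)
  finally show ?thesis using u l 1 by (simp add: algebra_simps abs_le_iff)
qed

text \<open>The integral over the slice at the common height \<open>t\<close> is additive over
  cubes, so its leaf sum is its value at the root. Exchanging slice means for corner values costs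
  \<open>c\<^sub>3 / 2\<close> at the leaves and again at the root.\<close>

lemma first_moment_PS:
  assumes e: "norm e = 1"
  shows "PS (\<lambda>w. cube_vol w * X e w) \<le> c\<^sub>3 * \<epsilon> * cube_vol w0"
proof -
  define t where "t = snd w0 / N ^ R"
  have t: "0 < t" "t \<le> snd w0" using w0 N0 stage_snd(4)[OF stage_start w0, of 0 R] by (auto simp: t_def)
  define f where "f w = integral (cube_of w) (\<lambda>x. e \<bullet> grad F (x, t))" for w
  have C2: "C2_on F upper_half_space" using harmonic by (simp add: harmonic_on_def)
  have int: "(\<lambda>x. e \<bullet> grad F (x, t)) integrable_on cube_of w" for w :: "'a \<times> real"
    unfolding cube_of_cbox using t
    by (intro integrable_continuous continuous_intros continuous_on_compose2[OF C2_on_continuous_grad[OF C2 open_upper_half_space]])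
       (auto simp: upper_half_space_iff)
  have add: "PS f = f w0"
  proof (rule stopped_sum_additive[where I = "\<lambda>_ w. 0 < snd w"])
    show "f w = (\<Sum>w'\<in>ch w. f w')" if "0 < snd w" for r w
      unfolding f_def by (rule integral_children[OF that N0 int])
    show "0 < snd w'" if "0 < snd w" "w' \<in> ch w" for r w w' using that N0 by (simp add: snd_children)
  qed fact
  have fm: "\<bar>f w - cube_vol w * (e \<bullet> grad F w)\<bar> \<le> c\<^sub>3 / 2 * \<epsilon> * cube_vol w" if "0 < snd w" "t \<le> snd w" "snd w \<le> snd w0" for w
  proof -
    have "c\<^sub>3 / 2 = real (2 + 3 * DIM('a))" by (simp add: c\<^sub>3_def)
    thus ?thesis
      using first_moment[OF harmonic bloch_below_mono[OF bl that(3) order_refl] t(1) that(2) e, of "fst w"]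
      by (simp only: f_def cube_of_def cube_vol_def prod.collapse)
  qed
  have "PS (\<lambda>w. cube_vol w * X e w) \<le> PS (\<lambda>w. (f w - (e \<bullet> grad F w0) * cube_vol w) + c\<^sub>3 / 2 * \<epsilon> * cube_vol w)"
  proof (rule PS_mono)
    fix r w assume i: "stage w0 R ((M + osc) * \<epsilon>) r w"
    have "\<bar>f w - cube_vol w * (e \<bullet> grad F w)\<bar> \<le> c\<^sub>3 / 2 * \<epsilon> * cube_vol w"
      using stage_snd[OF i w0] by (intro fm) (auto simp: t_def)
    moreover have "cube_vol w * X e w = cube_vol w * (e \<bullet> grad F w) - (e \<bullet> grad F w0) * cube_vol w"
      by (simp add: inner_diff_right algebra_simps)
    ultimately show "cube_vol w * X e w \<le> (f w - (e \<bullet> grad F w0) * cube_vol w) + c\<^sub>3 / 2 * \<epsilon> * cube_vol w"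
      by linarith
  qed
  also have "\<dots> = (f w0 - (e \<bullet> grad F w0) * cube_vol w0) + c\<^sub>3 / 2 * \<epsilon> * cube_vol w0"
    by (simp only: stopped_sum_add stopped_sum_diff stopped_sum_cmult stopped_sum_cube_vol[OF w0] add)
  also have "\<dots> \<le> c\<^sub>3 / 2 * \<epsilon> * cube_vol w0 + c\<^sub>3 / 2 * \<epsilon> * cube_vol w0"
    using fm[OF w0 t(2) order_refl] mult.commute[of "e \<bullet> grad F w0" "cube_vol w0"] by linarith
  finally show ?thesis by (simp add: mult_ac)
qed

text \<open>By weak quasiregularity the second moment of the displacement \<open>X e\<close> is comparable to the full
  second moment, hence to \<open>(M \<epsilon>)\<^sup>2\<close>, while its first moment is only \<open>O(\<epsilon>)\<close>. So \<open>X e\<close> must be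
  substantially negative on a proportion of the volume that does not depend on \<open>M\<close>.\<close>

lemma descent:
  assumes e: "norm e = 1" and st: "cube_vol w0 / 2 \<le> PS (\<lambda>w. if stop w0 (M * \<epsilon>) w then cube_vol w else 0)"
  shows "c\<^sub>1 / 16 * cube_vol w0 \<le> PS (\<lambda>w. if X e w \<le> - (c\<^sub>1 / 16 * M * \<epsilon>) then cube_vol w else 0)"
proof -
  define V where "V = cube_vol w0"
  have V: "0 < V" using w0 by (simp add: V_def cube_vol_def)
  define P where "P e = PS (\<lambda>w. cube_vol w * (X e w)\<^sup>2)" for e
  define t where "t = snd w0 / N ^ R"
  have t: "0 < t" using w0 N0 by (simp add: t_def)
  define \<Phi> where "\<Phi> e = green_functional F e (e \<bullet> grad F w0) t w0 - PS (green_functional F e (e \<bullet> grad F w0) t)" for e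
  define D where "D = real DIM('a) + 1"
  have D: "1 \<le> D" by (simp add: D_def)
  define \<delta> where "\<delta> = 2 * c\<^sub>2 * M * \<epsilon>\<^sup>2 * V"
  have \<delta>: "0 \<le> \<delta>" using c_pos M_bounds V by (simp add: \<delta>_def)
  have en: "\<bar>\<Phi> e - P e\<bar> \<le> \<delta>" if "norm e = 1" for e
    using energy_identity[OF that] by (simp add: \<Phi>_def P_def \<delta>_def t_def V_def)
  have cmp: "\<Phi> b \<le> \<kappa> * \<Phi> e" if "norm b = 1" for b
    unfolding \<Phi>_def by (rule green_functional_stopped_sum_le[OF harmonic N0 energy_le[OF _ e that] t]) (simp_all add: t_def)
  \<comment> \<open>Moments are passed to energies and back, at a cost of \<open>\<delta>\<close>
    each time; weak quasiregularity is used between the energies.\<close>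
  have Pb: "P b \<le> \<kappa> * (P e + 2 * \<delta>)" if "b \<in> Basis" for b
  proof -
    have b: "norm b = 1" using that by simp
    have "P b \<le> \<Phi> b + \<delta>" using en[OF b] by linarith
    also have "\<dots> \<le> \<kappa> * \<Phi> e + \<delta>" using cmp[OF b] by simp
    also have "\<dots> \<le> \<kappa> * (P e + \<delta>) + \<kappa> * \<delta>"
      using en[OF e] \<kappa>1 \<delta> mult_right_mono[of 1 \<kappa> \<delta>] by (intro add_mono mult_left_mono) auto
    finally show ?thesis by (simp add: algebra_simps)
  qed
  \<comment> \<open>The squared displacement is the sum of its squares along basis vectors and is at
    least the square of \<open>M * \<epsilon>\<close> on stopped leaves, which fill half the
    volume.\<close>
  have "(M * \<epsilon>)\<^sup>2 * (V / 2) \<le> (M * \<epsilon>)\<^sup>2 * PS (\<lambda>w. if stop w0 (M * \<epsilon>) w then cube_vol w else 0)"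
    using st by (intro mult_left_mono) (auto simp: V_def)
  also have "\<dots> = PS (\<lambda>w. (M * \<epsilon>)\<^sup>2 * (if stop w0 (M * \<epsilon>) w then cube_vol w else 0))"
    by (rule stopped_sum_cmult[symmetric])
  also have "\<dots> \<le> PS (\<lambda>w. \<Sum>b\<in>Basis. cube_vol w * (X b w)\<^sup>2)"
  proof (rule PS_mono)
    fix r w assume i: "stage w0 R ((M + osc) * \<epsilon>) r w"
    have "(\<Sum>b\<in>Basis. (X b w)\<^sup>2) = (\<Sum>b\<in>Basis. ((grad F w - grad F w0) \<bullet> b) * ((grad F w - grad F w0) \<bullet> b))"
      by (intro sum.cong refl) (simp only: power2_eq_square inner_commute)
    also have "\<dots> = (norm (grad F w - grad F w0))\<^sup>2"
      by (simp only: power2_norm_eq_inner euclidean_inner[of "grad F w - grad F w0" "grad F w - grad F w0"])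
    finally have "(\<Sum>b\<in>Basis. (X b w)\<^sup>2) = (norm (grad F w - grad F w0))\<^sup>2" .
    hence eq: "(\<Sum>b\<in>Basis. cube_vol w * (X b w)\<^sup>2) = (norm (grad F w - grad F w0))\<^sup>2 * cube_vol w"
      by (simp add: sum_distrib_left[symmetric])
    show "(M * \<epsilon>)\<^sup>2 * (if stop w0 (M * \<epsilon>) w then cube_vol w else 0) \<le> (\<Sum>b\<in>Basis. cube_vol w * (X b w)\<^sup>2)"
    proof (cases "stop w0 (M * \<epsilon>) w")
      case True
      hence "(M * \<epsilon>)\<^sup>2 \<le> (norm (grad F w - grad F w0))\<^sup>2"
        using M_bounds \<epsilon> by (intro power_mono) (auto simp: stop_def)
      thus ?thesis unfolding eq using True cube_vol_pos[OF i] by (simp add: mult_right_mono)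
    next
      case False
      thus ?thesis unfolding eq using cube_vol_pos[OF i] by simp
    qed
  qed
  also have "\<dots> = (\<Sum>b\<in>Basis. P b)" by (simp add: stopped_sum_sum P_def)
  also have "\<dots> \<le> (\<Sum>b\<in>(Basis::('a \<times> real) set). \<kappa> * (P e + 2 * \<delta>))" by (intro sum_mono Pb)
  also have "\<dots> = D * \<kappa> * (P e + 2 * \<delta>)" by (simp add: D_def)
  finally have "(M * \<epsilon>)\<^sup>2 * (V / 2) / (D * \<kappa>) \<le> P e + 2 * \<delta>"
    using D \<kappa>1 by (simp add: pos_divide_le_eq mult.commute)
  moreover have "c\<^sub>1 = 1 / (4 * D * \<kappa>)" by (simp add: c\<^sub>1_def D_def)
  ultimately have "2 * c\<^sub>1 * ((M * \<epsilon>)\<^sup>2 * V) \<le> P e + 2 * \<delta>"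
    by simp
  moreover have "2 * \<delta> \<le> c\<^sub>1 * ((M * \<epsilon>)\<^sup>2 * V)"
  proof -
    have "2 * \<delta> = (4 * c\<^sub>2) * (M * \<epsilon>\<^sup>2 * V)" by (simp add: \<delta>_def)
    also have "\<dots> \<le> (c\<^sub>1 * M) * (M * \<epsilon>\<^sup>2 * V)" using M_bounds V by (intro mult_right_mono) auto
    finally show ?thesis by (simp add: power2_eq_square algebra_simps)
  qed
  ultimately have Pe: "c\<^sub>1 * ((M * \<epsilon>)\<^sup>2 * V) \<le> P e" by linarith
  define \<theta> where "\<theta> = c\<^sub>1 / 16 * M * \<epsilon>"
  have \<theta>: "0 < \<theta>" using c_pos M_bounds \<epsilon> by (simp add: \<theta>_def)
  define m where "m = PS (\<lambda>w. if X e w \<le> - \<theta> then cube_vol w else 0)"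
  have "P e \<le> PS (\<lambda>w. 2 * (M * \<epsilon>) * ((cube_vol w * X e w + 2 * \<theta> * cube_vol w) + 4 * (M * \<epsilon>) * (if X e w \<le> - \<theta> then cube_vol w else 0)))"
    unfolding P_def
  proof (rule PS_mono)
    fix r w assume i: "stage w0 R ((M + osc) * \<epsilon>) r w"
    define x where "x = X e w"
    define K where "K = 2 * (M * \<epsilon>)"
    have K: "0 < K" using M_bounds \<epsilon> by (simp add: K_def)
    have "((M + osc) * \<epsilon>) \<le> K" using M_bounds \<epsilon> osc_pos mult_right_mono[of "M + osc" "2 * M" \<epsilon>] by (simp add: K_def)
    hence xK: "\<bar>x\<bar> \<le> K" using X_le[OF e i] by (simp add: x_def)
    have "x\<^sup>2 = \<bar>x\<bar> * \<bar>x\<bar>" by (simp add: power2_eq_square)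
    also have "\<dots> \<le> K * \<bar>x\<bar>" using xK by (intro mult_right_mono) auto
    \<comment> \<open>For \<open>x\<close> above \<open>- \<theta>\<close> the absolute value is at
      most \<open>x + 2 * \<theta>\<close>; otherwise the term \<open>2 * K\<close> compensates. So
      \<open>P e\<close> is bounded by the first moment, by \<open>\<theta>\<close> and by the
      volume \<open>m\<close> on which \<open>X e\<close> is at most
      \<open>- \<theta>\<close>.\<close>
    also have "K * \<bar>x\<bar> \<le> K * (x + 2 * \<theta> + 2 * K * (if x \<le> - \<theta> then 1 else 0))"
      using xK \<theta> K by (intro mult_left_mono) auto
    finally have "cube_vol w * x\<^sup>2 \<le> cube_vol w * (K * (x + 2 * \<theta> + 2 * K * (if x \<le> - \<theta> then 1 else 0)))"
      using cube_vol_pos[OF i] by (intro mult_left_mono) auto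
    also have "\<dots> = K * ((cube_vol w * x + 2 * \<theta> * cube_vol w) + 2 * K * (if x \<le> - \<theta> then cube_vol w else 0))"
      by (simp add: algebra_simps)
    finally show "cube_vol w * (X e w)\<^sup>2 \<le> 2 * (M * \<epsilon>) * ((cube_vol w * X e w + 2 * \<theta> * cube_vol w) + 4 * (M * \<epsilon>) * (if X e w \<le> - \<theta> then cube_vol w else 0))"
      by (simp add: x_def K_def)
  qed
  also have "\<dots> = 2 * (M * \<epsilon>) * ((PS (\<lambda>w. cube_vol w * X e w) + 2 * \<theta> * V) + 4 * (M * \<epsilon>) * m)"
    by (simp only: stopped_sum_cmult stopped_sum_add stopped_sum_cube_vol[OF w0] m_def V_def)
  also have "\<dots> \<le> 2 * (M * \<epsilon>) * ((c\<^sub>3 * \<epsilon> * V + 2 * \<theta> * V) + 4 * (M * \<epsilon>) * m)"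
    using first_moment_PS[OF e] M_bounds \<epsilon> by (intro mult_left_mono add_right_mono) (auto simp: V_def)
  also have "\<dots> = (M * \<epsilon>\<^sup>2 * V) * (2 * c\<^sub>3) + c\<^sub>1 / 4 * ((M * \<epsilon>)\<^sup>2 * V) + 8 * (M * \<epsilon>)\<^sup>2 * m"
    by (simp add: \<theta>_def power2_eq_square algebra_simps)
  also have "(M * \<epsilon>\<^sup>2 * V) * (2 * c\<^sub>3) \<le> (M * \<epsilon>\<^sup>2 * V) * (c\<^sub>1 * M / 4)"
    using M_bounds V by (intro mult_left_mono) auto
  \<comment> \<open>The first moment and \<open>\<theta>\<close> contribute
    \<open>c\<^sub>1 / 4\<close> each. As \<open>P e\<close> has at least the factor
    \<open>c\<^sub>1\<close>, half of it is left for \<open>8 * m\<close>, which gives the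
    proportion \<open>c\<^sub>1 / 16\<close>.\<close>
  finally have "P e \<le> c\<^sub>1 / 2 * ((M * \<epsilon>)\<^sup>2 * V) + 8 * (M * \<epsilon>)\<^sup>2 * m"
    by (simp add: power2_eq_square algebra_simps)
  hence "(M * \<epsilon>)\<^sup>2 * (c\<^sub>1 / 2 * V) \<le> (M * \<epsilon>)\<^sup>2 * (8 * m)" using Pe by (simp add: algebra_simps)
  hence "c\<^sub>1 / 2 * V \<le> 8 * m" using M_bounds \<epsilon> by simp
  thus ?thesis by (simp add: m_def V_def \<theta>_def)
qed

end

end

subsection \<open>Descending chains and Hausdorff measure\<close>

text \<open>If \<open>T\<close> were at least the mass on every child, summation would give it on
  the parent; so \<open>T < \<alpha>\<close> passes to some child. The state \<open>\<sigma>\<close>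
  is the memory of the construction. Only children of positive mass need the invariant, as
  \<open>T < \<alpha>\<close> forces positivity.\<close>

lemma descending_chain:
  fixes \<alpha> :: "'w \<Rightarrow> 's \<Rightarrow> real" and T :: "'w \<Rightarrow> ennreal"
  assumes step: "\<And>w \<sigma>. Inv w \<sigma> \<Longrightarrow> 0 < \<alpha> w \<sigma> \<Longrightarrow> \<exists>\<tau>. \<alpha> w \<sigma> \<le> (\<Sum>w'\<in>ch w. \<alpha> w' (\<tau> w')) \<and>
      (\<forall>w'\<in>ch w. 0 < \<alpha> w' (\<tau> w') \<longrightarrow> Inv w' (\<tau> w') \<and> Tr w \<sigma> w' (\<tau> w'))"
    and nonneg: "\<And>w \<sigma>. 0 \<le> \<alpha> w \<sigma>" and T: "\<And>w \<sigma>. Inv w \<sigma> \<Longrightarrow> (\<Sum>w'\<in>ch w. T w') \<le> T w"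
    and start: "Inv w0 \<sigma>0" "T w0 < ennreal (\<alpha> w0 \<sigma>0)"
  obtains W S where "W 0 = w0" "S 0 = \<sigma>0" "\<And>j. W (Suc j) \<in> ch (W j)" "\<And>j. Inv (W j) (S j)"
    "\<And>j. Tr (W j) (S j) (W (Suc j)) (S (Suc j))" "\<And>j. T (W j) < ennreal (\<alpha> (W j) (S j))"
proof -
  let ?P = "\<lambda>(w, \<sigma>). Inv w \<sigma> \<and> T w < ennreal (\<alpha> w \<sigma>)"
  let ?Q = "\<lambda>(w, \<sigma>) (w', \<sigma>'). w' \<in> ch w \<and> Tr w \<sigma> w' \<sigma>'"
  have ex: "\<exists>q. ?P q \<and> ?Q p q" if p: "?P p" for p
  proof -
    obtain w \<sigma> where p_def: "p = (w, \<sigma>)" by fastforce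
    have P: "Inv w \<sigma>" "T w < ennreal (\<alpha> w \<sigma>)" using p p_def by auto
    hence "0 < \<alpha> w \<sigma>" by (metis ennreal_neg leI not_less_zero)
    then obtain \<tau> where \<tau>: "\<alpha> w \<sigma> \<le> (\<Sum>w'\<in>ch w. \<alpha> w' (\<tau> w'))"
      "\<And>w'. w' \<in> ch w \<Longrightarrow> 0 < \<alpha> w' (\<tau> w') \<Longrightarrow> Inv w' (\<tau> w') \<and> Tr w \<sigma> w' (\<tau> w')"
      using step[OF P(1)] by blast
    have "\<exists>w'\<in>ch w. T w' < ennreal (\<alpha> w' (\<tau> w'))"
    proof (rule ccontr)
      assume "\<not> ?thesis"
      hence "(\<Sum>w'\<in>ch w. ennreal (\<alpha> w' (\<tau> w'))) \<le> (\<Sum>w'\<in>ch w. T w')" by (intro sum_mono) (auto simp: not_less)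
      also have "\<dots> \<le> T w" by (rule T[OF P(1)])
      also have "\<dots> < ennreal (\<alpha> w \<sigma>)" by (rule P)
      also have "\<dots> \<le> ennreal (\<Sum>w'\<in>ch w. \<alpha> w' (\<tau> w'))" using \<tau>(1) by (rule ennreal_leI)
      also have "\<dots> = (\<Sum>w'\<in>ch w. ennreal (\<alpha> w' (\<tau> w')))" by (intro sum_ennreal[symmetric] nonneg)
      finally show False by simp
    qed
    then obtain w' where w': "w' \<in> ch w" "T w' < ennreal (\<alpha> w' (\<tau> w'))" by blast
    hence "0 < \<alpha> w' (\<tau> w')" by (metis ennreal_neg leI not_less_zero)
    hence "?P (w', \<tau> w') \<and> ?Q p (w', \<tau> w')" using \<tau>(2)[OF w'(1)] w' p_def by auto
    thus ?thesis by blast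
  qed
  define f where "f = rec_nat (w0, \<sigma>0) (\<lambda>_ p. SOME q. ?P q \<and> ?Q p q)"
  have f0: "f 0 = (w0, \<sigma>0)" by (simp add: f_def)
  have fS: "f (Suc j) = (SOME q. ?P q \<and> ?Q (f j) q)" for j by (simp add: f_def)
  have fP: "?P (f j)" for j
  proof (induction j)
    case 0
    show ?case using start by (simp add: f0)
  next
    case (Suc j)
    show ?case using someI_ex[OF ex[OF Suc]] unfolding fS by (rule conjunct1)
  qed
  have fQ: "?Q (f j) (f (Suc j))" for j
    using someI_ex[OF ex[OF fP[of j]]] unfolding fS by (rule conjunct2)
  show ?thesis
  proof (rule that[of "\<lambda>j. fst (f j)" "\<lambda>j. snd (f j)"])
    show "fst (f (Suc j)) \<in> ch (fst (f j))" for j using fQ[of j] by (simp add: case_prod_unfold)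
    show "Inv (fst (f j)) (snd (f j))" for j using fP[of j] by (simp add: case_prod_unfold)
    show "Tr (fst (f j)) (snd (f j)) (fst (f (Suc j))) (snd (f (Suc j)))" for j using fQ[of j] by (simp add: case_prod_unfold)
    show "T (fst (f j)) < ennreal (\<alpha> (fst (f j)) (snd (f j)))" for j using fP[of j] by (simp add: case_prod_unfold)
  qed (simp_all add: f0)
qed

text \<open>In each coordinate the index of a touching cube lies between \<open>q i - 2\<close> and
  \<open>q i + 1\<close>, because neither the mesh nor the diameter exceeds \<open>h\<close>; this
  leaves at most four integers.\<close>

lemma card_touching_le:
  fixes w :: "'a::euclidean_space \<times> real"
  assumes w: "0 < snd w" "0 < K" and U: "bounded U" "diameter U \<le> snd w / K"
  shows "card {c \<in> children K w. cube_of c \<inter> U \<noteq> {}} \<le> 4 ^ DIM('a)"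
proof (cases "U = {}")
  case False
  then obtain x0 where x0: "x0 \<in> U" by blast
  define h where "h = snd w / K"
  have h: "0 < h" using w by (simp add: h_def)
  define q where "q i = (x0 \<bullet> i - fst w \<bullet> i) / h" for i
  define S where "S i = real_of_int ` {\<lceil>q i\<rceil> - 2..\<lfloor>q i\<rfloor> + 1}" for i
  have fS: "finite (S i)" for i by (simp add: S_def)
  have cS: "card (S i) \<le> 4" for i
  proof -
    have "card (S i) \<le> card {\<lceil>q i\<rceil> - 2..\<lfloor>q i\<rfloor> + 1}" unfolding S_def by (rule card_image_le) simp
    also have "\<dots> \<le> 4" using floor_le_ceiling[of "q i"] by simp linarith
    finally show ?thesis .
  qed
  let ?D = "{d::'a. \<forall>i\<in>Basis. d \<bullet> i \<in> S i}"
  have "{c \<in> children K w. cube_of c \<inter> U \<noteq> {}} \<subseteq> (\<lambda>d. (fst w + h *\<^sub>R d, h)) ` ?D"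
  proof
    fix c assume "c \<in> {c \<in> children K w. cube_of c \<inter> U \<noteq> {}}"
    then obtain d x where d: "d \<in> digits K" "c = (fst w + h *\<^sub>R d, h)" and x: "x \<in> cube_of c" "x \<in> U"
      by (auto simp: children_def h_def)
    have "d \<bullet> i \<in> S i" if i: "i \<in> Basis" for i
    proof -
      obtain k where k: "d \<bullet> i = real k" using d i by (auto simp: digits_def)
      have "\<bar>(x - x0) \<bullet> i\<bar> \<le> norm (x - x0)" by (rule Basis_le_norm[OF i])
      also have "\<dots> \<le> h" using diameter_bounded_bound[OF U(1) x(2) x0] U(2) by (simp add: dist_norm h_def)
      finally have 1: "\<bar>x \<bullet> i - x0 \<bullet> i\<bar> \<le> h" by (simp add: inner_diff_left)
      have 2: "fst w \<bullet> i + h * k \<le> x \<bullet> i" "x \<bullet> i \<le> fst w \<bullet> i + h * k + h"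
        using x(1) i unfolding mem_cube_of by (auto simp: d(2) k inner_simps)
      have "x0 \<bullet> i = fst w \<bullet> i + h * q i" using h by (simp add: q_def)
      hence "h * real k \<le> h * (q i + 1)" "h * q i \<le> h * (real k + 2)"
        using 1 2 by (auto simp: algebra_simps)
      hence "real k \<le> q i + 1" "q i \<le> real k + 2" using h by auto
      hence "\<lceil>q i\<rceil> - 2 \<le> int k" "int k \<le> \<lfloor>q i\<rfloor> + 1" by linarith+
      hence "real_of_int (int k) \<in> S i" unfolding S_def by (intro imageI) simp
      thus ?thesis by (simp add: k)
    qed
    thus "c \<in> (\<lambda>d. (fst w + h *\<^sub>R d, h)) ` ?D" using d(2) by blast
  qed
  hence "card {c \<in> children K w. cube_of c \<inter> U \<noteq> {}} \<le> card ((\<lambda>d. (fst w + h *\<^sub>R d, h)) ` ?D)"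
    using finite_coordinate_product[of S] fS by (intro card_mono) auto
  also have "\<dots> \<le> card ?D" using finite_coordinate_product[of S] fS by (intro card_image_le) auto
  also have "\<dots> \<le> (\<Prod>i\<in>(Basis::'a set). card (S i))" by (rule card_coordinate_product_le) (rule fS)
  also have "\<dots> \<le> (\<Prod>i\<in>(Basis::'a set). 4)" by (rule prod_mono) (use cS in auto)
  finally show ?thesis by simp
qed simp

lemma children_children:
  assumes "w1 \<in> children K w" "w2 \<in> children N w1" "0 < K" "0 < N"
  shows "w2 \<in> children (K * N) w"
proof -
  obtain d where d: "d \<in> digits K" "w1 = (fst w + (snd w / K) *\<^sub>R d, snd w / K)"
    using assms by (auto simp: children_def)
  obtain d' where d': "d' \<in> digits N" "w2 = (fst w1 + (snd w1 / N) *\<^sub>R d', snd w1 / N)"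
    using assms by (auto simp: children_def)
  have "real N *\<^sub>R d + d' \<in> digits (K * N)"
    unfolding digits_def
  proof (safe)
    fix i :: 'a assume i: "i \<in> Basis"
    obtain k k' where k: "d \<bullet> i = real k" "k < K" "d' \<bullet> i = real k'" "k' < N"
      using d(1) d'(1) i by (fastforce simp: digits_def)
    have "N * k + k' < N * (k + 1)" using k by simp
    also have "\<dots> \<le> K * N" using k by (metis Suc_eq_plus1 Suc_leI mult.commute mult_le_mono2)
    finally have "N * k + k' < K * N" .
    moreover have "(real N *\<^sub>R d + d') \<bullet> i = real (N * k + k')" using k by (simp add: inner_simps)
    ultimately show "(real N *\<^sub>R d + d') \<bullet> i \<in> real ` {..<K * N}" by (metis imageI lessThan_iff)
  qed
  moreover have "w2 = (fst w + (snd w / (K * N)) *\<^sub>R (real N *\<^sub>R d + d'), snd w / (K * N))"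
    using assms(3,4) by (simp add: d(2) d'(2) algebra_simps)
  ultimately show ?thesis unfolding children_def by force
qed

lemma chain_in_children:
  assumes "W 0 = w" "\<And>j. W (Suc j) \<in> children N (W j)" "0 < N"
  shows "W j \<in> children (N ^ j) w"
proof (induction j)
  case 0
  have "w = (fst w + (snd w / 1) *\<^sub>R 0, snd w / 1)" by simp
  moreover have "0 \<in> digits 1" by (auto simp: digits_def)
  ultimately show ?case unfolding children_def using assms(1) by force
next
  case (Suc j)
  show ?case using children_children[OF Suc assms(2)] assms(3) by (simp add: mult.commute)
qed

lemma chain_common_point:
  fixes W :: "nat \<Rightarrow> 'a::euclidean_space \<times> real"
  assumes "0 < snd (W 0)" "\<And>j. W (Suc j) \<in> children N (W j)" "0 < N"
  obtains x where "\<And>j. x \<in> cube_of (W j)"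
proof -
  have pos: "0 < snd (W j)" for j
    by (induction j) (use assms snd_children[OF assms(2)] in auto)
  have "cube_of (W j) \<subseteq> cube_of (W i)" if "i \<le> j" for i j
    using that by (induction rule: dec_induct) (use children_subset[OF assms(2) pos assms(3)] in auto)
  moreover have "compact (cube_of (W j))" for j by (simp add: cube_of_cbox)
  moreover have "cube_of (W j) \<noteq> {}" for j using interior_cube_of_nonempty[OF pos[of j]] interior_subset by blast
  ultimately have "\<Inter>(range (\<lambda>j. cube_of (W j))) \<noteq> {}"
    by (intro compact_nest)
  thus ?thesis using that by blast
qed

lemma exists_power_scale_less:
  fixes c \<delta> :: real
  assumes "2 \<le> N" "0 < \<delta>"
  shows "\<exists>k. c / real (N ^ k) < \<delta>"
proof -
  have "(\<lambda>k. c * inverse (real N) ^ k) \<longlonglongrightarrow> c * 0"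
    using assms by (intro tendsto_mult_left LIMSEQ_power_zero) (auto simp: field_simps)
  hence "\<forall>\<^sub>F k in sequentially. c * inverse (real N) ^ k < \<delta>" using assms by (intro order_tendstoD) auto
  then obtain k where "c * inverse (real N) ^ k < \<delta>" unfolding eventually_sequentially by blast
  thus ?thesis by (intro exI[of _ k]) (simp add: divide_inverse power_inverse)
qed

text \<open>A mass distribution principle without a measure. If the measure were 0, take an
  efficient cover and replace each cover set by the cubes of a comparable generation that meet it.
  The cost \<open>T w\<close> is the sum of the \<open>s\<close>-th powers of the sides of those
  cubes contained in \<open>w\<close>. The chain obtained for \<open>T\<close> has cost below
  \<open>snd (W j) powr s\<close>, although its limit point is covered.\<close>

lemma hausdorff_measure_nonzero:
  fixes w0 :: "'a::euclidean_space \<times> real" and A :: "'a set"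
  assumes w0: "0 < snd w0" and N: "2 \<le> N" and s: "0 < s" and B: "0 < B"
    and chain: "\<And>T :: 'a \<times> real \<Rightarrow> ennreal. (\<And>w. 0 < snd w \<Longrightarrow> (\<Sum>w'\<in>children N w. T w') \<le> T w) \<Longrightarrow> T w0 < ennreal B \<Longrightarrow>
      \<exists>W. W 0 = w0 \<and> (\<forall>j. W (Suc j) \<in> children N (W j) \<and> T (W j) < ennreal (snd (W j) powr s)) \<and>
        (\<forall>x. (\<forall>j. x \<in> cube_of (W j)) \<longrightarrow> x \<in> A)"
  shows "hausdorff_measure s (A \<inter> cube_of w0) \<noteq> 0"
proof
  define n where "n = DIM('a)"
  define L where "L = snd w0"
  assume "hausdorff_measure s (A \<inter> cube_of w0) = 0"
  moreover have "hausdorff_premeasure s 1 (A \<inter> cube_of w0) \<le> hausdorff_measure s (A \<inter> cube_of w0)"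
    unfolding hausdorff_measure_def by (rule SUP_upper) simp
  ultimately have pm: "hausdorff_premeasure s 1 (A \<inter> cube_of w0) = 0" by simp
  define C where "C = 4 ^ n * real N powr s"
  have C: "0 < C" using N by (simp add: C_def)
  \<comment> \<open>The first bound forces \<open>r i \<le> L\<close>, so that a generation of
    comparable size exists below \<open>w0\<close>; the second makes the total cost smaller than
    \<open>B\<close>.\<close>
  define \<eta> where "\<eta> = min (L powr s / 2) (B / (4 * C))"
  have \<eta>: "0 < \<eta>" "\<eta> \<le> L powr s / 2" "C * (2 * \<eta>) < B"
    using w0 B C by (auto simp: \<eta>_def L_def min_def field_simps)
  have "hausdorff_premeasure s 1 (A \<inter> cube_of w0) < ennreal \<eta>" using pm \<eta> by simp
  then obtain U :: "nat \<Rightarrow> 'a set" where U: "A \<inter> cube_of w0 \<subseteq> (\<Union>i. U i)" "\<And>i. bounded (U i)"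
    "(\<Sum>i. ennreal (diameter (U i) powr s)) < ennreal \<eta>"
    unfolding hausdorff_premeasure_def INF_less_iff by auto
  define d where "d i = diameter (U i)" for i
  have d0: "0 \<le> d i" for i unfolding d_def by (rule diameter_ge_0[OF U(2)])
  have dsum: "summable (\<lambda>i. d i powr s)" "(\<Sum>i. d i powr s) < \<eta>"
  proof -
    have "(\<Sum>i. ennreal (d i powr s)) \<noteq> top" using U(3) by (auto simp: d_def)
    thus sm: "summable (\<lambda>i. d i powr s)" by (rule summable_suminf_not_top[rotated]) simp
    have "(\<Sum>i. ennreal (d i powr s)) = ennreal (\<Sum>i. d i powr s)" by (rule suminf_ennreal2[OF _ sm]) simp
    hence "ennreal (\<Sum>i. d i powr s) < ennreal \<eta>" using U(3) by (simp add: d_def)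
    thus "(\<Sum>i. d i powr s) < \<eta>" by (metis ennreal_leI leD leI)
  qed
  \<comment> \<open>A diameter may be 0, while a comparable generation needs a positive length. The
    geometric series adds only \<open>\<eta>\<close> to the sum of the \<open>s\<close>-th
    powers.\<close>
  define r where "r i = (d i powr s + \<eta> * (1 / 2) ^ Suc i) powr (1 / s)" for i
  have rs: "r i powr s = d i powr s + \<eta> * (1 / 2) ^ Suc i" for i
    using s \<eta> by (simp add: r_def powr_powr add_nonneg_nonneg)
  have r0: "0 < r i" for i
  proof -
    have "0 < d i powr s + \<eta> * (1 / 2) ^ Suc i" using \<eta> by (intro add_nonneg_pos) auto
    thus ?thesis by (simp add: r_def)
  qed
  have dr: "d i \<le> r i" for i
  proof (rule ccontr)
    assume "\<not> d i \<le> r i"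
    hence "r i powr s < d i powr s" using r0[of i] s by (intro powr_less_mono2) auto
    moreover have "0 < \<eta> * (1 / 2) ^ Suc i" using \<eta> by (intro mult_pos_pos) auto
    ultimately show False using rs[of i] by linarith
  qed
  have geo: "(\<lambda>i. \<eta> * (1 / 2) ^ Suc i) sums \<eta>" using sums_mult[OF power_half_series, of \<eta>] by simp
  have rsm: "summable (\<lambda>i. r i powr s)" unfolding rs using dsum(1) geo by (intro summable_add) (auto simp: sums_iff)
  have rsum: "(\<Sum>i. r i powr s) \<le> 2 * \<eta>"
    unfolding rs using dsum geo by (subst suminf_add[symmetric]) (auto simp: sums_iff)
  have rL: "r i \<le> L" for i
  proof (rule ccontr)
    assume "\<not> r i \<le> L"
    hence "L powr s < r i powr s" using s w0 by (intro powr_less_mono2) (auto simp: L_def)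
    moreover have "r i powr s \<le> (\<Sum>i. r i powr s)" using sum_le_suminf[OF rsm, of "{i}"] by simp
    ultimately show False using rsum \<eta>(2) by linarith
  qed
  \<comment> \<open>A generation coarse enough for \<open>U i\<close> to meet boundedly many of its
    cubes, and fine enough for their sides to be at most \<open>N * r i\<close>.\<close>
  have "\<exists>k. r i \<le> L / N ^ k \<and> L / N ^ k \<le> N * r i" for i
  proof -
    obtain k0 where k0: "L / N ^ k0 < r i" using exists_power_scale_less[OF N r0] by blast
    define k where "k = (LEAST k. L / N ^ k < r i)"
    have k: "L / N ^ k < r i" unfolding k_def by (rule LeastI[of _ k0]) (rule k0)
    have "k \<noteq> 0"
    proof
      assume "k = 0"
      thus False using k rL[of i] by simp
    qed
    then obtain j where j: "k = Suc j" using not0_implies_Suc by blast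
    have "\<not> L / N ^ j < r i" using not_less_Least[of j "\<lambda>k. L / N ^ k < r i"] j k_def by simp
    moreover have "L / N ^ j \<le> N * r i" using k N unfolding j by (simp add: field_simps)
    ultimately show ?thesis by (intro exI[of _ j]) simp
  qed
  then obtain k where k: "\<And>i. r i \<le> L / N ^ k i" "\<And>i. L / N ^ k i \<le> N * r i" by metis
  define \<C> where "\<C> i = {c \<in> children (N ^ k i) w0. cube_of c \<inter> U i \<noteq> {}}" for i
  have fin: "finite (\<C> i)" for i unfolding \<C>_def
    by (rule finite_subset[OF _ finite_children[of "N ^ k i" w0]]) auto
  have card: "card (\<C> i) \<le> 4 ^ n" for i
    unfolding \<C>_def n_def using w0 N U(2) dr[of i] k(1)[of i] by (intro card_touching_le) (auto simp: d_def L_def)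
  have csnd: "snd c = L / N ^ k i" if "c \<in> \<C> i" for c i using that snd_children by (fastforce simp: \<C>_def L_def)
  define T where "T w = (\<Sum>i. \<Sum>c | c \<in> \<C> i \<and> cube_of c \<subseteq> cube_of w. ennreal (snd c powr s))" for w :: "'a \<times> real"
  \<comment> \<open>A cube charged to \<open>U i\<close> lies in at most one child, since its
    interior points would be interior to both.\<close>
  have Tsub: "(\<Sum>w'\<in>children N w. T w') \<le> T w" if w: "0 < snd w" for w :: "'a \<times> real"
  proof -
    have N0: "0 < N" using N by simp
    have "(\<Sum>w'\<in>children N w. T w') = (\<Sum>i. \<Sum>w'\<in>children N w. \<Sum>c | c \<in> \<C> i \<and> cube_of c \<subseteq> cube_of w'. ennreal (snd c powr s))"
      unfolding T_def by (rule suminf_sum[symmetric]) simp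
    also have "\<dots> \<le> T w" unfolding T_def
    proof (rule suminf_le)
      fix i
      have "(\<Sum>w'\<in>children N w. \<Sum>c | c \<in> \<C> i \<and> cube_of c \<subseteq> cube_of w'. ennreal (snd c powr s)) =
          (\<Sum>c\<in>(\<Union>w'\<in>children N w. {c. c \<in> \<C> i \<and> cube_of c \<subseteq> cube_of w'}). ennreal (snd c powr s))"
      proof (rule sum.UNION_disjoint[symmetric])
        show "finite (children N w)" by (rule finite_children)
        show "\<forall>w'\<in>children N w. finite {c. c \<in> \<C> i \<and> cube_of c \<subseteq> cube_of w'}" using fin[of i] by simp
        show "\<forall>w1\<in>children N w. \<forall>w2\<in>children N w. w1 \<noteq> w2 \<longrightarrow>
           {c. c \<in> \<C> i \<and> cube_of c \<subseteq> cube_of w1} \<inter> {c. c \<in> \<C> i \<and> cube_of c \<subseteq> cube_of w2} = {}"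
        proof (intro ballI impI, rule ccontr)
          fix w1 w2 assume w12: "w1 \<in> children N w" "w2 \<in> children N w" "w1 \<noteq> w2"
            "{c. c \<in> \<C> i \<and> cube_of c \<subseteq> cube_of w1} \<inter> {c. c \<in> \<C> i \<and> cube_of c \<subseteq> cube_of w2} \<noteq> {}"
          then obtain c where c: "c \<in> \<C> i" "cube_of c \<subseteq> cube_of w1" "cube_of c \<subseteq> cube_of w2" by blast
          have "0 < snd c" using csnd[OF c(1)] w0 N by (simp add: L_def)
          then obtain x where "x \<in> interior (cube_of c)" using interior_cube_of_nonempty by blast
          hence "x \<in> interior (cube_of w1)" "x \<in> interior (cube_of w2)" using c interior_mono by blast+
          thus False using children_interior_disjoint[OF w12(1,2) w N0] w12(3) by blast
        qed
      qed
      also have "\<dots> \<le> (\<Sum>c | c \<in> \<C> i \<and> cube_of c \<subseteq> cube_of w. ennreal (snd c powr s))"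
        using fin[of i] children_subset[OF _ w N0] by (intro sum_mono2) auto
      finally show "(\<Sum>w'\<in>children N w. \<Sum>c | c \<in> \<C> i \<and> cube_of c \<subseteq> cube_of w'. ennreal (snd c powr s))
          \<le> (\<Sum>c | c \<in> \<C> i \<and> cube_of c \<subseteq> cube_of w. ennreal (snd c powr s))" .
    qed simp_all
    finally show ?thesis .
  qed
  have "T w0 \<le> (\<Sum>i. ennreal (C * r i powr s))" unfolding T_def
  proof (rule suminf_le)
    fix i
    have "(\<Sum>c | c \<in> \<C> i \<and> cube_of c \<subseteq> cube_of w0. ennreal (snd c powr s)) \<le> (\<Sum>c\<in>\<C> i. ennreal (snd c powr s))"
      using fin[of i] by (intro sum_mono2) auto
    also have "\<dots> \<le> (\<Sum>c\<in>\<C> i. ennreal (real N powr s * r i powr s))"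
    proof (intro sum_mono ennreal_leI)
      fix c assume "c \<in> \<C> i"
      hence "snd c powr s \<le> (N * r i) powr s" using csnd k(2)[of i] s w0 by (intro powr_mono2) (auto simp: L_def)
      also have "\<dots> = real N powr s * r i powr s" using r0[of i] by (simp add: powr_mult)
      finally show "snd c powr s \<le> real N powr s * r i powr s" .
    qed
    also have "\<dots> = ennreal (card (\<C> i) * (real N powr s * r i powr s))" by (simp add: ennreal_of_nat_eq_real_of_nat ennreal_mult)
    also have "\<dots> \<le> ennreal (4 ^ n * (real N powr s * r i powr s))"
    proof (rule ennreal_leI, rule mult_right_mono)
      have "real (card (\<C> i)) \<le> real (4 ^ n)" using card[of i] by (rule of_nat_mono)
      thus "real (card (\<C> i)) \<le> 4 ^ n" by simp
    qed simp
    finally show "(\<Sum>c | c \<in> \<C> i \<and> cube_of c \<subseteq> cube_of w0. ennreal (snd c powr s)) \<le> ennreal (C * r i powr s)"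
      by (simp add: C_def mult.assoc)
  qed simp_all
  also have "\<dots> = ennreal (\<Sum>i. C * r i powr s)"
    using C rsm by (intro suminf_ennreal2 summable_mult) auto
  also have "\<dots> < ennreal B"
  proof (rule ennreal_lessI[OF B])
    have "(\<Sum>i. C * r i powr s) = C * (\<Sum>i. r i powr s)" by (rule suminf_mult[OF rsm])
    also have "\<dots> \<le> C * (2 * \<eta>)" using rsum C by simp
    finally show "(\<Sum>i. C * r i powr s) < B" using \<eta>(3) by linarith
  qed
  finally have "T w0 < ennreal B" .
  from chain[OF Tsub this] obtain W where W: "W 0 = w0" "\<And>j. W (Suc j) \<in> children N (W j)"
    "\<And>j. T (W j) < ennreal (snd (W j) powr s)" "\<And>x. (\<forall>j. x \<in> cube_of (W j)) \<Longrightarrow> x \<in> A" by blast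
  obtain x where x: "\<And>j. x \<in> cube_of (W j)"
    using chain_common_point[of W N] W(1,2) w0 N by auto
  have "x \<in> A \<inter> cube_of w0" using W(4) x W(1) by (metis IntI)
  then obtain i where i: "x \<in> U i" using U(1) by blast
  define c where "c = W (k i)"
  \<comment> \<open>The member of the chain in generation \<open>k i\<close> contains
    \<open>x\<close>, hence meets \<open>U i\<close> and contributes its own
    \<open>snd c powr s\<close> to \<open>T c\<close>.\<close>
  have "c \<in> \<C> i" unfolding \<C>_def c_def using chain_in_children[OF W(1,2)] N x i by auto
  hence "ennreal (snd c powr s) \<le> (\<Sum>c' | c' \<in> \<C> i \<and> cube_of c' \<subseteq> cube_of c. ennreal (snd c' powr s))"
    using fin[of i] by (intro member_le_sum) auto
  also have "\<dots> \<le> T c" unfolding T_def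
    using sum_le_suminf[of "\<lambda>i. \<Sum>c' | c' \<in> \<C> i \<and> cube_of c' \<subseteq> cube_of c. ennreal (snd c' powr s)" "{i}"] by simp
  finally show False using W(3)[of "k i"] by (simp add: c_def)
qed

subsection \<open>The tree of descending cubes\<close>

context harmonic_energy_comparison
begin

lemma c\<^sub>1_le: "c\<^sub>1 \<le> 1"
proof -
  define D where "D = 4 * (real DIM('a) + 1) * \<kappa>"
  have "1 \<le> D" using \<kappa>1 mult_mono[of 1 "4 * (real DIM('a) + 1)" 1 \<kappa>] by (simp add: D_def)
  moreover have "c\<^sub>1 = 1 / D" by (simp add: c\<^sub>1_def D_def)
  ultimately show ?thesis by simp
qed

text \<open>\<open>est l\<close> bounds the oscillation at scales below \<open>l\<close>: it is constant in the Bloch case and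
  tends to \<open>0\<close> through halvings in the little Bloch case.\<close>

context
  fixes est :: "real \<Rightarrow> real" and wr :: "'a \<times> real" and s M \<rho> :: real
  assumes wr: "0 < snd wr" and s: "0 < s" "s < DIM('a)" and M: "large M"
    and est_pos: "\<And>l. 0 < l \<Longrightarrow> l \<le> snd wr \<Longrightarrow> 0 < est l"
    and est_bloch: "\<And>l. 0 < l \<Longrightarrow> l \<le> snd wr \<Longrightarrow> bloch_below F (est l) l"
    and est_step: "\<And>l l'. 0 < l' \<Longrightarrow> l' \<le> l \<Longrightarrow> l \<le> snd wr \<Longrightarrow> est l' = est l \<or> est l' \<le> est l / 2"
    and \<rho>: "0 < \<rho>" "\<rho> < 1" "\<rho> powr (DIM('a) - s) \<le> c\<^sub>1 / 16" "ln (1 / \<rho>) \<le> c\<^sub>1 * M / 16 - DIM('a)"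
    and dich: "\<And>w. 0 < snd w \<Longrightarrow> snd w \<le> snd wr \<Longrightarrow> cube_of w \<subseteq> cube_of wr \<Longrightarrow>
      (\<exists>R. cube_vol w / 2 \<le> stopped_mass w (M * est (snd w)) R) \<or>
      (\<exists>R. est (snd w / N ^ R) \<le> est (snd w) / 2 \<and> snd w / N ^ R \<le> \<rho> * snd w \<and>
        cube_vol w / 2 \<le> unstopped_mass w (M * est (snd w)) R)"
begin

text \<open>If the target is at distance at least \<open>32 * M * \<epsilon> / c\<^sub>1\<close>, a
  displacement of norm at most \<open>2 * M * \<epsilon>\<close> with component at least
  \<open>c\<^sub>1 / 16 * M * \<epsilon>\<close> towards it does not increase the distance. If it is
  closer, the displacement adds at most \<open>2 * M * \<epsilon>\<close>.\<close>

definition "Kc = 32 / c\<^sub>1 + 2"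

text \<open>The leaves kept in a generation: they have shrunk by \<open>\<rho>\<close>, and either
  the gradient is still near the target \<open>v\<close> or the estimate has halved, after which a
  new target is chosen.\<close>

definition good :: "'a \<times> real \<Rightarrow> 'a \<times> real \<Rightarrow> 'a \<times> real \<Rightarrow> bool" where
  "good w0 v w \<longleftrightarrow> snd w \<le> \<rho> * snd w0 \<and> norm (grad F w - grad F w0) \<le> 2 * M * est (snd w0) \<and>
     (norm (grad F w - v) \<le> Kc * M * est (snd w0) \<or> est (snd w) \<le> est (snd w0) / 2)"

definition is_root :: "'a \<times> real \<Rightarrow> 'a \<times> real \<Rightarrow> bool" where
  "is_root w0 v \<longleftrightarrow> 0 < snd w0 \<and> snd w0 \<le> snd wr \<and> cube_of w0 \<subseteq> cube_of wr \<and>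
     norm (grad F w0 - v) \<le> Kc * M * est (snd w0)"

lemma M_pos: "0 < M" "osc + 2 \<le> M"
  using M osc_pos by (auto simp: large_def)

lemma Kc_pos: "2 < Kc"
  using c_pos by (simp add: Kc_def)

text \<open>Both alternatives of \<open>dich\<close> supply good leaves. Stopped mass is steered
  towards the target by \<open>descent\<close>; unstopped mass is followed to a depth where
  \<open>est\<close> has halved.\<close>

lemma root_step:
  assumes r: "is_root w0 v"
  obtains R where "c\<^sub>1 / 16 * cube_vol w0 \<le> stopped_sum ch (stop w0 (M * est (snd w0))) R w0 (\<lambda>w. if good w0 v w then cube_vol w else 0)"
proof -
  define \<epsilon> where "\<epsilon> = est (snd w0)"
  have w0: "0 < snd w0" "snd w0 \<le> snd wr" "cube_of w0 \<subseteq> cube_of wr" "norm (grad F w0 - v) \<le> Kc * M * \<epsilon>"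
    using r by (auto simp: is_root_def \<epsilon>_def)
  have \<epsilon>: "0 < \<epsilon>" unfolding \<epsilon>_def by (rule est_pos[OF w0(1,2)])
  have bl: "bloch_below F \<epsilon> (snd w0)" unfolding \<epsilon>_def by (rule est_bloch[OF w0(1,2)])
  have Mosc: "(M + osc) * \<epsilon> \<le> 2 * M * \<epsilon>" using M_pos osc_pos \<epsilon> by (intro mult_right_mono) auto
  have V: "0 < cube_vol w0" using w0 by (simp add: cube_vol_def)
  consider (stopped) R where "cube_vol w0 / 2 \<le> stopped_mass w0 (M * \<epsilon>) R"
    | (unstopped) R where "est (snd w0 / N ^ R) \<le> \<epsilon> / 2" "snd w0 / N ^ R \<le> \<rho> * snd w0"
        "cube_vol w0 / 2 \<le> unstopped_mass w0 (M * \<epsilon>) R"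
    using dich[OF w0(1-3)] unfolding \<epsilon>_def by blast
  thus ?thesis
  proof cases
    case stopped
    define d where "d = grad F w0 - v"
    \<comment> \<open>On the target any direction serves, and the vertical one is chosen.\<close>
    define e where "e = (if d = 0 then (0, 1) else d /\<^sub>R norm d)"
    have e: "norm e = 1" by (simp add: e_def norm_Pair zero_prod_def)
    have de: "d = norm d *\<^sub>R e" by (cases "d = 0") (simp_all add: e_def zero_prod_def)
    define \<theta> where "\<theta> = c\<^sub>1 / 16 * M * \<epsilon>"
    have \<theta>: "0 < \<theta>" using c_pos M_pos \<epsilon> by (simp add: \<theta>_def)
    have "c\<^sub>1 / 16 * cube_vol w0 \<le> stopped_sum ch (stop w0 (M * \<epsilon>)) R w0 (\<lambda>w. if e \<bullet> (grad F w - grad F w0) \<le> - \<theta> then cube_vol w else 0)"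
      unfolding \<theta>_def by (rule descent[OF w0(1) bl \<epsilon> M e stopped])
    also have "\<dots> \<le> stopped_sum ch (stop w0 (M * \<epsilon>)) R w0 (\<lambda>w. if good w0 v w then cube_vol w else 0)"
    proof (rule PS_mono[OF w0(1) bl \<epsilon> M])
      fix r w assume i: "stage w0 R ((M + osc) * \<epsilon>) r w"
      note b = stage_snd[OF i w0(1)]
      have "good w0 v w" if x: "e \<bullet> (grad F w - grad F w0) \<le> - \<theta>"
      proof -
        define g where "g = grad F w - grad F w0"
        have g: "norm g \<le> 2 * M * \<epsilon>" using i Mosc by (simp add: stage_def g_def)
        have sub: "cube_of w \<subseteq> cube_of w0" using i by (simp add: stage_def)
        moreover have "fst w \<in> cube_of w" using b(1) by (simp add: mem_cube_of)
        ultimately have "norm g \<le> \<epsilon> * (DIM('a) + ln (snd w0 / snd w))"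
          using grad_osc[OF bl w0(1), of "fst w" "snd w"] b by (auto simp: g_def)
        moreover have "\<theta> \<le> norm g"
          using Cauchy_Schwarz_ineq2[of e g] e x by (simp add: g_def)
        \<comment> \<open>A displacement of at least \<open>\<theta>\<close> needs logarithmically
          many scales: the oscillation bound yields a lower bound on
          \<open>ln (snd w0 / snd w)\<close>, hence the shrinking by \<open>\<rho>\<close>.\<close>
        ultimately have "c\<^sub>1 / 16 * M * \<epsilon> \<le> (DIM('a) + ln (snd w0 / snd w)) * \<epsilon>" by (simp add: \<theta>_def mult.commute)
        hence "c\<^sub>1 / 16 * M \<le> DIM('a) + ln (snd w0 / snd w)" using \<epsilon> by simp
        hence "ln (1 / \<rho>) \<le> ln (snd w0 / snd w)" using \<rho>(4) by simp
        hence "1 / \<rho> \<le> snd w0 / snd w" using \<rho> b w0 by (subst (asm) ln_le_cancel_iff) auto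
        hence 1: "snd w \<le> \<rho> * snd w0" using \<rho> b by (simp add: field_simps)
        have 2: "norm (grad F w - v) \<le> Kc * M * \<epsilon>"
        proof -
          have gv: "grad F w - v = g + d" by (simp add: g_def d_def)
          have dK: "norm d \<le> Kc * M * \<epsilon>" using w0(4) by (simp add: d_def)
          show ?thesis
          proof (cases "32 * M * \<epsilon> / c\<^sub>1 \<le> norm d")
            case False
            have "norm (g + d) \<le> norm g + norm d" by (rule norm_triangle_ineq)
            also have "\<dots> \<le> 2 * M * \<epsilon> + 32 * M * \<epsilon> / c\<^sub>1" using g False by simp
            also have "\<dots> = Kc * M * \<epsilon>" by (simp add: Kc_def algebra_simps)
            finally show ?thesis by (simp add: gv)
          next
            case True
            have "(norm (g + d))\<^sup>2 = (norm g)\<^sup>2 + 2 * (g \<bullet> d) + (norm d)\<^sup>2"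
              by (simp add: power2_norm_eq_inner inner_add_left inner_add_right inner_commute)
            moreover have "g \<bullet> d = norm d * (e \<bullet> g)" by (subst de) (simp add: inner_commute)
            moreover have "norm d * (e \<bullet> g) \<le> norm d * (- \<theta>)" using x by (intro mult_left_mono) (auto simp: g_def)
            moreover have "(norm g)\<^sup>2 \<le> (2 * M * \<epsilon>)\<^sup>2" using g by (intro power_mono) auto
            moreover have "(2 * M * \<epsilon>)\<^sup>2 \<le> 2 * (norm d * \<theta>)"
            proof -
              have "(2 * M * \<epsilon>)\<^sup>2 = 2 * ((32 * M * \<epsilon> / c\<^sub>1) * \<theta>)" using c_pos by (simp add: \<theta>_def power2_eq_square)
              also have "\<dots> \<le> 2 * (norm d * \<theta>)"
                using mult_right_mono[OF True, of \<theta>] \<theta> by (intro mult_left_mono) auto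
              finally show ?thesis .
            qed
            ultimately have "(norm (g + d))\<^sup>2 \<le> (norm d)\<^sup>2" by linarith
            hence "norm (g + d) \<le> norm d" by (rule power2_le_imp_le) simp
            thus ?thesis using dK by (simp add: gv)
          qed
        qed
        show ?thesis using 1 2 g by (simp add: good_def g_def \<epsilon>_def)
      qed
      thus "(if e \<bullet> (grad F w - grad F w0) \<le> - \<theta> then cube_vol w else 0) \<le> (if good w0 v w then cube_vol w else 0)"
        using b by (auto simp: cube_vol_def)
    qed
    finally show ?thesis using that by (simp add: \<epsilon>_def)
  next
    case unstopped
    have "c\<^sub>1 / 16 * cube_vol w0 \<le> 1 / 2 * cube_vol w0" using V c\<^sub>1_le by (intro mult_right_mono) auto
    also have "\<dots> \<le> unstopped_mass w0 (M * \<epsilon>) R"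
      using unstopped(3) by simp
    also have "\<dots> \<le> stopped_sum ch (stop w0 (M * \<epsilon>)) R w0 (\<lambda>w. if good w0 v w then cube_vol w else 0)"
    proof (rule stopped_sum_mono_inv[where I = "stage w0 R ((M + osc) * \<epsilon>)"])
      show "stage w0 R ((M + osc) * \<epsilon>) R w0" using M_pos \<epsilon> osc_pos by (intro stage_start) simp
      show "stage w0 R ((M + osc) * \<epsilon>) r w'" if "stage w0 R ((M + osc) * \<epsilon>) (Suc r) w" "\<not> stop w0 (M * \<epsilon>) w" "w' \<in> ch w" for r w w'
        by (rule stage_step[OF bl w0(1) _ that]) (simp add: algebra_simps)
      fix r w assume i: "stage w0 R ((M + osc) * \<epsilon>) r w" and l: "r = 0 \<or> stop w0 (M * \<epsilon>) w"
      note b = stage_snd[OF i w0(1)]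
      have "good w0 v w" if ns: "\<not> stop w0 (M * \<epsilon>) w"
      proof -
        \<comment> \<open>A leaf that has not stopped was cut off by depth, so it sits at level
          \<open>R\<close>, where the estimate has halved.\<close>
        have sw: "snd w = snd w0 / N ^ R" using i l ns by (simp add: stage_def)
        have "norm (grad F w - grad F w0) \<le> M * \<epsilon>" using ns by (simp add: stop_def)
        also have "\<dots> \<le> 2 * M * \<epsilon>" using M_pos \<epsilon> by simp
        finally show ?thesis using unstopped(1,2) unfolding good_def sw \<epsilon>_def by simp
      qed
      thus "(if stop w0 (M * \<epsilon>) w then 0 else cube_vol w) \<le> (if good w0 v w then cube_vol w else 0)"
        using b by (auto simp: cube_vol_def)
    qed
    finally show ?thesis using that by (simp add: \<epsilon>_def)
  qed
qed

text \<open>A state \<open>(w0, v, r)\<close> consists of the last cube at which the construction was restarted, the current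
  target value and the remaining depth.\<close>

definition mass :: "'a \<times> real \<Rightarrow> ('a \<times> real) \<times> ('a \<times> real) \<times> nat \<Rightarrow> real" where
  "mass w \<sigma> = (case \<sigma> of (w0, v, r) \<Rightarrow> if 0 < snd w0 \<and> 0 < snd w then snd w0 powr (s - DIM('a)) *
     stopped_sum ch (stop w0 (M * est (snd w0))) r w (\<lambda>w. if good w0 v w \<and> 0 < snd w then cube_vol w else 0) else 0)"

definition mass_inv :: "'a \<times> real \<Rightarrow> ('a \<times> real) \<times> ('a \<times> real) \<times> nat \<Rightarrow> bool" where
  "mass_inv w \<sigma> = (case \<sigma> of (w0, v, r) \<Rightarrow> is_root w0 v \<and> 0 < snd w \<and> snd w \<le> snd w0 \<and> cube_of w \<subseteq> cube_of w0 \<and>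
     norm (grad F w - grad F w0) \<le> 2 * M * est (snd w0))"

text \<open>Twice the distance that the gradient can have from the target within a generation. The
  other half of the radius is room for the next ball once the estimate has halved.\<close>

definition "rad = 2 * (Kc + 2) * M"

text \<open>The last clause forces restarts along an infinite chain, because the remaining depth
  cannot decrease forever.\<close>

definition mass_step :: "'a \<times> real \<Rightarrow> ('a \<times> real) \<times> ('a \<times> real) \<times> nat \<Rightarrow> 'a \<times> real \<Rightarrow> ('a \<times> real) \<times> ('a \<times> real) \<times> nat \<Rightarrow> bool" where
  "mass_step w \<sigma> w' \<sigma>' = (case \<sigma> of (w0, v, r) \<Rightarrow> case \<sigma>' of (w0', v', r') \<Rightarrow>
     cball v' (rad * est (snd w0')) \<subseteq> cball v (rad * est (snd w0)) \<and> est (snd w0') \<le> est (snd w0) \<and>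
     (r' < r \<or> snd w0' = snd w))"

lemma stopped_sum_pos_cong:
  assumes "0 < snd w"
  shows "stopped_sum ch st r w (\<lambda>w. if P w \<and> 0 < snd w then cube_vol w else 0) = stopped_sum ch st r w (\<lambda>w. if P w then cube_vol w else 0)"
  using assms
proof (induction r arbitrary: w)
  case (Suc r)
  thus ?case using N0 by (auto simp: snd_children intro!: sum.cong)
qed simp

lemma mass_nonneg: "0 \<le> mass w \<sigma>"
  unfolding mass_def case_prod_unfold by (auto intro!: mult_nonneg_nonneg stopped_sum_nonneg simp: cube_vol_def)

text \<open>The factor \<open>snd w0 powr (s - DIM('a))\<close> converts volume into
  \<open>s\<close>-dimensional size. As \<open>s < DIM('a)\<close>, it only grows when
  \<open>w0\<close> is replaced by the smaller cube \<open>w\<close>.\<close>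

lemma mass_le:
  assumes "mass_inv w \<sigma>"
  shows "mass w \<sigma> \<le> snd w powr s"
proof -
  obtain w0 v r where \<sigma>: "\<sigma> = (w0, v, r)" by (cases \<sigma>)
  have i: "0 < snd w" "snd w \<le> snd w0" using assms by (auto simp: mass_inv_def \<sigma>)
  let ?p = "stopped_sum ch (stop w0 (M * est (snd w0))) r w"
  have "?p (\<lambda>w. if good w0 v w \<and> 0 < snd w then cube_vol w else 0) \<le> ?p cube_vol"
    by (rule stopped_sum_mono_inv[where I = "\<lambda>_ w. 0 < snd w"]) (use i N0 in \<open>auto simp: cube_vol_def snd_children\<close>)
  also have "\<dots> = cube_vol w" by (rule stopped_sum_cube_vol[OF i(1)])
  finally have 1: "?p (\<lambda>w. if good w0 v w \<and> 0 < snd w then cube_vol w else 0) \<le> cube_vol w" .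
  have "snd w0 powr (s - DIM('a)) \<le> snd w powr (s - DIM('a))"
    using i s by (intro powr_mono2') auto
  hence "snd w0 powr (s - DIM('a)) * ?p (\<lambda>w. if good w0 v w \<and> 0 < snd w then cube_vol w else 0) \<le> snd w powr (s - DIM('a)) * cube_vol w"
    using 1 by (intro mult_mono) (auto intro!: stopped_sum_nonneg simp: cube_vol_def)
  also have "\<dots> = snd w powr s" using i by (simp add: cube_vol_def powr_realpow[symmetric] powr_add[symmetric])
  finally show ?thesis using i by (simp add: mass_def \<sigma>)
qed

text \<open>Inside a generation the mass is shared exactly among the children. At a good leaf a new
  generation starts: only \<open>c\<^sub>1 / 16\<close> of the volume survives, but the shrinking by
  \<open>\<rho>\<close> raises the volume factor by at least \<open>16 / c\<^sub>1\<close>.\<close>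

lemma mass_split:
  assumes I: "mass_inv w \<sigma>" and pos: "0 < mass w \<sigma>"
  shows "\<exists>\<tau>. mass w \<sigma> \<le> (\<Sum>w'\<in>ch w. mass w' (\<tau> w')) \<and>
      (\<forall>w'\<in>ch w. 0 < mass w' (\<tau> w') \<longrightarrow> mass_inv w' (\<tau> w') \<and> mass_step w \<sigma> w' (\<tau> w'))"
proof -
  obtain w0 v r where \<sigma>: "\<sigma> = (w0, v, r)" by (cases \<sigma>)
  define \<epsilon> where "\<epsilon> = est (snd w0)"
  have i: "is_root w0 v" "0 < snd w" "snd w \<le> snd w0" "cube_of w \<subseteq> cube_of w0" "norm (grad F w - grad F w0) \<le> 2 * M * \<epsilon>"
    using I by (auto simp: mass_inv_def \<sigma> \<epsilon>_def)
  have w0: "0 < snd w0" "snd w0 \<le> snd wr" "cube_of w0 \<subseteq> cube_of wr" "norm (grad F w0 - v) \<le> Kc * M * \<epsilon>"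
    using i(1) by (auto simp: is_root_def \<epsilon>_def)
  have \<epsilon>: "0 < \<epsilon>" unfolding \<epsilon>_def by (rule est_pos[OF w0(1,2)])
  have bl: "bloch_below F \<epsilon> (snd w0)" unfolding \<epsilon>_def by (rule est_bloch[OF w0(1,2)])
  have chw: "0 < snd w'" "snd w' \<le> snd w" "cube_of w' \<subseteq> cube_of w" if "w' \<in> ch w" for w'
    using that i N0 children_subset[OF that i(2) N0]
    by (auto simp: snd_children divide_le_eq mult_le_cancel_left1)
  show ?thesis
  proof (cases "r = 0 \<or> stop w0 (M * \<epsilon>) w")
    case False
    then obtain r1 where r: "r = Suc r1" "\<not> stop w0 (M * \<epsilon>) w" by (cases r) auto
    have "mass w \<sigma> = (\<Sum>w'\<in>ch w. mass w' (w0, v, r1))"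
      using w0 i r chw by (simp add: mass_def \<sigma> \<epsilon>_def sum_distrib_left)
    moreover have "mass_inv w' (w0, v, r1)" if w': "w' \<in> ch w" for w'
    proof -
      have "norm (grad F w' - grad F w) \<le> \<epsilon> * osc"
        by (rule grad_osc_child[OF bloch_below_mono[OF bl i(3) order_refl] i(2) w'])
      moreover have "\<epsilon> * osc \<le> M * \<epsilon>" using M_pos \<epsilon> by (simp add: mult.commute)
      ultimately have "norm (grad F w' - grad F w0) \<le> 2 * M * \<epsilon>"
        using r(2) norm_triangle_ineq[of "grad F w' - grad F w" "grad F w - grad F w0"] by (simp add: stop_def)
      thus ?thesis using i chw[OF w'] by (auto simp: mass_inv_def \<epsilon>_def)
    qed
    moreover have "mass_step w \<sigma> w' (w0, v, r1)" for w' by (simp add: mass_step_def \<sigma> r)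
    ultimately show ?thesis by (intro exI[of _ "\<lambda>_. (w0, v, r1)"]) auto
  next
    case True
    have leaf: "stopped_sum ch (stop w0 (M * est (snd w0))) r w f = f w" for f
      using True stopped_sum_stop[of "stop w0 (M * est (snd w0))" w ch r f] by (auto simp: \<epsilon>_def)
    have g: "good w0 v w" using pos by (auto simp: mass_def \<sigma> leaf split: if_splits)
    have \<alpha>: "mass w \<sigma> = snd w0 powr (s - DIM('a)) * cube_vol w" using g w0 i by (simp add: mass_def \<sigma> leaf)
    define \<epsilon>' where "\<epsilon>' = est (snd w)"
    have swr: "snd w \<le> snd wr" using i w0 by simp
    have \<epsilon>': "0 < \<epsilon>'" unfolding \<epsilon>'_def by (rule est_pos[OF i(2) swr])
    have st: "\<epsilon>' = \<epsilon> \<or> \<epsilon>' \<le> \<epsilon> / 2" unfolding \<epsilon>_def \<epsilon>'_def by (rule est_step[OF i(2,3) w0(2)])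
    \<comment> \<open>The target is kept while the estimate is unchanged and reset to the current
      gradient after a halving; with these choices the balls around the targets are nested.\<close>
    define v' where "v' = (if \<epsilon>' = \<epsilon> then v else grad F w)"
    have root: "is_root w v'"
    proof -
      have "norm (grad F w - v') \<le> Kc * M * \<epsilon>'"
      proof (cases "\<epsilon>' = \<epsilon>")
        case True
        hence "norm (grad F w - v) \<le> Kc * M * \<epsilon>" using g \<epsilon> by (auto simp: good_def \<epsilon>_def \<epsilon>'_def)
        thus ?thesis using True by (simp add: v'_def)
      qed (use \<epsilon>' Kc_pos M_pos in \<open>simp add: v'_def\<close>)
      thus ?thesis using i w0 swr by (auto simp: is_root_def \<epsilon>'_def)
    qed
    obtain R where R: "c\<^sub>1 / 16 * cube_vol w \<le> stopped_sum ch (stop w (M * \<epsilon>')) R w (\<lambda>w'. if good w v' w' then cube_vol w' else 0)"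
      using root_step[OF root] unfolding \<epsilon>'_def .
    have V: "0 < cube_vol w" using i by (simp add: cube_vol_def)
    \<comment> \<open>With \<open>R = 0\<close> the leaf would be \<open>w\<close> itself, which
      cannot have shrunk by \<open>\<rho> < 1\<close>.\<close>
    have "R \<noteq> 0"
    proof
      assume "R = 0"
      hence "good w v' w" using R V c_pos by (auto split: if_splits simp: mult_le_0_iff)
      hence "snd w \<le> \<rho> * snd w" by (simp add: good_def)
      thus False using \<rho> i by simp
    qed
    then obtain R1 where R1: "R = Suc R1" using not0_implies_Suc by blast
    have ns: "\<not> stop w (M * \<epsilon>') w" using M_pos \<epsilon>' by (simp add: stop_def mult_le_0_iff)
    have "snd w0 powr (s - DIM('a)) \<le> c\<^sub>1 / 16 * snd w powr (s - DIM('a))"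
    proof -
      have "snd w / snd w0 \<le> \<rho>" using g w0 by (simp add: good_def divide_le_eq)
      hence "(snd w / snd w0) powr (DIM('a) - s) \<le> \<rho> powr (DIM('a) - s)" using i w0 s by (intro powr_mono2) auto
      hence "(snd w / snd w0) powr (DIM('a) - s) \<le> c\<^sub>1 / 16" using \<rho>(3) by simp
      hence "(snd w / snd w0) powr (DIM('a) - s) * snd w powr (s - DIM('a)) \<le> c\<^sub>1 / 16 * snd w powr (s - DIM('a))"
        by (intro mult_right_mono) auto
      also have "(snd w / snd w0) powr (DIM('a) - s) * snd w powr (s - DIM('a)) = snd w0 powr (s - DIM('a))"
        using i w0 powr_minus_divide[of "snd w" "DIM('a) - s"] powr_minus_divide[of "snd w0" "DIM('a) - s"] by (simp add: powr_divide)
      finally show ?thesis .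
    qed
    hence "mass w \<sigma> \<le> c\<^sub>1 / 16 * snd w powr (s - DIM('a)) * cube_vol w"
      unfolding \<alpha> using V by (intro mult_right_mono) auto
    also have "\<dots> = snd w powr (s - DIM('a)) * (c\<^sub>1 / 16 * cube_vol w)" by simp
    also have "\<dots> \<le> snd w powr (s - DIM('a)) * stopped_sum ch (stop w (M * \<epsilon>')) R w (\<lambda>w'. if good w v' w' then cube_vol w' else 0)"
      using R by (intro mult_left_mono) auto
    also have "\<dots> = (\<Sum>w'\<in>ch w. mass w' (w, v', R1))"
      using ns i chw stopped_sum_pos_cong by (simp add: R1 mass_def \<epsilon>'_def sum_distrib_left)
    finally have 1: "mass w \<sigma> \<le> (\<Sum>w'\<in>ch w. mass w' (w, v', R1))" .
    have 2: "mass_inv w' (w, v', R1)" if w': "w' \<in> ch w" for w'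
    proof -
      have "norm (grad F w' - grad F w) \<le> \<epsilon>' * osc"
        by (rule grad_osc_child[OF _ i(2) w']) (simp add: \<epsilon>'_def est_bloch[OF i(2) swr])
      moreover have "\<epsilon>' * osc \<le> \<epsilon>' * (2 * M)" using M_pos \<epsilon>' by (intro mult_left_mono) auto
      ultimately show ?thesis using root chw[OF w'] by (auto simp: mass_inv_def \<epsilon>'_def mult_ac)
    qed
    have 3: "mass_step w \<sigma> w' (w, v', R1)" for w'
    proof -
      have "cball v' (rad * \<epsilon>') \<subseteq> cball v (rad * \<epsilon>)"
      proof (cases "\<epsilon>' = \<epsilon>")
        case False
        hence h: "\<epsilon>' \<le> \<epsilon> / 2" using st by blast
        have "norm (grad F w - v) \<le> norm (grad F w - grad F w0) + norm (grad F w0 - v)"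
          using norm_triangle_ineq[of "grad F w - grad F w0" "grad F w0 - v"] by simp
        also have "\<dots> \<le> rad * \<epsilon> / 2" using i(5) w0(4) by (simp add: rad_def algebra_simps)
        finally have "dist v' v \<le> rad * \<epsilon> / 2" using False by (simp add: v'_def dist_norm)
        moreover have "rad * \<epsilon>' \<le> rad * (\<epsilon> / 2)" using h Kc_pos M_pos by (intro mult_left_mono) (auto simp: rad_def)
        ultimately show ?thesis by (intro subsetI) (smt (verit) dist_commute dist_triangle mem_cball times_divide_eq_right field_sum_of_halves)
      qed (simp add: v'_def)
      moreover have "\<epsilon>' \<le> \<epsilon>" using st \<epsilon> by auto
      ultimately show ?thesis by (simp add: mass_step_def \<sigma> \<epsilon>_def \<epsilon>'_def)
    qed
    show ?thesis using 1 2 3 by (intro exI[of _ "\<lambda>_. (w, v', R1)"]) auto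
  qed
qed

text \<open>Isolates what the boundary sets need of a chain. Nested balls keep the gradients
  bounded; when \<open>est\<close> tends to 0, the control of \<open>e\<close> by \<open>est\<close>
  at arbitrarily small scales also shrinks the balls.\<close>

lemma hausdorff_measure_tree:
  assumes A: "\<And>W v e Q x. W 0 = wr \<Longrightarrow> (\<And>j. W (Suc j) \<in> ch (W j)) \<Longrightarrow> (\<And>j. grad F (W j) \<in> cball (v j) (Q * e j)) \<Longrightarrow>
    (\<And>j. cball (v (Suc j)) (Q * e (Suc j)) \<subseteq> cball (v j) (Q * e j)) \<Longrightarrow> (\<And>j. 0 \<le> e j) \<Longrightarrow>
    (\<And>j::nat. \<exists>i l. 0 < l \<and> l \<le> snd (W j) \<and> e i \<le> est l) \<Longrightarrow> (\<And>j. x \<in> cube_of (W j)) \<Longrightarrow> x \<in> A"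
  shows "hausdorff_measure s (A \<inter> cube_of wr) \<noteq> 0"
proof -
  have root: "is_root wr (grad F wr)"
    using wr est_pos[of "snd wr"] Kc_pos M_pos by (simp add: is_root_def)
  obtain R where R: "c\<^sub>1 / 16 * cube_vol wr \<le> stopped_sum ch (stop wr (M * est (snd wr))) R wr (\<lambda>w. if good wr (grad F wr) w then cube_vol w else 0)"
    using root_step[OF root] .
  define \<sigma>0 where "\<sigma>0 = (wr, grad F wr, R)"
  define B where "B = mass wr \<sigma>0"
  have V: "0 < cube_vol wr" using wr by (simp add: cube_vol_def)
  have "0 < snd wr powr (s - DIM('a)) * (c\<^sub>1 / 16 * cube_vol wr)" using wr V c_pos by simp
  also have "\<dots> \<le> B" unfolding B_def mass_def \<sigma>0_def using wr R by (simp add: stopped_sum_pos_cong mult_left_mono)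
  finally have B: "0 < B" .
  have I0: "mass_inv wr \<sigma>0" using root wr est_pos[of "snd wr"] M_pos by (simp add: mass_inv_def \<sigma>0_def)
  show ?thesis
  proof (rule hausdorff_measure_nonzero[OF wr N2 s(1) B])
    fix T :: "'a \<times> real \<Rightarrow> ennreal"
    assume T: "\<And>w. 0 < snd w \<Longrightarrow> (\<Sum>w'\<in>ch w. T w') \<le> T w" "T wr < ennreal B"
    obtain W S where WS: "W 0 = wr" "S 0 = \<sigma>0" "\<And>j. W (Suc j) \<in> ch (W j)" "\<And>j. mass_inv (W j) (S j)"
      "\<And>j. mass_step (W j) (S j) (W (Suc j)) (S (Suc j))" "\<And>j. T (W j) < ennreal (mass (W j) (S j))"
    proof (rule descending_chain[where Inv = mass_inv and \<alpha> = mass and ch = ch and Tr = mass_step and T = T and ?w0.0 = wr and ?\<sigma>0.0 = \<sigma>0])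
      show "(\<Sum>w'\<in>ch w. T w') \<le> T w" if "mass_inv w \<sigma>" for w \<sigma>
        using that by (intro T(1)) (auto simp: mass_inv_def split: prod.splits)
    qed (use mass_split mass_nonneg I0 T(2) in \<open>auto simp: B_def\<close>)
    define w0 where "w0 j = fst (S j)" for j
    define v where "v j = fst (snd (S j))" for j
    define r where "r j = snd (snd (S j))" for j
    define e where "e j = est (snd (w0 j))" for j
    have Sj: "S j = (w0 j, v j, r j)" for j by (simp add: w0_def v_def r_def)
    have stage: "is_root (w0 j) (v j)" "0 < snd (W j)" "snd (W j) \<le> snd (w0 j)" "norm (grad F (W j) - grad F (w0 j)) \<le> 2 * M * e j" for j
      using WS(4)[of j] by (auto simp: mass_inv_def Sj e_def)
    have tr: "cball (v (Suc j)) (rad * e (Suc j)) \<subseteq> cball (v j) (rad * e j)" "e (Suc j) \<le> e j"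
       "r (Suc j) < r j \<or> snd (w0 (Suc j)) = snd (W j)" for j
      using WS(5)[of j] by (auto simp: mass_step_def Sj e_def)
    have e0: "0 < e j" for j using stage(1)[of j] by (auto simp: e_def is_root_def intro: est_pos)
    have gin: "grad F (W j) \<in> cball (v j) (rad * e j)" for j
    proof -
      have "norm (grad F (w0 j) - v j) \<le> Kc * M * e j" using stage(1)[of j] by (simp add: is_root_def e_def)
      hence "norm (grad F (W j) - v j) \<le> (Kc + 2) * M * e j"
        using stage(4)[of j] norm_triangle_ineq[of "grad F (W j) - grad F (w0 j)" "grad F (w0 j) - v j"] by (simp add: algebra_simps)
      also have "\<dots> \<le> rad * e j" using Kc_pos M_pos e0[of j] by (simp add: rad_def)
      finally show ?thesis by (simp add: dist_norm norm_minus_commute)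
    qed
    have TW: "T (W j) < ennreal (snd (W j) powr s)" for j
      using WS(6)[of j] ennreal_leI[OF mass_le[OF WS(4)[of j]]] by (rule less_le_trans)
    have Wmono: "snd (W i) \<le> snd (W j)" if "j \<le> i" for i j
      using that
    proof (induction rule: dec_induct)
      case (step i)
      have "snd (W (Suc i)) \<le> snd (W i)" using snd_children[OF WS(3)[of i]] stage(2)[of i] N0 by (simp add: divide_le_eq mult_le_cancel_left1)
      thus ?case using step by simp
    qed simp
    have ei: "\<exists>i l. 0 < l \<and> l \<le> snd (W j) \<and> e i \<le> est l" for j
    proof -
      \<comment> \<open>A restart after time \<open>j\<close> exists by descent on the remaining
        depth; from there on the estimate is taken at the scale of the current cube.\<close>
      have "\<exists>i\<ge>j. \<not> r (Suc i) < r i"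
      proof (rule ccontr)
        assume "\<not> ?thesis"
        hence dec: "r (Suc i) < r i" if "j \<le> i" for i using that by blast
        have "r (j + m) + m \<le> r j" for m
        proof (induction m)
          case (Suc m)
          thus ?case using dec[of "j + m"] by simp
        qed simp
        from this[of "Suc (r j)"] show False by simp
      qed
      then obtain i where i: "j \<le> i" "\<not> r (Suc i) < r i" by blast
      hence "snd (w0 (Suc i)) = snd (W i)" using tr(3)[of i] by blast
      thus ?thesis using stage(2)[of i] Wmono[OF i(1)] by (intro exI[of _ "Suc i"] exI[of _ "snd (W i)"]) (simp add: e_def)
    qed
    have "x \<in> A" if "\<forall>j. x \<in> cube_of (W j)" for x
      by (rule A[OF WS(1,3) gin tr(1) less_imp_le[OF e0] ei]) (use that in blast)
    thus "\<exists>W. W 0 = wr \<and> (\<forall>j. W (Suc j) \<in> ch (W j) \<and> T (W j) < ennreal (snd (W j) powr s)) \<and>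
        (\<forall>x. (\<forall>j. x \<in> cube_of (W j)) \<longrightarrow> x \<in> A)"
      using WS(1,3) TW by blast
  qed
qed

end

end

subsection \<open>Hausdorff dimension of subsets of a cube\<close>

lemma hausdorff_measure_mono: "A \<subseteq> B \<Longrightarrow> hausdorff_measure s A \<le> hausdorff_measure s B"
  unfolding hausdorff_measure_def hausdorff_premeasure_def
  by (intro SUP_mono' INF_superset_mono) auto

lemma diameter_cube_of_le:
  fixes c :: "'a::euclidean_space \<times> real"
  assumes "0 \<le> snd c"
  shows "diameter (cube_of c) \<le> DIM('a) * snd c"
proof (rule diameter_le)
  show "cube_of c \<noteq> {} \<or> 0 \<le> DIM('a) * snd c" using assms by simp
  fix x y assume xy: "x \<in> cube_of c" "y \<in> cube_of c"
  have "norm (x - y) \<le> (\<Sum>i\<in>Basis. \<bar>(x - y) \<bullet> i\<bar>)" by (rule norm_le_l1)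
  also have "\<dots> \<le> (\<Sum>i\<in>(Basis::'a set). snd c)"
  proof (rule sum_mono)
    fix i :: 'a assume i: "i \<in> Basis"
    have "fst c \<bullet> i \<le> x \<bullet> i" "x \<bullet> i \<le> fst c \<bullet> i + snd c" "fst c \<bullet> i \<le> y \<bullet> i" "y \<bullet> i \<le> fst c \<bullet> i + snd c"
      using xy i by (auto simp: mem_cube_of)
    thus "\<bar>(x - y) \<bullet> i\<bar> \<le> snd c" by (simp add: inner_diff_left)
  qed
  finally show "norm (x - y) \<le> DIM('a) * snd c" by simp
qed

lemma card_children_le:
  fixes w :: "'a::euclidean_space \<times> real"
  shows "card (children K w) \<le> K ^ DIM('a)"
proof -
  have "card (children K w) \<le> card (digits K :: 'a set)"
    unfolding children_def by (rule card_image_le[OF finite_digits])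
  also have "\<dots> \<le> (\<Prod>i\<in>(Basis::'a set). card (real ` {..<K}))"
    unfolding digits_def by (rule card_coordinate_product_le) simp
  also have "\<dots> = K ^ DIM('a)" by (simp add: card_image)
  finally show ?thesis .
qed

text \<open>Subdivision into at most \<open>K ^ DIM('a)\<close> cubes of diameter at most
  \<open>n * snd w / K\<close> gives a sum of order \<open>K powr (n - t)\<close>, which tends to
  0.\<close>

lemma hausdorff_measure_cube_zero:
  fixes w :: "'a::euclidean_space \<times> real"
  assumes w: "0 < snd w" and t: "real DIM('a) < t" and A: "A \<subseteq> cube_of w"
  shows "hausdorff_measure t A = 0"
proof -
  define n where "n = real DIM('a)"
  have n: "0 < n" by (simp add: n_def)
  have "hausdorff_premeasure t \<delta> A \<le> 0" if \<delta>: "0 < \<delta>" for \<delta>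
  proof (rule ennreal_le_epsilon)
    fix \<eta> :: real assume \<eta>: "0 < \<eta>"
    have l1: "(\<lambda>K. n * snd w * inverse (real K)) \<longlonglongrightarrow> n * snd w * 0"
      by (intro tendsto_mult_left lim_inverse_n)
    have l2: "(\<lambda>K. (n * snd w) powr t * real K powr (n - t)) \<longlonglongrightarrow> (n * snd w) powr t * 0"
      using t by (intro tendsto_mult_left tendsto_neg_powr filterlim_real_sequentially) (simp add: n_def)
    have "\<forall>\<^sub>F K in sequentially. n * snd w * inverse (real K) < \<delta> \<and> (n * snd w) powr t * real K powr (n - t) < \<eta> \<and> 0 < K"
      using order_tendstoD(2)[OF l1, of \<delta>] order_tendstoD(2)[OF l2, of \<eta>] \<delta> \<eta> eventually_gt_at_top[of "0::nat"]
      by (intro eventually_conj) auto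
    then obtain K where K: "n * snd w * inverse (real K) < \<delta>" "(n * snd w) powr t * real K powr (n - t) < \<eta>" "0 < K"
      unfolding eventually_sequentially by blast
    define m where "m = card (children K w)"
    obtain f where f: "bij_betw f {..<m} (children K w)"
      using ex_bij_betw_nat_finite[OF finite_children[of K w]] unfolding m_def atLeast0LessThan by blast
    \<comment> \<open>Padding with empty sets is free: their diameter is 0 and
      \<open>0 powr t = 0\<close>.\<close>
    define U where "U i = (if i < m then cube_of (f i) else {})" for i
    have fc: "f i \<in> children K w" if "i < m" for i using f that by (auto simp: bij_betw_def)
    have sf: "snd (f i) = snd w / K" if "i < m" for i using snd_children[OF fc[OF that]] .
    have dU: "diameter (U i) \<le> n * snd w / K" if "i < m" for i
      using diameter_cube_of_le[of "f i"] sf[OF that] w that by (simp add: U_def n_def)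
    have bU: "bounded (U i)" for i by (simp add: U_def cube_of_cbox)
    have cov: "A \<subseteq> (\<Union>i. U i)"
    proof
      fix x assume "x \<in> A"
      hence "x \<in> \<Union>(cube_of ` children K w)"
        using A children_division(1)[OF w K(3)] unfolding division_of_def by auto
      then obtain c where c: "c \<in> children K w" "x \<in> cube_of c" by blast
      then obtain i where "i < m" "c = f i" using f unfolding bij_betw_def by (metis imageE lessThan_iff)
      thus "x \<in> (\<Union>i. U i)" using c by (auto simp: U_def)
    qed
    have "diameter (U i) \<le> \<delta>" for i
    proof (cases "i < m")
      case True
      thus ?thesis using dU[OF True] K(1) by (simp add: divide_inverse)
    qed (use \<delta> in \<open>simp add: U_def\<close>)
    hence "hausdorff_premeasure t \<delta> A \<le> (\<Sum>i. ennreal (diameter (U i) powr t))"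
      unfolding hausdorff_premeasure_def using cov bU by (intro INF_lower) auto
    also have "\<dots> = (\<Sum>i<m. ennreal (diameter (U i) powr t))"
      by (rule suminf_finite) (auto simp: U_def)
    also have "\<dots> \<le> (\<Sum>i<m. ennreal ((n * snd w / K) powr t))"
      using dU bU t n by (intro sum_mono ennreal_leI powr_mono2) (auto intro: diameter_ge_0 simp: n_def)
    also have "\<dots> = ennreal (m * (n * snd w / K) powr t)" by (simp add: ennreal_of_nat_eq_real_of_nat ennreal_mult)
    also have "\<dots> \<le> ennreal \<eta>"
    proof (rule ennreal_leI)
      have "real m \<le> real (K ^ DIM('a))" unfolding m_def by (rule of_nat_mono[OF card_children_le])
      hence "m * (n * snd w / K) powr t \<le> real (K ^ DIM('a)) * (n * snd w / K) powr t" by (rule mult_right_mono) simp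
      also have "real (K ^ DIM('a)) = real K powr n" using K(3) by (simp add: n_def powr_realpow)
      also have "real K powr n * (n * snd w / K) powr t = (n * snd w) powr t * real K powr (n - t)"
        using n w by (simp add: powr_divide powr_diff)
      finally show "m * (n * snd w / K) powr t \<le> \<eta>" using K(2) by simp
    qed
    finally show "hausdorff_premeasure t \<delta> A \<le> 0 + ennreal \<eta>" by simp
  qed
  thus ?thesis unfolding hausdorff_measure_def by (intro antisym SUP_least) auto
qed

lemma hausdorff_dim_eq_DIM:
  fixes w :: "'a::euclidean_space \<times> real"
  assumes w: "0 < snd w" and A: "A \<subseteq> cube_of w"
    and pos: "\<And>s::real. 0 < s \<Longrightarrow> s < DIM('a) \<Longrightarrow> hausdorff_measure s A \<noteq> 0"
  shows "hausdorff_dim A = of_nat DIM('a)"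
proof (rule antisym)
  show "hausdorff_dim A \<le> of_nat DIM('a)"
  proof (rule ennreal_le_epsilon)
    fix e :: real assume e: "0 < e"
    have "hausdorff_dim A \<le> ennreal (DIM('a) + e)"
      unfolding hausdorff_dim_def
      using hausdorff_measure_cube_zero[OF w _ A, of "DIM('a) + e"] e by (intro INF_lower) (auto intro: add_pos_pos)
    thus "hausdorff_dim A \<le> of_nat DIM('a) + ennreal e"
      using e by (simp add: ennreal_of_nat_eq_real_of_nat ennreal_plus)
  qed
  show "of_nat DIM('a) \<le> hausdorff_dim A"
    unfolding hausdorff_dim_def
  proof (rule INF_greatest)
    fix s assume "s \<in> {s. 0 < s \<and> hausdorff_measure s A = 0}"
    hence "DIM('a) \<le> s" using pos[of s] by force
    thus "of_nat DIM('a) \<le> ennreal s" by (simp add: ennreal_of_nat_eq_real_of_nat ennreal_leI)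
  qed
qed

subsection \<open>The boundary sets\<close>

context harmonic_energy_comparison
begin

lemma exists_large:
  fixes s :: real
  assumes "s < DIM('a)"
  obtains M \<rho> where "large M" "0 < \<rho>" "\<rho> < 1" "\<rho> powr (DIM('a) - s) \<le> c\<^sub>1 / 16" "ln (1 / \<rho>) \<le> c\<^sub>1 * M / 16 - DIM('a)"
proof -
  define \<rho> where "\<rho> = (c\<^sub>1 / 16) powr (1 / (DIM('a) - s))"
  have "c\<^sub>1 / 16 < 1" using c\<^sub>1_le by simp
  hence \<rho>: "0 < \<rho>" "\<rho> < 1" "\<rho> powr (DIM('a) - s) \<le> c\<^sub>1 / 16"
    using c_pos assms by (auto simp: \<rho>_def powr_powr powr01_less_one)
  define M where "M = Max {osc + 2, 4 * c\<^sub>2 / c\<^sub>1, 8 * c\<^sub>3 / c\<^sub>1, 16 * (ln (1 / \<rho>) + DIM('a)) / c\<^sub>1}"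
  have "osc + 2 \<le> M" "4 * c\<^sub>2 / c\<^sub>1 \<le> M" "8 * c\<^sub>3 / c\<^sub>1 \<le> M" "16 * (ln (1 / \<rho>) + DIM('a)) / c\<^sub>1 \<le> M"
    unfolding M_def by (rule Max_ge; simp)+
  hence "large M" "ln (1 / \<rho>) \<le> c\<^sub>1 * M / 16 - DIM('a)"
    using c_pos(1) by (auto simp: large_def pos_divide_le_eq mult.commute)
  thus ?thesis using that \<rho> by blast
qed

lemma stopped_unstopped:
  assumes "0 < snd w"
  shows "stopped_sum ch st R w (\<lambda>w'. if st w' then 0 else cube_vol w') = cube_vol w - stopped_sum ch st R w (\<lambda>w'. if st w' then cube_vol w' else 0)"
proof -
  have "stopped_sum ch st R w (\<lambda>w'. (if st w' then 0 else cube_vol w') + (if st w' then cube_vol w' else 0)) = stopped_sum ch st R w cube_vol"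
    by (rule arg_cong[where f = "stopped_sum ch st R w"]) auto
  thus ?thesis using stopped_sum_cube_vol[OF assms, of st R] by (simp add: stopped_sum_add)
qed

lemma chain_snd:
  fixes W :: "nat \<Rightarrow> 'a \<times> real"
  assumes "0 < snd (W 0)" "\<And>j. W (Suc j) \<in> ch (W j)"
  shows "snd (W j) = snd (W 0) / N ^ j" "0 < snd (W j)"
proof -
  show "snd (W j) = snd (W 0) / N ^ j"
    by (induction j) (use snd_children[OF assms(2)] in auto)
  thus "0 < snd (W j)" using assms N0 by simp
qed

lemma chain_scale:
  fixes W :: "nat \<Rightarrow> 'a \<times> real" and y :: real
  assumes W: "0 < snd (W 0)" "\<And>j. W (Suc j) \<in> ch (W j)" and y: "0 < y" "y \<le> snd (W 0)"
  obtains j where "y \<le> snd (W j)" "snd (W j) < N * y"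
proof -
  obtain k0 where "snd (W 0) / N ^ k0 < y" using exists_power_scale_less[OF N2 y(1)] by blast
  hence k0: "snd (W k0) < y" by (simp add: chain_snd(1)[OF W, of k0])
  define k where "k = (LEAST k. snd (W k) < y)"
  have k: "snd (W k) < y" unfolding k_def by (rule LeastI[of _ k0]) (rule k0)
  have "k \<noteq> 0"
  proof
    assume "k = 0"
    thus False using k y by simp
  qed
  then obtain j where j: "k = Suc j" using not0_implies_Suc by blast
  have "\<not> snd (W j) < y" using not_less_Least[of j "\<lambda>k. snd (W k) < y"] j k_def by simp
  moreover have "snd (W j) < N * y" using k snd_children[OF W(2)[of j]] N0 unfolding j by (simp add: divide_less_eq mult.commute)
  ultimately show ?thesis using that[of j] by simp
qed

lemma grad_osc_scale:
  fixes w :: "'a \<times> real" and y :: real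
  assumes "bloch_below F \<epsilon> (snd w)" "0 < snd w" "x \<in> cube_of w" "0 < y" "y \<le> snd w" "snd w < N * y"
  shows "norm (grad F (x, y) - grad F w) \<le> \<epsilon> * osc"
proof -
  have "ln (snd w / y) \<le> ln N" using assms by (subst ln_le_cancel_iff) (auto simp: divide_le_eq N0)
  moreover have "0 \<le> \<epsilon>" by (rule bloch_below_nonneg[OF assms(1,2)])
  ultimately have "\<epsilon> * (DIM('a) + ln (snd w / y)) \<le> \<epsilon> * osc" by (intro mult_left_mono) (auto simp: osc_def)
  thus ?thesis using grad_osc[OF assms(1-5)] by linarith
qed

text \<open>Every height up to \<open>snd (W 0)\<close> is within a factor \<open>N\<close> of the
  side of some cube of the chain, so bounds along the chain carry over to the vertical line above
  \<open>x\<close>.\<close>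

lemma bounded_chain_boundary:
  assumes W: "0 < snd (W 0)" "\<And>j. W (Suc j) \<in> ch (W j)" and x: "\<And>j. x \<in> cube_of (W j)"
    and bl: "\<And>l. bloch_below F \<epsilon> l" and C: "\<And>j. norm (grad F (W j)) \<le> C"
  shows "x \<in> bounded_boundary_set F"
proof -
  have b: "norm (grad F (x, y)) \<le> C + \<epsilon> * osc" if y: "0 < y" "y \<le> snd (W 0)" for y
  proof -
    obtain j where j: "y \<le> snd (W j)" "snd (W j) < N * y" using chain_scale[OF W y] .
    have "norm (grad F (x, y) - grad F (W j)) \<le> \<epsilon> * osc"
      by (rule grad_osc_scale[OF bl chain_snd(2)[OF W] x y(1) j])
    thus ?thesis using C[of j] norm_triangle_ineq2[of "grad F (x, y)" "grad F (W j)"] by linarith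
  qed
  have "\<forall>\<^sub>F y in at_right 0. ereal (norm (grad F (x, y))) \<le> ereal (C + \<epsilon> * osc)"
    using eventually_at_right_real[OF W(1)] by eventually_elim (simp add: b)
  hence "Limsup (at_right 0) (\<lambda>y. ereal (norm (grad F (x, y)))) \<le> ereal (C + \<epsilon> * osc)"
    by (rule Limsup_bounded)
  also have "\<dots> < \<infinity>" by simp
  finally show ?thesis by (simp add: bounded_boundary_set_def)
qed

text \<open>If the stopping time is infinite on a set of positive measure, the limiting proportion of
  unstopped volume is an additive mass that can be followed down the tree.\<close>

lemma hausdorff_measure_unstopped:
  fixes s m :: real
  assumes w0: "0 < snd w0" and s: "0 < s" "s < DIM('a)" and bl: "\<And>l. bloch_below F \<epsilon> l"
    and un: "\<And>R. stopped_mass w0 m R < cube_vol w0 / 2"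
  shows "hausdorff_measure s (bounded_boundary_set F \<inter> cube_of w0) \<noteq> 0"
proof -
  \<comment> \<open>The volume below \<open>w\<close> that survives \<open>r\<close> levels without
    stopping. The guard \<open>snd w' \<le> 0\<close> keeps it nonnegative at degenerate pairs,
    whose \<open>cube_vol\<close> may be negative.\<close>
  define a where "a r w = stopped_sum ch (stop w0 m) r w (\<lambda>w'. if stop w0 m w' \<or> snd w' \<le> 0 then 0 else cube_vol w')" for r w
  have a0: "0 \<le> a r w" for r w unfolding a_def by (rule stopped_sum_nonneg) (auto simp: cube_vol_def)
  have a_stop: "a r w = 0" if "stop w0 m w" for r w using that by (simp add: a_def stopped_sum_stop)
  have a_Suc: "a (Suc r) w = (\<Sum>w'\<in>ch w. a r w')" if "\<not> stop w0 m w" for r w using that by (simp add: a_def)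
  have pos: "0 < snd w'" if "0 < snd w" "w' \<in> ch w" for w w' using that N0 by (simp add: snd_children)
  have a_dec: "a (Suc r) w \<le> a r w" if "0 < snd w" for r w
    using that
  proof (induction r arbitrary: w)
    case 0
    show ?case
    proof (cases "stop w0 m w")
      case False
      have "a 1 w = (\<Sum>w'\<in>ch w. a 0 w')" using a_Suc[OF False, of 0] by simp
      also have "\<dots> \<le> (\<Sum>w'\<in>ch w. cube_vol w')" using pos[OF 0] by (intro sum_mono) (auto simp: a_def cube_vol_def less_imp_le)
      also have "\<dots> = cube_vol w" using cube_vol_children[OF 0 N0] by simp
      also have "\<dots> = a 0 w" using False 0 by (simp add: a_def)
      finally show ?thesis by simp
    qed (simp add: a_stop)
  next
    case (Suc r)
    show ?case
    proof (cases "stop w0 m w")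
      case False
      show ?thesis unfolding a_Suc[OF False] by (intro sum_mono Suc.IH pos[OF Suc.prems])
    qed (simp add: a_stop)
  qed
  define l where "l w = lim (\<lambda>r. a r w)" for w
  have lim: "(\<lambda>r. a r w) \<longlonglongrightarrow> l w" if "0 < snd w" for w
  proof -
    have "decseq (\<lambda>r. a r w)" using a_dec[OF that] by (rule decseq_SucI)
    hence "convergent (\<lambda>r. a r w)" using a0 by (metis convergentI decseq_convergent)
    thus ?thesis by (simp add: l_def convergent_LIMSEQ_iff)
  qed
  have l_nonneg: "0 \<le> l w" if "0 < snd w" for w using LIMSEQ_le_const[OF lim[OF that]] a0 by blast
  have l_le: "l w \<le> cube_vol w" if w: "0 < snd w" for w
  proof (rule LIMSEQ_le_const2[OF lim[OF w]], intro exI[of _ 0] allI impI)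
    fix r
    have "a r w \<le> a 0 w" using decseqD[OF decseq_SucI[of "\<lambda>r. a r w"], of 0 r] a_dec[OF w] by simp
    also have "\<dots> \<le> cube_vol w" using w by (simp add: a_def cube_vol_def)
    finally show "a r w \<le> cube_vol w" .
  qed
  have l_stop: "l w = 0" if "stop w0 m w" for w using a_stop[OF that] by (simp add: l_def)
  have l_ch: "l w = (\<Sum>w'\<in>ch w. l w')" if w: "0 < snd w" "\<not> stop w0 m w" for w
  proof (rule LIMSEQ_unique)
    show "(\<lambda>r. a (Suc r) w) \<longlonglongrightarrow> l w" using lim[OF w(1)] by (rule LIMSEQ_Suc)
    show "(\<lambda>r. a (Suc r) w) \<longlonglongrightarrow> (\<Sum>w'\<in>ch w. l w')"
      unfolding a_Suc[OF w(2)] using lim pos[OF w(1)] by (intro tendsto_sum) auto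
  qed
  have "a R w0 = unstopped_mass w0 m R" for R
    unfolding a_def
    by (intro antisym stopped_sum_mono_inv[where I = "\<lambda>_ w. 0 < snd w"]) (use w0 pos in \<open>auto simp: cube_vol_def\<close>)
  hence "cube_vol w0 / 2 \<le> a R w0" for R
    using un[of R] stopped_unstopped[OF w0, of "stop w0 m" R] by simp
  hence l0: "cube_vol w0 / 2 \<le> l w0" using LIMSEQ_le_const[OF lim[OF w0]] by blast
  \<comment> \<open>Rescaled so that \<open>\<alpha> w u\<close> is at most
    \<open>snd w powr s\<close> for cubes no larger than \<open>w0\<close>; the construction needs
    no memory, so its state is of type \<open>unit\<close>.\<close>
  define \<alpha> where "\<alpha> w u = (if 0 < snd w then snd w0 powr (s - DIM('a)) * l w else 0)" for w and u :: unit
  have "0 < cube_vol w0 / 2" using w0 by (simp add: cube_vol_def)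
  hence "0 < l w0" using l0 by linarith
  hence B: "0 < \<alpha> w0 ()" using w0 by (simp add: \<alpha>_def)
  show ?thesis
  proof (rule hausdorff_measure_nonzero[OF w0 N2 s(1) B])
    fix T :: "'a \<times> real \<Rightarrow> ennreal"
    assume T: "\<And>w. 0 < snd w \<Longrightarrow> (\<Sum>w'\<in>ch w. T w') \<le> T w" "T w0 < ennreal (\<alpha> w0 ())"
    define Inv where "Inv w u \<longleftrightarrow> 0 < snd w \<and> snd w \<le> snd w0" for w :: "'a \<times> real" and u :: unit
    obtain W S where W: "W 0 = w0" "S 0 = ()" "\<And>j. W (Suc j) \<in> ch (W j)" "\<And>j. Inv (W j) (S j)" "\<And>j::nat. True"
        "\<And>j. T (W j) < ennreal (\<alpha> (W j) (S j))"
    proof (rule descending_chain[where Inv = Inv and \<alpha> = \<alpha> and ch = ch and Tr = "\<lambda>_ _ _ _. True" and T = T and ?w0.0 = w0 and ?\<sigma>0.0 = "()"])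
      fix w :: "'a \<times> real" and \<sigma> assume I: "Inv w \<sigma>" and p: "0 < \<alpha> w \<sigma>"
      have w: "0 < snd w" "snd w \<le> snd w0" using I by (auto simp: Inv_def)
      have ns: "\<not> stop w0 m w" using p l_stop[of w] by (auto simp: \<alpha>_def split: if_splits)
      have "\<alpha> w \<sigma> = (\<Sum>w'\<in>ch w. \<alpha> w' ())" using w pos[OF w(1)] l_ch[OF w(1) ns] by (simp add: \<alpha>_def sum_distrib_left)
      moreover have "Inv w' ()" if "w' \<in> ch w" for w'
      proof -
        have "snd w' \<le> snd w" using snd_children[OF that] w N0 by (simp add: divide_le_eq mult_le_cancel_left1)
        thus ?thesis using pos[OF w(1) that] w by (simp add: Inv_def)
      qed
      ultimately show "\<exists>\<tau>. \<alpha> w \<sigma> \<le> (\<Sum>w'\<in>ch w. \<alpha> w' (\<tau> w')) \<and> (\<forall>w'\<in>ch w. 0 < \<alpha> w' (\<tau> w') \<longrightarrow> Inv w' (\<tau> w') \<and> True)"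
        by (intro exI[of _ "\<lambda>_. ()"]) auto
    next
      show "0 \<le> \<alpha> w \<sigma>" for w \<sigma> using l_nonneg by (simp add: \<alpha>_def)
      show "(\<Sum>w'\<in>ch w. T w') \<le> T w" if "Inv w \<sigma>" for w \<sigma> using that by (intro T(1)) (simp add: Inv_def)
      show "Inv w0 ()" using w0 by (simp add: Inv_def)
      show "T w0 < ennreal (\<alpha> w0 ())" by (rule T(2))
    qed blast
    have Wp: "0 < snd (W j)" "snd (W j) \<le> snd w0" for j using W(4)[of j] by (auto simp: Inv_def)
    have "T (W j) < ennreal (snd (W j) powr s)" for j
    proof -
      have "\<alpha> (W j) (S j) \<le> snd (W j) powr (s - DIM('a)) * cube_vol (W j)"
        using Wp[of j] l_le[OF Wp(1)[of j]] l_nonneg[OF Wp(1)[of j]] s unfolding \<alpha>_def by (auto intro!: mult_mono powr_mono2')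
      also have "\<dots> = snd (W j) powr s" using Wp(1)[of j] by (simp add: cube_vol_def powr_realpow[symmetric] powr_add[symmetric])
      finally show ?thesis using W(6)[of j] by (meson ennreal_leI less_le_trans)
    qed
    moreover have "x \<in> bounded_boundary_set F" if x: "\<forall>j. x \<in> cube_of (W j)" for x
    proof (rule bounded_chain_boundary[of W x \<epsilon> "norm (grad F w0) + m"])
      fix j
      have "0 < \<alpha> (W j) (S j)" using W(6)[of j] by (metis ennreal_neg leI not_less_zero)
      hence "\<not> stop w0 m (W j)" using l_stop[of "W j"] by (auto simp: \<alpha>_def split: if_splits)
      thus "norm (grad F (W j)) \<le> norm (grad F w0) + m"
        using norm_triangle_ineq2[of "grad F (W j)" "grad F w0"] by (simp add: stop_def)
    qed (use W x bl w0 in auto)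
    ultimately show "\<exists>W. W 0 = w0 \<and> (\<forall>j. W (Suc j) \<in> ch (W j) \<and> T (W j) < ennreal (snd (W j) powr s)) \<and>
        (\<forall>x. (\<forall>j. x \<in> cube_of (W j)) \<longrightarrow> x \<in> bounded_boundary_set F)"
      using W(1,3) by blast
  qed
qed

text \<open>A constant positive estimate never halves, so the tree requires stopping on half the
  volume in every subcube. If this fails in one subcube, \<open>hausdorff_measure_unstopped\<close>
  applies there, and the measure is monotone.\<close>

lemma hausdorff_measure_bounded_boundary_set:
  fixes s :: real
  assumes wr: "0 < snd wr" and s: "0 < s" "s < DIM('a)" and bl: "\<And>l. bloch_below F \<epsilon> l" and \<epsilon>: "0 < \<epsilon>"
  shows "hausdorff_measure s (bounded_boundary_set F \<inter> cube_of wr) \<noteq> 0"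
proof -
  obtain M \<rho> where M: "large M" and \<rho>: "0 < \<rho>" "\<rho> < 1" "\<rho> powr (DIM('a) - s) \<le> c\<^sub>1 / 16" "ln (1 / \<rho>) \<le> c\<^sub>1 * M / 16 - DIM('a)"
    using exists_large[OF s(2)] .
  show ?thesis
  proof (cases "\<forall>w. 0 < snd w \<longrightarrow> snd w \<le> snd wr \<longrightarrow> cube_of w \<subseteq> cube_of wr \<longrightarrow>
      (\<exists>R. cube_vol w / 2 \<le> stopped_mass w (M * \<epsilon>) R)")
    case False
    then obtain w where w: "0 < snd w" "cube_of w \<subseteq> cube_of wr"
      "\<And>R. stopped_mass w (M * \<epsilon>) R < cube_vol w / 2"
      by (auto simp: not_le)
    have "hausdorff_measure s (bounded_boundary_set F \<inter> cube_of w) \<le> hausdorff_measure s (bounded_boundary_set F \<inter> cube_of wr)"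
      using w(2) by (intro hausdorff_measure_mono) auto
    thus ?thesis using hausdorff_measure_unstopped[OF w(1) s bl w(3)] by auto
  next
    case True
    show ?thesis
    proof (rule hausdorff_measure_tree[OF wr s M _ _ _ \<rho>, where est = "\<lambda>_. \<epsilon>"])
      fix W :: "nat \<Rightarrow> 'a \<times> real" and v e Q x
      assume W: "W 0 = wr" "\<And>j. W (Suc j) \<in> ch (W j)" "\<And>j. grad F (W j) \<in> cball (v j) (Q * e j)"
        "\<And>j. cball (v (Suc j)) (Q * e (Suc j)) \<subseteq> cball (v j) (Q * e j)" and x: "\<And>j. x \<in> cube_of (W j)"
      have nest: "cball (v j) (Q * e j) \<subseteq> cball (v 0) (Q * e 0)" for j
        by (induction j) (use W(4) in blast)+
      have "norm (grad F (W j)) \<le> norm (v 0) + Q * e 0" for j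
      proof -
        have "dist (v 0) (grad F (W j)) \<le> Q * e 0" using W(3)[of j] nest[of j] by auto
        thus ?thesis using norm_triangle_ineq2[of "grad F (W j)" "v 0"] by (simp add: dist_norm norm_minus_commute)
      qed
      thus "x \<in> bounded_boundary_set F"
        using bounded_chain_boundary[of W x \<epsilon>] W(1,2) wr x bl by auto
    qed (use \<epsilon> bl True in auto)
  qed
qed

text \<open>The radii of the nested balls tend to 0 along a chain, so the gradients at its corners
  are Cauchy. The oscillation between a corner and the vertical line at comparable height is at most
  \<open>est * osc\<close> and tends to 0 as well.\<close>

lemma hausdorff_measure_convergent_boundary_set:
  fixes s :: real and est :: "real \<Rightarrow> real"
  assumes wr: "0 < snd wr" and s: "0 < s" "s < DIM('a)"
    and est_pos: "\<And>l. 0 < l \<Longrightarrow> l \<le> snd wr \<Longrightarrow> 0 < est l"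
    and est_bloch: "\<And>l. 0 < l \<Longrightarrow> l \<le> snd wr \<Longrightarrow> bloch_below F (est l) l"
    and est_step: "\<And>l l'. 0 < l' \<Longrightarrow> l' \<le> l \<Longrightarrow> l \<le> snd wr \<Longrightarrow> est l' = est l \<or> est l' \<le> est l / 2"
    and est_lim: "(est \<longlongrightarrow> 0) (at_right 0)"
  shows "hausdorff_measure s (convergent_boundary_set F \<inter> cube_of wr) \<noteq> 0"
proof -
  obtain M \<rho> where M: "large M" and \<rho>: "0 < \<rho>" "\<rho> < 1" "\<rho> powr (DIM('a) - s) \<le> c\<^sub>1 / 16" "ln (1 / \<rho>) \<le> c\<^sub>1 * M / 16 - DIM('a)"
    using exists_large[OF s(2)] .
  have est_small: "\<exists>\<delta>>0. \<forall>l. 0 < l \<longrightarrow> l \<le> \<delta> \<longrightarrow> est l < \<eta>" if "0 < \<eta>" for \<eta>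
  proof -
    have "\<forall>\<^sub>F l in at_right 0. est l < \<eta>" by (rule order_tendstoD(2)[OF est_lim that])
    then obtain b where "0 < b" "\<And>l. 0 < l \<Longrightarrow> l < b \<Longrightarrow> est l < \<eta>"
      unfolding eventually_at_right_field by blast
    thus ?thesis by (intro exI[of _ "b / 2"]) auto
  qed
  have small: "\<exists>R. c / N ^ R \<le> \<delta>" if "0 < \<delta>" for c \<delta> :: real
    using exists_power_scale_less[OF N2 that, of c] less_imp_le by blast
  \<comment> \<open>Take \<open>R\<close> so deep that \<open>est\<close> has halved and the side
    has shrunk by \<open>\<rho>\<close>. At that depth stopped or unstopped leaves fill half the
    volume.\<close>
  have dich: "(\<exists>R. cube_vol w / 2 \<le> stopped_mass w (M * est (snd w)) R) \<or>
      (\<exists>R. est (snd w / N ^ R) \<le> est (snd w) / 2 \<and> snd w / N ^ R \<le> \<rho> * snd w \<and>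
        cube_vol w / 2 \<le> unstopped_mass w (M * est (snd w)) R)"
    if w: "0 < snd w" "snd w \<le> snd wr" and "cube_of w \<subseteq> cube_of wr" for w
  proof -
    obtain \<delta> where \<delta>: "0 < \<delta>" "\<And>l. 0 < l \<Longrightarrow> l \<le> \<delta> \<Longrightarrow> est l < est (snd w) / 2"
      using est_small[of "est (snd w) / 2"] est_pos[OF w] by auto
    obtain R where R: "snd w / N ^ R \<le> min \<delta> (\<rho> * snd w)" using small[of "min \<delta> (\<rho> * snd w)" "snd w"] \<delta> \<rho> w by auto
    have "est (snd w / N ^ R) \<le> est (snd w) / 2" using \<delta>(2)[of "snd w / N ^ R"] R w N0 by simp
    thus ?thesis using R stopped_unstopped[OF w(1), of "stop w (M * est (snd w))" R]
      by (cases "cube_vol w / 2 \<le> stopped_mass w (M * est (snd w)) R")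
         (blast, intro disjI2 exI[of _ R], simp)
  qed
  show ?thesis
  proof (rule hausdorff_measure_tree[OF wr s M est_pos est_bloch est_step \<rho> dich])
    fix W :: "nat \<Rightarrow> 'a \<times> real" and v e Q x
    assume W: "W 0 = wr" "\<And>j. W (Suc j) \<in> ch (W j)" "\<And>j. grad F (W j) \<in> cball (v j) (Q * e j)"
      "\<And>j. cball (v (Suc j)) (Q * e (Suc j)) \<subseteq> cball (v j) (Q * e j)" "\<And>j. 0 \<le> e j"
      "\<And>j. \<exists>i l. 0 < l \<and> l \<le> snd (W j) \<and> e i \<le> est l" and x: "\<And>j. x \<in> cube_of (W j)"
    have W0: "0 < snd (W 0)" using wr W(1) by simp
    note cs = chain_snd[OF W0 W(2)]
    have nest: "cball (v j) (Q * e j) \<subseteq> cball (v i) (Q * e i)" if "i \<le> j" for i j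
      using that by (induction rule: dec_induct) (use W(4) in blast)+
    have e_small: "\<exists>i. Q * e i < \<eta>" if \<eta>: "0 < \<eta>" for \<eta>
    proof (cases "Q \<le> 0")
      case True
      hence "Q * e 0 \<le> 0" using W(5)[of 0] by (simp add: mult_nonpos_nonneg)
      thus ?thesis using \<eta> by (intro exI[of _ 0]) simp
    next
      case False
      obtain \<delta> where \<delta>: "0 < \<delta>" "\<And>l. 0 < l \<Longrightarrow> l \<le> \<delta> \<Longrightarrow> est l < \<eta> / Q" using est_small[of "\<eta> / Q"] \<eta> False by auto
      obtain j where "snd (W j) \<le> \<delta>" using small[OF \<delta>(1), of "snd (W 0)"] cs(1) by metis
      then obtain i l where "0 < l" "l \<le> \<delta>" "e i \<le> est l" using W(6)[of j] order_trans by metis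
      hence "e i < \<eta> / Q" using \<delta>(2)[of l] by simp
      thus ?thesis using False by (intro exI[of _ i]) (simp add: field_simps)
    qed
    have "Cauchy (\<lambda>j. grad F (W j))"
    proof (rule metric_CauchyI)
      fix \<eta> :: real assume "0 < \<eta>"
      then obtain i where i: "Q * e i < \<eta> / 2" using e_small[of "\<eta> / 2"] by auto
      have "dist (v i) (grad F (W j)) < \<eta> / 2" if "i \<le> j" for j
        using W(3)[of j] nest[OF that] i by fastforce
      thus "\<exists>M. \<forall>m\<ge>M. \<forall>n\<ge>M. dist (grad F (W m)) (grad F (W n)) < \<eta>"
        by (intro exI[of _ i]) (metis dist_commute dist_triangle_half_l)
    qed
    then obtain G where G: "(\<lambda>j. grad F (W j)) \<longlonglongrightarrow> G" using Cauchy_convergent convergent_def by blast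
    have "((\<lambda>y. grad F (x, y)) \<longlongrightarrow> G) (at_right 0)"
    proof (rule tendstoI)
      fix \<eta> :: real assume \<eta>: "0 < \<eta>"
      obtain J where J: "\<And>j. J \<le> j \<Longrightarrow> dist (grad F (W j)) G < \<eta> / 2"
        using metric_LIMSEQ_D[OF G, of "\<eta> / 2"] \<eta> by auto
      obtain \<delta> where \<delta>: "0 < \<delta>" "\<And>l. 0 < l \<Longrightarrow> l \<le> \<delta> \<Longrightarrow> est l < \<eta> / 2 / osc"
        using est_small[of "\<eta> / 2 / osc"] \<eta> osc_pos by auto
      \<comment> \<open>Below \<open>y0\<close>, a chain cube of side between \<open>y\<close> and
        \<open>N * y\<close> has index at least \<open>J\<close> and side at most
        \<open>\<delta>\<close>.\<close>
      define y0 where "y0 = min (snd (W J) / N) (min (\<delta> / N) (snd (W 0)))"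
      have y0: "0 < y0" using cs(2)[of J] N0 \<delta> W0 by (simp add: y0_def)
      have "dist (grad F (x, y)) G < \<eta>" if y: "0 < y" "y < y0" for y
      proof -
        have yb: "N * y \<le> snd (W J)" "N * y \<le> \<delta>" "y \<le> snd (W 0)"
          using y N0 by (auto simp: y0_def pos_less_divide_eq mult.commute)
        obtain j where j: "y \<le> snd (W j)" "snd (W j) < N * y" using chain_scale[OF W0 W(2) y(1) yb(3)] .
        have "J \<le> j"
        proof (rule ccontr)
          assume "\<not> J \<le> j"
          hence "real N ^ j \<le> real N ^ J" using N0 by (intro power_increasing) auto
          hence "snd (W J) \<le> snd (W j)" unfolding cs(1)[of J] cs(1)[of j] using W0 N0 by (intro divide_left_mono) auto
          thus False using j yb by simp
        qed
        have sj: "0 < snd (W j)" "snd (W j) \<le> snd wr"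
        proof -
          show "0 < snd (W j)" by (rule cs(2))
          have "1 \<le> real N ^ j" using N0 by simp
          thus "snd (W j) \<le> snd wr" unfolding cs(1)[of j] W(1) using wr N0 by (simp add: divide_le_eq mult_le_cancel_left1)
        qed
        have "norm (grad F (x, y) - grad F (W j)) \<le> est (snd (W j)) * osc"
          using grad_osc_scale[OF est_bloch[OF sj] sj(1) _ y(1) j] x by blast
        also have "\<dots> < \<eta> / 2" using \<delta>(2)[OF sj(1)] j yb osc_pos by (simp add: pos_less_divide_eq)
        finally have "dist (grad F (x, y)) (grad F (W j)) < \<eta> / 2" by (simp add: dist_norm)
        thus ?thesis using J[OF \<open>J \<le> j\<close>] by (metis dist_commute dist_triangle_half_l)
      qed
      thus "\<forall>\<^sub>F y in at_right 0. dist (grad F (x, y)) G < \<eta>"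
        unfolding eventually_at_right_field using y0 by blast
    qed
    thus "x \<in> convergent_boundary_set F" unfolding convergent_boundary_set_def by blast
  qed
qed

end

lemma grad_Bloch_bloch_below:
  fixes F :: "'a::euclidean_space \<times> real \<Rightarrow> real"
  assumes "grad_Bloch F"
  obtains \<epsilon> where "0 < \<epsilon>" "\<And>l. bloch_below F \<epsilon> l"
proof -
  define S where "S = (SUP (x, y)\<in>upper_half_space. ereal (y * hess_norm F (x, y)))"
  have S: "S < \<infinity>" using assms by (simp add: grad_Bloch_def S_def)
  have up: "ereal (y * hess_norm F (x, y)) \<le> S" if "0 < y" for x y
    unfolding S_def using that by (intro SUP_upper2[of "(x, y)"]) (auto simp: upper_half_space_iff)
  \<comment> \<open>Adding 1 makes the bound positive even if the Hessian vanishes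
    identically.\<close>
  define \<epsilon> where "\<epsilon> = real_of_ereal S + 1"
  have "0 \<le> 1 * hess_norm F (0, 1)" using hess_norm_nonneg[of F "(0, 1)"] by simp
  hence "0 \<le> S" using up[of 1 0] by (metis ereal_less_eq(5) order_trans zero_less_one)
  hence S_eq: "S = ereal (real_of_ereal S)" "0 \<le> real_of_ereal S" using S by (auto simp: ereal_real real_of_ereal_pos)
  have "bloch_below F \<epsilon> l" for l
    unfolding bloch_below_def
  proof (intro allI impI)
    fix x y assume "0 < y" "y \<le> l"
    hence "ereal (y * hess_norm F (x, y)) \<le> ereal (real_of_ereal S)" using up S_eq by metis
    thus "y * hess_norm F (x, y) \<le> \<epsilon>" by (simp add: \<epsilon>_def)
  qed
  thus ?thesis using that[of \<epsilon>] S_eq by (simp add: \<epsilon>_def)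
qed

text \<open>The estimate is quantized to powers of \<open>1/2\<close>, so that it changes only by halvings.\<close>

lemma grad_little_Bloch_estimate:
  fixes F :: "'a::euclidean_space \<times> real \<Rightarrow> real"
  assumes "grad_little_Bloch F" "0 < l0"
  obtains L est where "0 < L" "L \<le> l0" "\<And>l. 0 < l \<Longrightarrow> l \<le> L \<Longrightarrow> 0 < est l"
    "\<And>l. 0 < l \<Longrightarrow> l \<le> L \<Longrightarrow> bloch_below F (est l) l"
    "\<And>l l'. 0 < l' \<Longrightarrow> l' \<le> l \<Longrightarrow> l \<le> L \<Longrightarrow> est l' = est l \<or> est l' \<le> est l / (2::real)"
    "(est \<longlongrightarrow> 0) (at_right 0)"
proof -
  define h where "h p = (1 / 2 :: real) ^ p" for p :: nat
  have h0: "0 < h p" for p by (simp add: h_def)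
  have ex: "\<exists>\<delta>>0. bloch_below F (h p) \<delta>" for p
  proof -
    have "\<forall>\<^sub>F y in at_right 0. (SUP x. ereal (y * hess_norm F (x, y))) < ereal (h p)"
      using assms(1) h0[of p] unfolding grad_little_Bloch_def by (intro order_tendstoD(2)) auto
    then obtain b where b: "0 < b" "\<And>y. 0 < y \<Longrightarrow> y < b \<Longrightarrow> (SUP x. ereal (y * hess_norm F (x, y))) < ereal (h p)"
      unfolding eventually_at_right_field by blast
    have "bloch_below F (h p) (b / 2)"
      unfolding bloch_below_def
    proof (intro allI impI)
      fix x y assume y: "0 < y" "y \<le> b / 2"
      have "ereal (y * hess_norm F (x, y)) \<le> (SUP x. ereal (y * hess_norm F (x, y)))" by (rule SUP_upper) simp
      also have "\<dots> < ereal (h p)" using b y by simp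
      finally show "y * hess_norm F (x, y) \<le> h p" by simp
    qed
    thus ?thesis using b by (intro exI[of _ "b / 2"]) simp
  qed
  obtain \<delta>0 where \<delta>0: "0 < \<delta>0" "bloch_below F (h 0) \<delta>0" using ex by blast
  define L where "L = min l0 \<delta>0"
  have L: "0 < L" "L \<le> l0" using assms \<delta>0 by (auto simp: L_def)
  \<comment> \<open>The cap \<open>1 / l\<close> keeps the set finite, so that a maximum exists even
    where the Hessian vanishes, and it tends to infinity as \<open>l\<close> tends to 0.\<close>
  define P where "P l = {p::nat. real p \<le> 1 / l \<and> bloch_below F (h p) l}" for l
  have finP: "finite (P l)" for l
    by (rule finite_subset[of _ "{..nat \<lceil>1 / l\<rceil>}"]) (auto simp: P_def, linarith)
  have P0: "0 \<in> P l" if "0 < l" "l \<le> L" for l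
    using that bloch_below_mono[OF \<delta>0(2), of l "h 0"] by (auto simp: P_def L_def)
  define p where "p l = Max (P l)" for l
  have pP: "p l \<in> P l" if "0 < l" "l \<le> L" for l unfolding p_def using finP P0[OF that] by (intro Max_in) auto
  have p_mono: "p l \<le> p l'" if "0 < l'" "l' \<le> l" "l \<le> L" for l l'
  proof -
    have "1 / l \<le> 1 / l'" using that by (intro divide_left_mono) auto
    hence "P l \<subseteq> P l'" using that bloch_below_mono by (fastforce simp: P_def)
    thus ?thesis unfolding p_def using finP P0[of l] that by (intro Max_mono) auto
  qed
  show ?thesis
  proof (rule that[OF L, of "\<lambda>l. h (p l)"])
    show "0 < h (p l)" for l by (rule h0)
    show "bloch_below F (h (p l)) l" if "0 < l" "l \<le> L" for l using pP[OF that] by (simp add: P_def)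
    show "h (p l') = h (p l) \<or> h (p l') \<le> h (p l) / 2" if "0 < l'" "l' \<le> l" "l \<le> L" for l l'
    proof (cases "p l' = p l")
      case False
      hence "Suc (p l) \<le> p l'" using p_mono[OF that] by simp
      hence "h (p l') \<le> h (Suc (p l))" unfolding h_def by (intro power_decreasing) auto
      thus ?thesis by (simp add: h_def)
    qed simp
    show "((\<lambda>l. h (p l)) \<longlongrightarrow> 0) (at_right 0)"
    proof (rule tendstoI)
      fix \<eta> :: real assume "0 < \<eta>"
      then obtain q where q: "h q < \<eta>" unfolding h_def using real_arch_pow_inv[of \<eta> "1 / 2"] by auto
      obtain \<delta> where \<delta>: "0 < \<delta>" "bloch_below F (h q) \<delta>" using ex by blast
      define b where "b = min L (min \<delta> (1 / (real q + 1)))"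
      have b: "0 < b" using L \<delta> by (simp add: b_def)
      have "dist (h (p l)) 0 < \<eta>" if l: "0 < l" "l < b" for l
      proof -
        have "l \<le> 1 / (real q + 1)" using l by (simp add: b_def)
        hence "real q \<le> 1 / l" using l by (simp add: field_simps)
        hence "q \<in> P l" using l bloch_below_mono[OF \<delta>(2), of l "h q"] by (simp add: P_def b_def)
        hence "q \<le> p l" unfolding p_def using finP by (intro Max_ge) auto
        hence "h (p l) \<le> h q" unfolding h_def by (intro power_decreasing) auto
        thus ?thesis using q h0[of "p l"] by (simp add: dist_real_def)
      qed
      thus "\<forall>\<^sub>F l in at_right 0. dist (h (p l)) 0 < \<eta>" unfolding eventually_at_right_field using b by blast
    qed
  qed
qed

theorem theorem1:
  fixes F :: "(real ^ 'n) \<times> real \<Rightarrow> real"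
  assumes "harmonic_on F upper_half_space"
    and "grad_weakly_quasiregular F"
  shows "(grad_Bloch F \<longrightarrow>
            (\<forall>(a :: real ^ 'n) l. l > 0 \<longrightarrow>
              hausdorff_dim (bounded_boundary_set F \<inter> cube a l) = of_nat CARD('n))) \<and>
         (grad_little_Bloch F \<longrightarrow>
            (\<forall>(a :: real ^ 'n) l. l > 0 \<longrightarrow>
              hausdorff_dim (convergent_boundary_set F \<inter> cube a l) = of_nat CARD('n)))"
proof -
  obtain N \<kappa> where N: "2 \<le> N" "1 \<le> \<kappa>"
    "\<And>w e e'. 0 < snd w \<Longrightarrow> norm e = 1 \<Longrightarrow> norm e' = 1 \<Longrightarrow> energy F N e' w \<le> \<kappa> * energy F N e w"
  proof (rule weakly_quasiregular_energy[OF assms])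
    fix N \<kappa>
    assume "2 \<le> N" "1 \<le> \<kappa>"
      "\<And>w e e'. 0 < snd w \<Longrightarrow> norm e = 1 \<Longrightarrow> norm e' = 1 \<Longrightarrow> energy F N e' w \<le> \<kappa> * energy F N e w"
    thus thesis by (rule that)
  qed
  interpret harmonic_energy_comparison F N \<kappa> by unfold_locales (use assms N in auto)
  have dim: "hausdorff_dim (A \<inter> cube a l) = of_nat CARD('n)"
    if "0 < l" "\<And>s::real. 0 < s \<Longrightarrow> s < CARD('n) \<Longrightarrow> hausdorff_measure s (A \<inter> cube a l) \<noteq> 0" for A and a :: "real ^ 'n" and l
    using hausdorff_dim_eq_DIM[of "(a, l)" "A \<inter> cube a l"] that by (simp add: cube_of_def)
  show ?thesis
  proof (intro conjI impI allI)
    fix a :: "real ^ 'n" and l :: real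
    assume B: "grad_Bloch F" and l: "0 < l"
    obtain \<epsilon> where \<epsilon>: "0 < \<epsilon>" "\<And>l. bloch_below F \<epsilon> l"
    proof (rule grad_Bloch_bloch_below[OF B])
      fix \<epsilon> :: real assume "0 < \<epsilon>" "\<And>l. bloch_below F \<epsilon> l"
      thus thesis by (rule that)
    qed
    show "hausdorff_dim (bounded_boundary_set F \<inter> cube a l) = of_nat CARD('n)"
      using hausdorff_measure_bounded_boundary_set[of "(a, l)" _ \<epsilon>] l \<epsilon> by (intro dim) (auto simp: cube_of_def)
  next
    fix a :: "real ^ 'n" and l :: real
    assume B: "grad_little_Bloch F" and l: "0 < l"
    obtain L est where L: "0 < L" "L \<le> l" "\<And>l. 0 < l \<Longrightarrow> l \<le> L \<Longrightarrow> 0 < est l"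
      "\<And>l. 0 < l \<Longrightarrow> l \<le> L \<Longrightarrow> bloch_below F (est l) l"
      "\<And>l l'. 0 < l' \<Longrightarrow> l' \<le> l \<Longrightarrow> l \<le> L \<Longrightarrow> est l' = est l \<or> est l' \<le> est l / (2::real)"
      "(est \<longlongrightarrow> 0) (at_right 0)"
    proof (rule grad_little_Bloch_estimate[OF B l])
      fix L :: real and est :: "real \<Rightarrow> real"
      assume "0 < L" "L \<le> l" "\<And>l. 0 < l \<Longrightarrow> l \<le> L \<Longrightarrow> 0 < est l"
        "\<And>l. 0 < l \<Longrightarrow> l \<le> L \<Longrightarrow> bloch_below F (est l) l"
        "\<And>l l'. 0 < l' \<Longrightarrow> l' \<le> l \<Longrightarrow> l \<le> L \<Longrightarrow> est l' = est l \<or> est l' \<le> est l / 2"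
        "(est \<longlongrightarrow> 0) (at_right 0)"
      thus thesis by (rule that)
    qed
    \<comment> \<open>The estimate is available only up to scale \<open>L\<close>, so the set is
      constructed in a smaller cube with the same corner.\<close>
    have sub: "cube_of (a, L) \<subseteq> cube a l"
      using L(2) by (force simp: mem_cube_of cube_def mem_box inner_simps)
    show "hausdorff_dim (convergent_boundary_set F \<inter> cube a l) = of_nat CARD('n)"
    proof (rule dim[OF l])
      fix s :: real assume s: "0 < s" "s < CARD('n)"
      have "hausdorff_measure s (convergent_boundary_set F \<inter> cube_of (a, L)) \<noteq> 0"
        by (rule hausdorff_measure_convergent_boundary_set[of "(a, L)" s est]) (use L s in auto)
      moreover have "hausdorff_measure s (convergent_boundary_set F \<inter> cube_of (a, L))
          \<le> hausdorff_measure s (convergent_boundary_set F \<inter> cube a l)"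
        using sub by (intro hausdorff_measure_mono) auto
      ultimately show "hausdorff_measure s (convergent_boundary_set F \<inter> cube a l) \<noteq> 0" by auto
    qed
  qed
qed

end
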